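(* Every anti-involution of $\Lambda$ is $\Gamma$-conjugate to exactly one of $\pm\xi_0,\pm\xi_1,\dots,\pm\xi_4$. Two anti-involutions of $\Lambda$ are $\Gamma$-conjugate if and only if the restrictions of $q$ to their two fixed spaces in $V$ have the same dimension and determinant (equivalently, if and only if the restrictions of $q$ to their two $(-1)$-eigenspaces in $V$ have the same dimension and determinant).
   Context: Let $\omega=e^{2\pi i/3}$, $\mathcal{E}=\mathbb{Z}[\omega]$ the Eisenstein integers, and $\theta=\omega-\bar\omega=\sqrt{-3}$. Let $\Lambda=\mathcal{E}^5$ with Hermitian form $h(x,y)=-x_0\bar y_0+x_1\bar y_1+\dots+x_4\bar y_4$, and let $\Gamma=\mathrm{Aut}(\Lambda)$ be the group of $\mathcal{E}$-linear isometries of $\Lambda$. An anti-involution of $\Lambda$ is an additive bijection $\xi:\Lambda\to\Lambda$ with $\xi(ax)=\bar a\,\xi(x)$ for $a\in\mathcal{E}$, $\xi^2=\mathrm{id}$, and $h(\xi x,\xi y)=\overline{h(x,y)}$. For $j=0,\dots,4$ let $\xi_j$ be the anti-involution $(x_0,\dots,x_4)\mapsto(\bar x_0,\dots,\bar x_{4-j},-\bar x_{5-j},\dots,-\bar x_4)$, i.e. conjugate all coordinates and negate the last $j$ of them. Let $V=\Lambda/\theta\Lambda$, a $5$-dimensional vector space over $\mathbb{F}_3=\mathcal{E}/\theta\mathcal{E}$, with the quadratic form $q$ obtained by reducing $h$ modulo $\theta$. Each anti-involution induces an $\mathbb{F}_3$-linear involution of $V$; its fixed space and its $(-1)$-eigenspace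 carry the restriction of $q$, whose determinant lies in $\mathbb{F}_3^*/(\mathbb{F}_3^* )^2=\{\pm1\}$ (the zero space having determinant $+1$). *)

theory Defs
  imports Complex_Main "HOL-Library.Numeral_Type" "Jordan_Normal_Form.Determinant"
begin

definition omega :: complex where
  "omega = cis (2 * pi / 3)"

definition Eis :: "complex set" where
  "Eis = {of_int a + of_int b * omega | a b. True}"

text \<open>Vectors of C^5 are modelled as functions nat => complex, vanishing outside {0..4}.\<close>

definition Lam :: "(nat \<Rightarrow> complex) set" where
  "Lam = {x. (\<forall>i<5. x i \<in> Eis) \<and> (\<forall>i\<ge>5. x i = 0)}"

definition vadd :: "(nat \<Rightarrow> complex) \<Rightarrow> (nat \<Rightarrow> complex) \<Rightarrow> nat \<Rightarrow> complex" where
  "vadd x y = (\<lambda>i. x i + y i)"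

definition smul :: "complex \<Rightarrow> (nat \<Rightarrow> complex) \<Rightarrow> nat \<Rightarrow> complex" where
  "smul a x = (\<lambda>i. a * x i)"

definition hform :: "(nat \<Rightarrow> complex) \<Rightarrow> (nat \<Rightarrow> complex) \<Rightarrow> complex" where
  "hform x y = (\<Sum>i<5. (if i = 0 then -1 else 1) * x i * cnj (y i))"

definition anti_involution :: "((nat \<Rightarrow> complex) \<Rightarrow> (nat \<Rightarrow> complex)) \<Rightarrow> bool" where
  "anti_involution \<xi> \<longleftrightarrow>
     bij_betw \<xi> Lam Lam \<and>
     (\<forall>x\<in>Lam. \<forall>y\<in>Lam. \<xi> (vadd x y) = vadd (\<xi> x) (\<xi> y)) \<and>
     (\<forall>a\<in>Eis. \<forall>x\<in>Lam. \<xi> (smul a x) = smul (cnj a) (\<xi> x)) \<and>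
     (\<forall>x\<in>Lam. \<xi> (\<xi> x) = x) \<and>
     (\<forall>x\<in>Lam. \<forall>y\<in>Lam. hform (\<xi> x) (\<xi> y) = cnj (hform x y))"

definition in_Gamma :: "((nat \<Rightarrow> complex) \<Rightarrow> (nat \<Rightarrow> complex)) \<Rightarrow> bool" where
  "in_Gamma g \<longleftrightarrow>
     bij_betw g Lam Lam \<and>
     (\<forall>x\<in>Lam. \<forall>y\<in>Lam. g (vadd x y) = vadd (g x) (g y)) \<and>
     (\<forall>a\<in>Eis. \<forall>x\<in>Lam. g (smul a x) = smul a (g x)) \<and>
     (\<forall>x\<in>Lam. \<forall>y\<in>Lam. hform (g x) (g y) = hform x y)"

definition Gamma_conj ::
  "((nat \<Rightarrow> complex) \<Rightarrow> (nat \<Rightarrow> complex)) \<Rightarrow> ((nat \<Rightarrow> complex) \<Rightarrow> (nat \<Rightarrow> complex)) \<Rightarrow> bool" where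
  "Gamma_conj \<xi> \<eta> \<longleftrightarrow> (\<exists>g. in_Gamma g \<and> (\<forall>x\<in>Lam. g (\<xi> x) = \<eta> (g x)))"

definition xi :: "nat \<Rightarrow> (nat \<Rightarrow> complex) \<Rightarrow> nat \<Rightarrow> complex" where
  "xi j x = (\<lambda>i. if i < 5 then (if 5 - j \<le> i then - cnj (x i) else cnj (x i)) else 0)"

definition std :: "bool \<Rightarrow> nat \<Rightarrow> (nat \<Rightarrow> complex) \<Rightarrow> nat \<Rightarrow> complex" where
  "std s j = (if s then xi j else (\<lambda>x i. - xi j x i))"

section \<open>V = Lambda / theta Lambda, identified with F_3^5\<close>

text \<open>The unique ring isomorphism E/theta E -> F_3 sends omega to 1, so a + b omega maps to a + b mod 3.
  F_3 is the numeral type 3.\<close>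
definition red_E :: "complex \<Rightarrow> 3" where
  "red_E z = (THE c. \<exists>a b. z = of_int a + of_int b * omega \<and> c = of_int (a + b))"

definition red :: "(nat \<Rightarrow> complex) \<Rightarrow> nat \<Rightarrow> 3" where
  "red x = (\<lambda>i. if i < 5 then red_E (x i) else 0)"

definition Vsp :: "(nat \<Rightarrow> 3) set" where
  "Vsp = red ` Lam"

definition fix_space :: "((nat \<Rightarrow> complex) \<Rightarrow> (nat \<Rightarrow> complex)) \<Rightarrow> (nat \<Rightarrow> 3) set" where
  "fix_space \<xi> = {red x | x. x \<in> Lam \<and> red (\<xi> x) = red x}"

definition neg_space :: "((nat \<Rightarrow> complex) \<Rightarrow> (nat \<Rightarrow> complex)) \<Rightarrow> (nat \<Rightarrow> 3) set" where
  "neg_space \<xi> = {red x | x. x \<in> Lam \<and> red (\<xi> x) = (\<lambda>i. - red x i)}"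

text \<open>Symmetric bilinear form of q (reduction of h mod theta): q(v) = bq v v.\<close>
definition bq :: "(nat \<Rightarrow> 3) \<Rightarrow> (nat \<Rightarrow> 3) \<Rightarrow> 3" where
  "bq v w = (\<Sum>i<5. (if i = 0 then -1 else 1) * v i * w i)"

definition lincomb :: "(nat \<Rightarrow> 3) \<Rightarrow> (nat \<Rightarrow> 3) list \<Rightarrow> nat \<Rightarrow> 3" where
  "lincomb c bs = (\<lambda>i. \<Sum>a<length bs. c a * (bs ! a) i)"

definition is_basis :: "(nat \<Rightarrow> 3) set \<Rightarrow> (nat \<Rightarrow> 3) list \<Rightarrow> bool" where
  "is_basis W bs \<longleftrightarrow>
     (\<forall>c. lincomb c bs = (\<lambda>_. 0) \<longrightarrow> (\<forall>a<length bs. c a = 0)) \<and>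
     {lincomb c bs | c. True} = W"

definition gram_det :: "(nat \<Rightarrow> 3) list \<Rightarrow> 3" where
  "gram_det bs = det (mat (length bs) (length bs) (\<lambda>(a, b). bq (bs ! a) (bs ! b)))"

text \<open>Dimension of W, and determinant of q restricted to W (Gram determinant w.r.t. a basis;
  since (F_3^*)^2 = {1}, this element of F_3 is basis independent and determines the class
  in F_3^*/(F_3^*)^2; the zero space gets the empty determinant 1).\<close>
definition qdim :: "(nat \<Rightarrow> 3) set \<Rightarrow> nat" where
  "qdim W = (SOME d. \<exists>bs. is_basis W bs \<and> length bs = d)"

definition qdet :: "(nat \<Rightarrow> 3) set \<Rightarrow> 3" where
  "qdet W = (SOME e. \<exists>bs. is_basis W bs \<and> gram_det bs = e)"

end

theory Submission
  imports Defs "HOL-Analysis.L2_Norm"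
begin

text \<open>
  Write \<open>L\<close> for the \<open>\<int>\<close>-lattice fixed by an anti-involution \<open>\<xi>\<close>; it is Lorentzian of rank 5, and
  \<open>\<theta>\<Lambda>\<close> lies in the \<open>\<E>\<close>-span of \<open>L\<close>, so the Gram determinant of \<open>L\<close> is \<open>- 3 ^ k\<close>. After possibly
  scaling the form by 3 the exponent is odd, and as long as it is at least 3 some vector \<open>x / 3\<close> can be
  adjoined, because ternary forms over \<open>\<FF>\<^sub>3\<close> are isotropic. A Hermite-reduced basis of an anisotropic
  lattice of determinant \<open>-3\<close> would have pivots \<open>1, 1, 1, 1, -3\<close> up to a negative pivot \<open>-1\<close>, which is
  absurd; hence \<open>L\<close> contains an isotropic vector.

  A shortest isotropic vector among those with \<open>\<xi> \<rho> = \<plusminus> \<rho>\<close> lies in a \<open>\<xi>\<close>-stable hyperbolic plane, whose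
  complement in \<open>\<Lambda>\<close> is definite, unimodular of rank 3, and therefore (Hermite reduction over the Euclidean
  ring \<open>\<E>\<close>) has an orthonormal basis. Its three coordinate lines are permuted by \<open>\<xi>\<close>, so one is fixed;
  a swapped pair of lines can be traded, together with the vector of norm \<open>-1\<close>, for eigenvectors. This
  produces an orthonormal frame of eigenvectors of \<open>\<xi>\<close>, that is, a conjugacy with some \<open>\<plusminus> \<xi>\<^sub>j\<close>.
  The ten candidates are told apart by dimension and determinant modulo \<open>\<theta>\<close>.
\<close>

section \<open>Hermitian forms on lists of vectors\<close>

text \<open>That an indefinite form in five variables is isotropic is Meyer's theorem; the special
  determinant permits an elementary substitute. It runs by contradiction because Hermite reduction
  of an indefinite form needs every pivot to be nonzero, which anisotropy guarantees. Adjoining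
  \<open>x / 3\<close> divides the determinant by 9, so only an odd exponent descends to
  \<open>-3\<close>; as the rank is odd, scaling by 3 changes the parity of the exponent. At
  determinant \<open>-3\<close> the classical factor 3/4 between consecutive pivots does not exclude
  a first pivot of absolute value 2; the sharper factor 5/4 at a change of sign barely does.

  Both signs of \<xi> have to be treated together because multiplication by \<theta> exchanges fixed
  and negated vectors, \<theta> being purely imaginary. This exchange is what makes a shortest
  vector pair to 1 with a fixed vector. The remaining obstacle is parity: the hyperbolic plane may
  be even, and then has no fixed orthonormal basis; an eigenvector of norm one from its complement
  repairs this.\<close>

type_synonym cvec = "nat \<Rightarrow> complex"
type_synonym cform = "cvec \<Rightarrow> cvec \<Rightarrow> complex"

definition hermitian :: "cform \<Rightarrow> bool" where
  "hermitian b \<longleftrightarrow> (\<forall>x y z. b (vadd x y) z = b x z + b y z) \<and>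
     (\<forall>a x y. b (smul a x) y = a * b x y) \<and> (\<forall>x y. b y x = cnj (b x y))"

text \<open>
  The form obtained by projecting along \<open>v\<close>, kept as a form on the whole space: Gram-Schmidt then acts
  on forms, and a list of vectors never has to be projected. It is meant for \<open>b v v \<noteq> 0\<close> only.
\<close>

definition schur :: "cform \<Rightarrow> cvec \<Rightarrow> cform" where
  "schur b v = (\<lambda>x y. b x y - b x v * b v y / b v v)"

lemma hermitianD:
  assumes "hermitian b"
  shows "b (vadd x y) z = b x z + b y z" "b (smul a x) y = a * b x y"
    "b z (vadd x y) = b z x + b z y" "b y (smul a x) = cnj a * b y x"
    "cnj (b x y) = b y x" "b x x \<in> \<real>" "Im (b x x) = 0"
proof -
  have l: "\<And>x y z. b (vadd x y) z = b x z + b y z" "\<And>a x y. b (smul a x) y = a * b x y"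
    and c: "\<And>x y. b y x = cnj (b x y)"
    using assms unfolding hermitian_def by blast+
  show "b (vadd x y) z = b x z + b y z" "b (smul a x) y = a * b x y" by (rule l)+
  show "b z (vadd x y) = b z x + b z y"
    using l(1)[of x y z] c by (metis complex_cnj_add)
  show "b y (smul a x) = cnj a * b y x"
    using l(2)[of a x y] c by (metis complex_cnj_mult)
  have cc: "\<And>x y. cnj (b x y) = b y x" by (metis c complex_cnj_cnj)
  thus "cnj (b x y) = b y x" .
  show "b x x \<in> \<real>" using cc[of x x] by (simp add: Reals_cnj_iff)
  thus "Im (b x x) = 0" by (simp add: complex_is_Real_iff)
qed

lemma hermitian_zero: "hermitian b \<Longrightarrow> b (\<lambda>_. 0) y = 0"
proof -
  assume "hermitian b"
  from hermitianD(2)[OF this, of 0 "\<lambda>_. 0" y] show ?thesis by (simp add: smul_def)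
qed

lemma hermitian_schur: assumes "hermitian b" shows "hermitian (schur b v)"
proof -
  note h = hermitianD[OF assms]
  show ?thesis unfolding hermitian_def schur_def
    by (auto simp: h algebra_simps add_divide_distrib)
qed

text \<open>Replacing both arguments by their projections along \<open>v\<close> leaves exactly the
  correction term of \<open>schur\<close>. Signs and anisotropy pass from \<open>b\<close> to
  \<open>schur b v\<close> through this identity, since the right side evaluates \<open>b\<close>
  itself.\<close>

lemma schur_proj:
  assumes h: "hermitian b" and v: "b v v \<noteq> 0"
  shows "schur b v x y = b (vadd x (smul (- (b x v / b v v)) v)) (vadd y (smul (- (b y v / b v v)) v))"
proof -
  note hh = hermitianD[OF h]
  have "cnj (b y v / b v v) = b v y / b v v" by (simp add: hh)
  thus ?thesis using v unfolding schur_def by (simp add: hh field_simps)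
qed

lemma schur_radical:
  assumes "hermitian b" "b v v \<noteq> 0"
  shows "schur b v v y = 0" "schur b v y v = 0"
  using assms by (auto simp: schur_def)

section \<open>Gram determinants and elementary moves on lists of vectors\<close>

definition gram :: "cform \<Rightarrow> cvec list \<Rightarrow> complex mat" where
  "gram b vs = mat (length vs) (length vs) (\<lambda>(i, j). b (vs ! i) (vs ! j))"

definition gdet :: "cform \<Rightarrow> cvec list \<Rightarrow> complex" where
  "gdet b vs = det (gram b vs)"

lemma gram_carrier [simp]: "gram b vs \<in> carrier_mat (length vs) (length vs)"
  by (simp add: gram_def)

lemma gdet_Nil [simp]: "gdet b [] = 1"
  by (simp add: gdet_def gram_def)

text \<open>Block elimination: a unitriangular matrix clears the first column below the pivot, and
  the minor that remains is the Gram matrix of the Schur form on the unchanged tail. Iterated, this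
  writes a Gram determinant as a product of pivots.\<close>

lemma gdet_Cons:
  assumes v: "b v v \<noteq> 0"
  shows "gdet b (v # vs) = b v v * gdet (schur b v) vs"
proof -
  define n where "n = length vs"
  define w where "w = (\<lambda>i. (v # vs) ! i)"
  define G where "G = gram b (v # vs)"
  define l :: "nat \<Rightarrow> complex" where "l i = (if i = 0 then 0 else - b (w i) v / b v v)" for i
  define M where "M = mat (Suc n) (Suc n) (\<lambda>(i, j). if i = j then 1 else if j = 0 then l i else 0)"
  define U where "U = mat (Suc n) (Suc n) (\<lambda>(i, j). b (w i) (w j) + l i * b v (w j))"
  have Gc: "G \<in> carrier_mat (Suc n) (Suc n)" by (simp add: G_def gram_def n_def)
  have Mc: "M \<in> carrier_mat (Suc n) (Suc n)" by (simp add: M_def)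
  have Uc: "U \<in> carrier_mat (Suc n) (Suc n)" by (simp add: U_def)
  have dM: "det M = 1"
  proof -
    have "det M = prod_list (diag_mat M)"
      by (rule det_lower_triangular[OF _ Mc]) (auto simp: M_def)
    also have "diag_mat M = map (\<lambda>_. 1) [0..<Suc n]"
      unfolding diag_mat_def by (rule map_cong) (auto simp: M_def)
    finally show ?thesis by (simp add: prod_list_replicate map_replicate_const)
  qed
  have "M * G = U"
  proof (rule eq_matI)
    fix i j assume "i < dim_row U" "j < dim_col U"
    hence ij: "i < Suc n" "j < Suc n" by (auto simp: U_def)
    have "(M * G) $$ (i, j) = (\<Sum>k<Suc n. M $$ (i, k) * G $$ (k, j))"
      using ij Mc Gc by (simp add: scalar_prod_def lessThan_atLeast0)
    also have "\<dots> = (\<Sum>k<Suc n. (if k = i then b (w i) (w j) else 0) + (if k = 0 then l i * b v (w j) else 0))"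
      by (rule sum.cong) (use ij in \<open>auto simp: M_def G_def gram_def n_def w_def l_def\<close>)
    also have "\<dots> = b (w i) (w j) + l i * b v (w j)"
      using ij by (simp add: sum.distrib)
    finally show "(M * G) $$ (i, j) = U $$ (i, j)" using ij by (simp add: U_def)
  qed (use Mc Gc Uc in auto)
  hence "det G = det U" using det_mult[OF Mc Gc] dM by simp
  also have "\<dots> = (\<Sum>i<Suc n. U $$ (i, 0) * cofactor U i 0)"
    by (rule laplace_expansion_column[OF Uc]) simp
  also have "\<dots> = (\<Sum>i<Suc n. if i = 0 then b v v * cofactor U 0 0 else 0)"
    by (rule sum.cong) (use v in \<open>auto simp: U_def w_def l_def\<close>)
  also have "\<dots> = b v v * det (mat_delete U 0 0)"
    by (simp add: cofactor_def)
  also have "mat_delete U 0 0 = gram (schur b v) vs"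
    by (rule eq_matI) (auto simp: mat_delete_def U_def gram_def n_def w_def l_def schur_def)
  finally show ?thesis by (simp add: gdet_def G_def)
qed

text \<open>A transvection. Bases are changed by these moves because they preserve Gram determinants
  exactly and need no division.\<close>

definition mv :: "nat \<Rightarrow> nat \<Rightarrow> complex \<Rightarrow> cvec list \<Rightarrow> cvec list" where
  "mv i j a vs = vs[i := vadd (vs ! i) (smul a (vs ! j))]"

lemma length_mv [simp]: "length (mv i j a vs) = length vs"
  by (simp add: mv_def)

lemma gdet_mv:
  assumes h: "hermitian b" and ij: "i < length vs" "j < length vs" "i \<noteq> j"
  shows "gdet b (mv i j a vs) = gdet b vs"
proof -
  note hh = hermitianD[OF h]
  have "gram b (mv i j a vs) = addcol (cnj a) i j (addrow a i j (gram b vs))"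
    by (rule eq_matI) (use ij in \<open>auto simp: gram_def mv_def nth_list_update hh algebra_simps\<close>)
  moreover have "det (addcol (cnj a) i j (addrow a i j (gram b vs))) = det (addrow a i j (gram b vs))"
    by (rule det_addcol[of _ "length vs"]) (use ij in auto)
  moreover have "det (addrow a i j (gram b vs)) = det (gram b vs)"
    by (rule det_addrow[of _ "length vs"]) (use ij in auto)
  ultimately show ?thesis by (simp add: gdet_def)
qed

definition comb :: "(nat \<Rightarrow> complex) \<Rightarrow> cvec list \<Rightarrow> cvec" where
  "comb c vs = (\<lambda>k. \<Sum>i<length vs. c i * (vs ! i) k)"

lemma comb_Nil [simp]: "comb c [] = (\<lambda>_. 0)"
  by (simp add: comb_def)

lemma comb_Cons: "comb c (v # vs) = vadd (smul (c 0) v) (comb (\<lambda>i. c (Suc i)) vs)"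
  by (rule ext) (simp add: comb_def vadd_def smul_def sum.lessThan_Suc_shift del: sum.lessThan_Suc)

text \<open>A move on the vectors acts on the coefficients as the transposed move, so a fixed vector
  is rewritten in the new list by undoing that move on its coefficients.\<close>

lemma comb_mv:
  assumes ij: "i < length vs" "j < length vs" "i \<noteq> j"
  shows "comb c (mv i j a vs) = comb (c(j := c j + c i * a)) vs"
proof
  fix k
  have "comb c (mv i j a vs) k = (\<Sum>l<length vs. c l * (vs ! l) k + (if l = i then c i * a * (vs ! j) k else 0))"
    unfolding comb_def
    by (simp, rule sum.cong) (use ij in \<open>auto simp: mv_def vadd_def smul_def nth_list_update algebra_simps\<close>)
  also have "\<dots> = (\<Sum>l<length vs. c l * (vs ! l) k) + c i * a * (vs ! j) k"
    using ij by (simp add: sum.distrib)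
  also have "\<dots> = (\<Sum>l<length vs. c l * (vs ! l) k + (if l = j then c i * a * (vs ! j) k else 0))"
    using ij by (simp add: sum.distrib)
  also have "\<dots> = comb (c(j := c j + c i * a)) vs k"
    unfolding comb_def by (rule sum.cong) (auto simp: algebra_simps)
  finally show "comb c (mv i j a vs) k = comb (c(j := c j + c i * a)) vs k" .
qed

lemma form_comb:
  assumes h: "hermitian b"
  shows "b (comb c vs) y = (\<Sum>i<length vs. c i * b (vs ! i) y)"
proof (induction vs arbitrary: c)
  case Nil thus ?case by (simp add: hermitian_zero[OF h])
next
  case (Cons v vs)
  show ?case
    by (simp add: comb_Cons hermitianD[OF h] Cons.IH sum.lessThan_Suc_shift del: sum.lessThan_Suc)
qed

text \<open>The common abstraction of \<open>\<int>\<close> and the Eisenstein integers. The last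
  clause turns diagonal values of a Hermitian form, which are real, into integers, so that minimal
  ones exist.\<close>

definition star_ring :: "complex set \<Rightarrow> bool" where
  "star_ring R \<longleftrightarrow> 0 \<in> R \<and> 1 \<in> R \<and> (\<forall>a\<in>R. \<forall>c\<in>R. a + c \<in> R \<and> a * c \<in> R) \<and>
     (\<forall>a\<in>R. - a \<in> R \<and> cnj a \<in> R) \<and> R \<inter> \<real> \<subseteq> \<int>"

lemma star_ringD:
  assumes "star_ring R"
  shows "0 \<in> R" "1 \<in> R" "a \<in> R \<Longrightarrow> c \<in> R \<Longrightarrow> a + c \<in> R" "a \<in> R \<Longrightarrow> c \<in> R \<Longrightarrow> a * c \<in> R"
    "a \<in> R \<Longrightarrow> - a \<in> R" "a \<in> R \<Longrightarrow> c \<in> R \<Longrightarrow> a - c \<in> R" "a \<in> R \<Longrightarrow> cnj a \<in> R"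
    "a \<in> R \<Longrightarrow> a \<in> \<real> \<Longrightarrow> a \<in> \<int>"
  using assms unfolding star_ring_def by (auto simp: diff_conv_add_uminus simp del: add_uminus_conv_diff)

lemma star_ring_of_nat: assumes "star_ring R" shows "of_nat n \<in> R"
  by (induction n) (auto intro: star_ringD[OF assms])

lemma star_ring_of_int: assumes "star_ring R" shows "of_int n \<in> R"
proof (cases "n \<ge> 0")
  case True thus ?thesis using star_ring_of_nat[OF assms, of "nat n"] by simp
next
  case False
  thus ?thesis using star_ringD(5)[OF assms star_ring_of_nat[OF assms, of "nat (- n)"]] by simp
qed

lemma star_ring_sum:
  assumes "star_ring R" "\<And>i. i \<in> S \<Longrightarrow> f i \<in> R" shows "sum f S \<in> R"
  using assms(2) by (induction S rule: infinite_finite_induct) (auto intro: star_ringD[OF assms(1)])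

lemma star_ring_Ints: "star_ring \<int>"
  unfolding star_ring_def by (auto elim!: Ints_cases)

section \<open>Equivalence of lists under transvections over a ring\<close>

inductive equ :: "complex set \<Rightarrow> cvec list \<Rightarrow> cvec list \<Rightarrow> bool" for R where
  equ_refl: "equ R vs vs"
| equ_step: "equ R vs ws \<Longrightarrow> i < length ws \<Longrightarrow> j < length ws \<Longrightarrow> i \<noteq> j \<Longrightarrow> a \<in> R \<Longrightarrow> equ R vs (mv i j a ws)"

lemma equ_trans:
  assumes "equ R us vs" "equ R vs ws" shows "equ R us ws"
  using assms(2,1) by induction (auto intro: equ_step)

lemma equ_length: "equ R vs ws \<Longrightarrow> length ws = length vs"
  by (induction rule: equ.induct) auto

lemma equ_Cons: "equ R vs ws \<Longrightarrow> equ R (v # vs) (v # ws)"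
proof (induction rule: equ.induct)
  case (equ_step vs ws i j a)
  from equ.equ_step[OF equ_step.IH, of "Suc i" "Suc j" a] equ_step.hyps
  show ?case by (simp add: mv_def)
qed (rule equ_refl)

lemma equ_one: "i < length vs \<Longrightarrow> j < length vs \<Longrightarrow> i \<noteq> j \<Longrightarrow> a \<in> R \<Longrightarrow> equ R vs (mv i j a vs)"
  by (rule equ_step[OF equ_refl])

lemma equ_gdet: "equ R vs ws \<Longrightarrow> hermitian b \<Longrightarrow> gdet b ws = gdet b vs"
  by (induction rule: equ.induct) (auto simp: gdet_mv)

lemma smul_one [simp]: "smul 1 x = x" by (simp add: smul_def)

text \<open>Three shears compose to the quarter turn that sends a pair \<open>(x, y)\<close> to
  \<open>(y, - x)\<close>. Transvections have determinant one, so a plain exchange is out of reach;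
  the sign ends up in the tail, where it does no harm.\<close>

lemma equ_front:
  assumes R: "star_ring R" and i: "i < length vs"
  shows "\<exists>ws. equ R vs (vs ! i # ws)"
proof (cases "i = 0")
  case True thus ?thesis using i equ_refl[of R vs] by (cases vs) auto
next
  case False
  define us where "us = mv 0 i 1 (mv i 0 (-1) (mv 0 i 1 vs))"
  have "equ R vs us" unfolding us_def
    using i False star_ringD(1,2)[OF R] star_ringD(5)[OF R star_ringD(2)[OF R]]
    by (intro equ_step equ_refl) (auto simp: length_mv)
  moreover have "us ! 0 = vs ! i"
  proof -
    have "vs \<noteq> []" using i by auto
    thus ?thesis unfolding us_def
      using i False by (auto simp: mv_def nth_list_update vadd_def smul_def)
  qed
  moreover have "us \<noteq> []" using i by (auto simp: us_def mv_def)
  ultimately show ?thesis by (metis list.collapse nth_Cons_0)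
qed

lemma equ_swap:
  assumes R: "star_ring R"
  shows "equ R (v # w # vs) (w # smul (-1) v # vs)"
proof -
  define us where "us = mv 0 1 1 (mv 1 0 (-1) (mv 0 1 1 (v # w # vs)))"
  have "equ R (v # w # vs) us" unfolding us_def
    using star_ringD(1,2)[OF R] star_ringD(5)[OF R star_ringD(2)[OF R]]
    by (intro equ_step equ_refl) (auto simp: length_mv)
  moreover have "us = w # smul (-1) v # vs"
    unfolding us_def by (auto simp: mv_def vadd_def smul_def)
  ultimately show ?thesis by simp
qed

lemma equ_add_head:
  assumes "a \<in> R"
  shows "equ R (v # us @ w # ws) (vadd v (smul a w) # us @ w # ws)"
proof -
  from equ_one[of 0 "v # us @ w # ws" "Suc (length us)" a R] assms
  show ?thesis by (simp add: mv_def nth_append)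
qed

definition entries_in :: "complex set \<Rightarrow> cform \<Rightarrow> cvec list \<Rightarrow> bool" where
  "entries_in S b vs \<longleftrightarrow> (\<forall>x\<in>set vs. \<forall>y\<in>set vs. b x y \<in> S)"

text \<open>Used for \<open>R\<close> itself and for the multiples of an integer, so that
  integrality and divisibility of a Gram matrix survive moves by one and the same argument.\<close>

definition ideal_in :: "complex set \<Rightarrow> complex set \<Rightarrow> bool" where
  "ideal_in R S \<longleftrightarrow> (\<forall>x\<in>S. \<forall>y\<in>S. x + y \<in> S) \<and> (\<forall>a\<in>R. \<forall>x\<in>S. a * x \<in> S)"

lemma set_mv: "i < length vs \<Longrightarrow> j < length vs \<Longrightarrow> set (mv i j a vs) \<subseteq> insert (vadd (vs ! i) (smul a (vs ! j))) (set vs)"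
  by (simp add: mv_def set_update_subset_insert)

lemma entries_in_mv:
  assumes h: "hermitian b" and R: "star_ring R" and S: "ideal_in R S"
    and e: "entries_in S b vs" and ij: "i < length vs" "j < length vs" and a: "a \<in> R"
  shows "entries_in S b (mv i j a vs)"
proof -
  let ?n = "vadd (vs ! i) (smul a (vs ! j))"
  have s: "x + y \<in> S" if "x \<in> S" "y \<in> S" for x y using S that by (auto simp: ideal_in_def)
  have m: "a * x \<in> S" "cnj a * x \<in> S" if "x \<in> S" for x
    using S that a star_ringD(7)[OF R] by (auto simp: ideal_in_def)
  have e': "b x y \<in> S" if "x \<in> set vs" "y \<in> set vs" for x y using e that by (auto simp: entries_in_def)
  have 1: "b ?n y \<in> S" if "y \<in> set vs" for y
    using that ij by (auto simp: hermitianD[OF h] intro!: s m e')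
  have 2: "b y ?n \<in> S" if "y \<in> set vs" for y
    using that ij by (auto simp: hermitianD[OF h] intro!: s m e')
  have 3: "b ?n ?n \<in> S"
    using ij by (auto simp: hermitianD(1,2)[OF h] intro!: s m 2)
  have "b x y \<in> S" if "x \<in> set (mv i j a vs)" "y \<in> set (mv i j a vs)" for x y
  proof -
    have "x = ?n \<or> x \<in> set vs" "y = ?n \<or> y \<in> set vs" using that set_mv[OF ij, of a] by auto
    thus ?thesis using 1 2 3 e' by (elim disjE) simp_all
  qed
  thus ?thesis by (simp add: entries_in_def)
qed

lemma equ_entries_in:
  "equ R vs ws \<Longrightarrow> hermitian b \<Longrightarrow> star_ring R \<Longrightarrow> ideal_in R S \<Longrightarrow> entries_in S b vs \<Longrightarrow> entries_in S b ws"
  by (induction rule: equ.induct) (auto intro: entries_in_mv)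

lemma ideal_in_self: "star_ring R \<Longrightarrow> ideal_in R R"
  by (auto simp: ideal_in_def star_ringD)

lemma equ_set_closed:
  assumes "equ R vs ws" "set vs \<subseteq> M" "\<And>x y a. x \<in> M \<Longrightarrow> y \<in> M \<Longrightarrow> a \<in> R \<Longrightarrow> vadd x (smul a y) \<in> M"
  shows "set ws \<subseteq> M"
  using assms(1,2)
proof induction
  case (equ_step vs ws i j a)
  hence "vadd (ws ! i) (smul a (ws ! j)) \<in> M" by (intro assms(3)) auto
  thus ?case using set_mv[of i ws j a] equ_step by blast
qed auto

definition nontriv :: "complex set \<Rightarrow> nat \<Rightarrow> (nat \<Rightarrow> complex) \<Rightarrow> bool" where
  "nontriv R n c \<longleftrightarrow> (\<forall>i<n. c i \<in> R) \<and> (\<exists>i<n. c i \<noteq> 0)"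

text \<open>Serves two properties: with \<open>b x x \<noteq> 0\<close> it is anisotropy of the
  lattice spanned by the list, and with \<open>x \<noteq> (\<lambda>_. 0)\<close> it is linear
  independence over \<open>R\<close>.\<close>

definition good :: "complex set \<Rightarrow> (cvec \<Rightarrow> bool) \<Rightarrow> cvec list \<Rightarrow> bool" where
  "good R P vs \<longleftrightarrow> (\<forall>c. nontriv R (length vs) c \<longrightarrow> P (comb c vs))"

text \<open>The coefficient change of \<open>comb_mv\<close> keeps nontrivial coefficients
  nontrivial: if \<open>c i\<close> vanishes nothing changes, and otherwise the entry
  \<open>i\<close> is untouched and nonzero.\<close>

lemma equ_good:
  assumes "equ R vs ws" "star_ring R" "good R P vs" shows "good R P ws"
  using assms(1,3)
proof induction
  case (equ_step vs ws i j a)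
  show ?case unfolding good_def
  proof (intro allI impI)
    fix c assume "nontriv R (length (mv i j a ws)) c"
    hence c: "nontriv R (length ws) c" by simp
    let ?d = "c(j := c j + c i * a)"
    have "\<exists>k<length ws. ?d k \<noteq> 0"
    proof (cases "c i = 0")
      case True
      from c obtain k where "k < length ws" "c k \<noteq> 0" by (auto simp: nontriv_def)
      thus ?thesis using True by (intro exI[of _ k]) auto
    next
      case False thus ?thesis using equ_step by (intro exI[of _ i]) auto
    qed
    moreover have "\<forall>k<length ws. ?d k \<in> R"
      using c equ_step star_ringD(3,4)[OF assms(2)] by (auto simp: nontriv_def)
    ultimately have "P (comb ?d ws)" using equ_step by (auto simp: good_def nontriv_def)
    thus "P (comb c (mv i j a ws))" using equ_step by (simp add: comb_mv)
  qed
qed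

lemma equ_comb:
  assumes "equ R vs ws" "star_ring R" "\<forall>i<length vs. c i \<in> R"
  shows "\<exists>d. (\<forall>i<length ws. d i \<in> R) \<and> comb c vs = comb d ws"
  using assms(1,3)
proof induction
  case (equ_step vs ws i j a)
  then obtain d where d: "\<forall>i<length ws. d i \<in> R" "comb c vs = comb d ws" by auto
  let ?e = "d(j := d j - d i * a)"
  have "?e(j := ?e j + ?e i * a) = d" using equ_step by auto
  hence 1: "comb ?e (mv i j a ws) = comb d ws" using equ_step by (simp add: comb_mv)
  have 2: "\<forall>l<length (mv i j a ws). ?e l \<in> R"
    using d equ_step star_ringD(4,6)[OF assms(2)] by auto
  show ?case unfolding d(2) 1[symmetric] using 2 by blast
qed auto

lemma nontriv_single: "star_ring R \<Longrightarrow> nontriv R (Suc n) (\<lambda>i. if i = 0 then 1 else 0)"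
  by (auto simp: nontriv_def star_ringD)

lemma comb_single: "comb (\<lambda>i. if i = 0 then a else 0) (v # vs) = smul a v"
  by (rule ext) (simp add: comb_def smul_def sum.lessThan_Suc_shift del: sum.lessThan_Suc)

lemma good_head: "star_ring R \<Longrightarrow> good R P (v # vs) \<Longrightarrow> P v"
  using comb_single[of 1 v vs] nontriv_single[of R "length vs"] by (auto simp: good_def)

lemma good_tail:
  assumes "star_ring R" "good R P (v # vs)" shows "good R P vs"
  unfolding good_def
proof (intro allI impI)
  fix c assume c: "nontriv R (length vs) c"
  let ?d = "\<lambda>i. if i = 0 then 0 else c (i - 1)"
  have "nontriv R (length (v # vs)) ?d"
    using c star_ringD(1)[OF assms(1)] unfolding nontriv_def by (auto simp: less_Suc_eq_0_disj)
  moreover have "comb ?d (v # vs) = comb c vs" by (auto simp: comb_Cons vadd_def smul_def)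
  ultimately show "P (comb c vs)" using assms(2) by (metis good_def)
qed

abbreviation aniso :: "complex set \<Rightarrow> cform \<Rightarrow> cvec list \<Rightarrow> bool" where
  "aniso R b vs \<equiv> good R (\<lambda>x. b x x \<noteq> 0) vs"

lemma comb_smul: "comb (\<lambda>i. a * c i) vs = smul a (comb c vs)"
  by (rule ext) (simp add: comb_def smul_def sum_distrib_left mult.assoc)

text \<open>Schur forms have denominators \<open>b v v\<close>. One common denominator for the whole
  Gram matrix keeps the norms in a discrete set, as the minimisation in the Hermite reduction
  requires.\<close>

definition scaled_in :: "complex set \<Rightarrow> cform \<Rightarrow> cvec list \<Rightarrow> bool" where
  "scaled_in R b vs \<longleftrightarrow> (\<exists>N::nat. N > 0 \<and> entries_in R (\<lambda>x y. of_nat N * b x y) vs)"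

text \<open>Clearing denominators. With the integer \<open>q = N * b v v\<close>, the vector
  \<open>q\<close> times the projection of a combination of \<open>ws\<close> is a combination of
  \<open>v # ws\<close> over \<open>R\<close>, hence not isotropic. Up to sign, \<open>N * q\<close>
  times the Schur form takes the values \<open>?t\<close>, which are polynomials in elements of
  \<open>R\<close>.\<close>

lemma
  assumes h: "hermitian b" and R: "star_ring R" and a: "aniso R b (v # ws)" and s: "scaled_in R b (v # ws)"
  shows aniso_schur: "aniso R (schur b v) ws" and scaled_in_schur: "scaled_in R (schur b v) ws"
proof -
  note hh = hermitianD[OF h]
  have v0: "b v v \<noteq> 0" using good_head[OF R a] .
  from s obtain N :: nat where N: "N > 0" "\<And>x y. x \<in> set (v # ws) \<Longrightarrow> y \<in> set (v # ws) \<Longrightarrow> of_nat N * b x y \<in> R"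
    unfolding scaled_in_def entries_in_def by blast
  have NvR: "of_nat N * b v v \<in> \<int>"
    by (rule star_ringD(8)[OF R N(2)]) (auto simp: hh)
  then obtain q :: int where q: "of_nat N * b v v = of_int q" by (auto elim: Ints_cases)
  have q0: "q \<noteq> 0" using q v0 N(1) by (metis mult_eq_0_iff of_int_0 of_nat_eq_0_iff not_gr_zero)
  show "aniso R (schur b v) ws" unfolding good_def
  proof (intro allI impI)
    fix c assume c: "nontriv R (length ws) c"
    let ?x = "comb c ws"
    let ?d = "\<lambda>i. if i = 0 then - (of_nat N * b ?x v) else of_int q * c (i - 1)"
    have "of_nat N * b ?x v = (\<Sum>i<length ws. c i * (of_nat N * b (ws ! i) v))"
      by (simp add: form_comb[OF h] sum_distrib_left mult.left_commute)
    also have "\<dots> \<in> R"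
      by (rule star_ring_sum[OF R], rule star_ringD(4)[OF R])
         (use c N(2) in \<open>auto simp: nontriv_def\<close>)
    finally have "nontriv R (length (v # ws)) ?d"
      using c q0 R unfolding nontriv_def
      by (auto simp: less_Suc_eq_0_disj intro!: star_ringD(4,5)[OF R] star_ring_of_int[OF R])
    hence "b (comb ?d (v # ws)) (comb ?d (v # ws)) \<noteq> 0" using a by (auto simp: good_def)
    moreover have "comb ?d (v # ws) = smul (of_int q) (vadd ?x (smul (- (b ?x v / b v v)) v))"
    proof -
      have "of_nat N = of_int q / b v v" using q v0 by (simp add: field_simps)
      thus ?thesis by (auto simp: comb_Cons comb_smul vadd_def smul_def field_simps)
    qed
    ultimately show "schur b v ?x ?x \<noteq> 0"
      unfolding schur_proj[OF h v0] by (auto simp: hh)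
  qed
  show "scaled_in R (schur b v) ws" unfolding scaled_in_def
  proof (intro exI conjI)
    show "N * nat \<bar>q\<bar> > 0" using N q0 by simp
    show "entries_in R (\<lambda>x y. of_nat (N * nat \<bar>q\<bar>) * schur b v x y) ws"
      unfolding entries_in_def
    proof (intro ballI)
      fix x y assume xy: "x \<in> set ws" "y \<in> set ws"
      let ?t = "of_nat N * b v v * (of_nat N * b x y) - (of_nat N * b x v) * (of_nat N * b v y)"
      have t: "?t \<in> R" by (intro star_ringD(4,6)[OF R] N(2)) (use xy in auto)
      have "of_nat N * of_int q * schur b v x y = ?t"
        unfolding schur_def q[symmetric] using v0 by (simp add: field_simps)
      moreover have "of_nat (N * nat \<bar>q\<bar>) = (if q \<ge> 0 then of_nat N * of_int q else - (of_nat N * of_int q) :: complex)"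
        by (simp add: of_nat_mult)
      ultimately have "of_nat (N * nat \<bar>q\<bar>) * schur b v x y \<in> {?t, - ?t}"
        by (cases "q \<ge> 0") (simp_all only: if_True if_False minus_mult_left[symmetric] insert_iff simp_thms)
      thus "of_nat (N * nat \<bar>q\<bar>) * schur b v x y \<in> R" using t star_ringD(5)[OF R t] by auto
    qed
  qed
qed

section \<open>Hermite reduction\<close>

text \<open>At each level only the second vector is compared with the first, after translation by
  arbitrary multiples of it; the pivot estimates rest on this comparison alone. Absolute values
  appear because the form may be indefinite.\<close>

fun reduced :: "complex set \<Rightarrow> cform \<Rightarrow> cvec list \<Rightarrow> bool" where
  "reduced R b (v # w # vs) \<longleftrightarrow>
     (\<forall>m\<in>R. cmod (b v v) \<le> cmod (b (vadd w (smul m v)) (vadd w (smul m v)))) \<and>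
     reduced R (schur b v) (w # vs)"
| "reduced R b [v] \<longleftrightarrow> True"
| "reduced R b [] \<longleftrightarrow> True"

lemma hermitian_scale: "hermitian b \<Longrightarrow> cnj c = c \<Longrightarrow> hermitian (\<lambda>x y. c * b x y)"
  unfolding hermitian_def[of "\<lambda>x y. c * b x y"] by (auto simp: hermitianD algebra_simps)

lemma equ_scaled_in:
  assumes "equ R vs ws" "hermitian b" "star_ring R" "scaled_in R b vs"
  shows "scaled_in R b ws"
proof -
  from assms(4) obtain N :: nat where N: "N > 0" "entries_in R (\<lambda>x y. of_nat N * b x y) vs"
    by (auto simp: scaled_in_def)
  have "entries_in R (\<lambda>x y. of_nat N * b x y) ws"
    by (rule equ_entries_in[OF assms(1) hermitian_scale[OF assms(2)] assms(3) ideal_in_self[OF assms(3)] N(2)]) simp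
  thus ?thesis using N by (auto simp: scaled_in_def)
qed

text \<open>Among all equivalent lists one has a head of least absolute norm, the norms being
  integers after multiplication by \<open>N\<close>. Reducing the tail for the Schur form does not
  move the head, and every \<open>w + m v\<close>, with \<open>w\<close> the new second vector, can
  itself be made the head, so minimality gives the inequality.\<close>

lemma hermite_reduction:
  assumes "hermitian b" "star_ring R" "aniso R b vs" "scaled_in R b vs"
  shows "\<exists>ws. equ R vs ws \<and> reduced R b ws"
  using assms
proof (induction "length vs" arbitrary: b vs)
  case 0 thus ?case using equ_refl[of R vs] by (intro exI[of _ vs]) auto
next
  case (Suc n)
  note h = Suc.prems(1) and R = Suc.prems(2)
  from Suc.prems(4) obtain N :: nat where N: "N > 0" "entries_in R (\<lambda>x y. of_nat N * b x y) vs"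
    by (auto simp: scaled_in_def)
  define f where "f us = nat \<lfloor>cmod (of_nat N * b (hd us) (hd us))\<rfloor>" for us
  have f: "real (f us) = real N * cmod (b (hd us) (hd us))" if us: "equ R vs us" for us
  proof -
    have "entries_in R (\<lambda>x y. of_nat N * b x y) us"
      by (rule equ_entries_in[OF us hermitian_scale[OF h] R ideal_in_self[OF R] N(2)]) simp
    moreover have "hd us \<in> set us" using equ_length[OF us] Suc.hyps(2) by (cases us) auto
    ultimately have "of_nat N * b (hd us) (hd us) \<in> R" by (auto simp: entries_in_def)
    hence "of_nat N * b (hd us) (hd us) \<in> \<int>"
      by (rule star_ringD(8)[OF R]) (simp add: hermitianD[OF h])
    then obtain k :: int where k: "of_nat N * b (hd us) (hd us) = of_int k" by (auto elim: Ints_cases)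
    hence "f us = nat \<bar>k\<bar>" by (simp add: f_def flip: of_int_abs)
    moreover have "cmod (of_nat N * b (hd us) (hd us)) = \<bar>k\<bar>" using k by simp
    ultimately show ?thesis by (simp add: norm_mult)
  qed
  obtain us where us: "equ R vs us" "\<And>ws. equ R vs ws \<Longrightarrow> f us \<le> f ws"
    using ex_has_least_nat[of "equ R vs" vs f] equ_refl by blast
  have min: "cmod (b (hd us) (hd us)) \<le> cmod (b (hd ws) (hd ws))" if "equ R vs ws" for ws
  proof -
    have "real (f us) \<le> real (f ws)" using us(2)[OF that] by simp
    thus ?thesis using f[OF that] f[OF us(1)] N(1) by simp
  qed
  obtain v ws where uv: "us = v # ws" using equ_length[OF us(1)] Suc.hyps(2) by (cases us) auto
  have a: "aniso R b (v # ws)" using equ_good[OF us(1) R Suc.prems(3)] uv by simp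
  have s: "scaled_in R b (v # ws)" using equ_scaled_in[OF us(1) h R Suc.prems(4)] uv by simp
  have "n = length ws" using equ_length[OF us(1)] Suc.hyps(2) uv by simp
  from Suc.hyps(1)[OF this hermitian_schur[OF h] R aniso_schur[OF h R a s] scaled_in_schur[OF h R a s]]
  obtain zs where zs: "equ R ws zs" "reduced R (schur b v) zs" by blast
  have e: "equ R vs (v # zs)" using equ_trans[OF us(1)] equ_Cons[OF zs(1), of v] uv by simp
  have "reduced R b (v # zs)"
  proof (cases zs)
    case (Cons w ys)
    have "cmod (b v v) \<le> cmod (b (vadd w (smul m v)) (vadd w (smul m v)))" if m: "m \<in> R" for m
    proof -
      \<comment> \<open>The swap turns \<open>v\<close> into \<open>- v\<close>, so the multiplier
        \<open>- m\<close> reproduces \<open>w + m v\<close>.\<close>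
      have "equ R vs (w # [] @ smul (-1) v # ys)"
        using equ_trans[OF e] equ_swap[OF R, of v w ys] Cons by simp
      from equ_trans[OF this equ_add_head[of "- m" R w "[]"]] m star_ringD(5)[OF R m]
      have "equ R vs (vadd w (smul (- m) (smul (- 1) v)) # [] @ smul (-1) v # ys)" by blast
      from min[OF this] uv show ?thesis by (simp add: smul_def)
    qed
    thus ?thesis using zs Cons by simp
  qed auto
  thus ?case using e by blast
qed

section \<open>Divisibility, and isotropic vectors over the field with three elements\<close>

definition mults :: "int \<Rightarrow> complex set" where
  "mults k = range (\<lambda>n. of_int (k * n))"

lemma mults_iff: "of_int m \<in> mults k \<longleftrightarrow> k dvd m"
  by (auto simp: mults_def dvd_def simp flip: of_int_mult)

lemma multsE: "z \<in> mults k \<Longrightarrow> \<exists>n. z = of_int (k * n)"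
  by (auto simp: mults_def)

lemma ideal_mults: "ideal_in \<int> (mults k)"
  unfolding ideal_in_def
proof (intro conjI ballI)
  fix x y assume "x \<in> mults k" "y \<in> mults k"
  then obtain m n where "x = of_int (k * m)" "y = of_int (k * n)" by (meson multsE)
  thus "x + y \<in> mults k" using mults_iff[of "k * m + k * n" k] by simp
next
  fix a x :: complex assume "a \<in> \<int>" "x \<in> mults k"
  then obtain m n where "a = of_int m" "x = of_int (k * n)" by (meson multsE Ints_cases)
  thus "a * x \<in> mults k" using mults_iff[of "m * (k * n)" k] by simp
qed

lemma mults_cancel:
  assumes "z \<in> \<int>" "of_int a * z \<in> mults k" "coprime a k" shows "z \<in> mults k"
proof -
  obtain m where m: "z = of_int m" using assms(1) by (auto elim: Ints_cases)
  have "k dvd a * m" using assms(2) mults_iff[of "a * m" k] by (simp add: m)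
  hence "k dvd m" using assms(3) by (metis coprime_commute coprime_dvd_mult_right_iff)
  thus ?thesis by (simp add: m mults_iff)
qed

lemma gdet_scale: "gdet (\<lambda>x y. c * b x y) vs = c ^ length vs * gdet b vs"
proof -
  have "gram (\<lambda>x y. c * b x y) vs = c \<cdot>\<^sub>m gram b vs" by (rule eq_matI) (auto simp: gram_def)
  thus ?thesis by (simp add: gdet_def gram_def)
qed

lemma star_ring_prod:
  assumes "star_ring R" "\<And>i. i \<in> S \<Longrightarrow> f i \<in> R" shows "prod f S \<in> R"
  using assms(2) by (induction S rule: infinite_finite_induct) (auto intro: star_ringD[OF assms(1)])

lemma det_in:
  assumes R: "star_ring R" and A: "A \<in> carrier_mat n n" and e: "\<And>i j. i < n \<Longrightarrow> j < n \<Longrightarrow> A $$ (i, j) \<in> R"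
  shows "det A \<in> R"
  unfolding det_def'[OF A]
proof (rule star_ring_sum[OF R])
  fix p assume "p \<in> {p. p permutes {0..<n}}"
  hence p: "p permutes {0..<n}" by simp
  have "(\<Prod>i = 0..<n. A $$ (i, p i)) \<in> R"
    by (rule star_ring_prod[OF R]) (use p permutes_in_image[OF p] in \<open>auto intro!: e\<close>)
  moreover have "(signof p :: complex) \<in> R"
    using star_ringD(2)[OF R] star_ringD(5)[OF R star_ringD(2)[OF R]] by (auto simp: sign_def)
  ultimately show "signof p * (\<Prod>i = 0..<n. A $$ (i, p i)) \<in> R" by (rule star_ringD(4)[OF R, rotated])
qed

lemma gdet_in: "star_ring R \<Longrightarrow> entries_in R b vs \<Longrightarrow> gdet b vs \<in> R"
  unfolding gdet_def by (rule det_in[OF _ gram_carrier]) (auto simp: gram_def entries_in_def)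

lemma gdet_single: "gdet b [u] = b u u"
  unfolding gdet_def by (subst det_single) (auto simp: gram_def)

lemma gdet_pair: "gdet b [u, v] = b u u * b v v - b u v * b v u"
proof -
  let ?A = "gram b [u, v]"
  have A: "?A \<in> carrier_mat 2 2" by (simp add: gram_def numeral_2_eq_2)
  have "det ?A = (\<Sum>i<2. ?A $$ (i, 0) * cofactor ?A i 0)"
    by (rule laplace_expansion_column[OF A]) simp
  also have "\<dots> = ?A $$ (0, 0) * cofactor ?A 0 0 + ?A $$ (1, 0) * cofactor ?A 1 0"
    by (simp add: numeral_2_eq_2)
  also have "cofactor ?A 0 0 = b v v"
    unfolding cofactor_def by (subst det_single) (auto simp: gram_def mat_delete_def)
  also have "cofactor ?A 1 0 = - b u v"
    unfolding cofactor_def by (subst det_single) (auto simp: gram_def mat_delete_def)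
  finally show ?thesis by (simp add: gdet_def gram_def)
qed

text \<open>Chevalley's theorem for ternary quadratic forms modulo 3, by inspection of the 729
  forms. The zero is normalised to have first nonzero coordinate 1, and the three alternatives are
  the positions of that coordinate; thus transvections can put it into a basis.\<close>

lemma ternary_mod3_aux:
  "\<forall>\<gamma>\<in>set [0,1,2]. \<forall>\<beta>\<in>set [0,1,2]. \<forall>r\<in>set [0,1,2]. \<forall>\<alpha>\<in>set [0,1,2]. \<forall>p\<in>set [0,1,2]. \<forall>q\<in>set [0,1,2::int].
     \<gamma> mod 3 = 0 \<or> (\<exists>d\<in>set [-1,0,1]. (\<beta> + d * d * \<gamma> + 2 * d * r) mod 3 = 0) \<or>
     (\<exists>c\<in>set [-1,0,1]. \<exists>d\<in>set [-1,0,1]. (\<alpha> + c * c * \<beta> + d * d * \<gamma> + 2 * c * p + 2 * d * q + 2 * c * d * r) mod 3 = 0)"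
  by code_simp

lemma ternary_mod3:
  fixes \<alpha> \<beta> \<gamma> p q r :: int
  shows "3 dvd \<gamma> \<or> (\<exists>d\<in>{-1,0,1}. 3 dvd \<beta> + d * d * \<gamma> + 2 * d * r) \<or>
     (\<exists>c\<in>{-1,0,1}. \<exists>d\<in>{-1,0,1}. 3 dvd \<alpha> + c * c * \<beta> + d * d * \<gamma> + 2 * c * p + 2 * d * q + 2 * c * d * r)"
proof -
  have m: "x mod 3 \<in> set [0,1,2]" for x :: int by auto
  have s: "set [-1,0,1] = {-1,0,1::int}" by simp
  have 2: "(\<beta> mod 3 + d * d * (\<gamma> mod 3) + 2 * d * (r mod 3)) mod 3 = (\<beta> + d * d * \<gamma> + 2 * d * r) mod 3" for d
    by (intro mod_add_cong mod_mult_cong) simp_all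
  have 3: "(\<alpha> mod 3 + c * c * (\<beta> mod 3) + d * d * (\<gamma> mod 3) + 2 * c * (p mod 3) + 2 * d * (q mod 3) + 2 * c * d * (r mod 3)) mod 3
     = (\<alpha> + c * c * \<beta> + d * d * \<gamma> + 2 * c * p + 2 * d * q + 2 * c * d * r) mod 3" for c d
    by (intro mod_add_cong mod_mult_cong) simp_all
  show ?thesis
    using ternary_mod3_aux[rule_format, OF m[of \<gamma>] m[of \<beta>] m[of r] m[of \<alpha>] m[of p] m[of q]]
    unfolding 2 3 s by (simp only: dvd_eq_mod_eq_0 mod_mod_trivial)
qed

section \<open>Descent at the prime 3\<close>

text \<open>A binary form whose discriminant vanishes modulo 3 is degenerate there and so has a
  zero, again with one coordinate normalised to 1.\<close>

lemma binary_mod3_aux: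
  "\<forall>\<alpha>\<in>set [0,1,2]. \<forall>\<beta>\<in>set [0,1,2]. \<forall>p\<in>set [0,1,2::int].
     (\<alpha> * \<beta> - p * p) mod 3 \<noteq> 0 \<or> \<alpha> mod 3 = 0 \<or> (\<exists>c\<in>set [-1,0,1]. (\<beta> + c * c * \<alpha> + 2 * c * p) mod 3 = 0)"
  by code_simp

lemma binary_mod3:
  fixes \<alpha> \<beta> p :: int
  assumes "3 dvd \<alpha> * \<beta> - p * p"
  shows "3 dvd \<alpha> \<or> (\<exists>c. 3 dvd \<beta> + c * c * \<alpha> + 2 * c * p)"
proof -
  have m: "x mod 3 \<in> set [0,1,2]" for x :: int by auto
  have 1: "(\<alpha> mod 3 * (\<beta> mod 3) - p mod 3 * (p mod 3)) mod 3 = (\<alpha> * \<beta> - p * p) mod 3"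
    by (intro mod_diff_cong mod_mult_cong) simp_all
  have 2: "(\<beta> mod 3 + c * c * (\<alpha> mod 3) + 2 * c * (p mod 3)) mod 3 = (\<beta> + c * c * \<alpha> + 2 * c * p) mod 3" for c
    by (intro mod_add_cong mod_mult_cong) simp_all
  show ?thesis
    using binary_mod3_aux[rule_format, OF m[of \<alpha>] m[of \<beta>] m[of p]] assms
    unfolding 1 2 dvd_eq_mod_eq_0 mod_mod_trivial by (elim disjE bexE) (simp, simp, rule disjI2, rule exI, assumption)
qed

text \<open>If both diagonal entries are divisible by 3 while \<open>b v w\<close> is not, then
  \<open>v + w\<close> has norm congruent to \<open>2 * b v w\<close>, and 2 is invertible modulo
  3.\<close>

lemma entries_in_unit_pivot:
  assumes h: "hermitian b" and e: "entries_in \<int> b vs" and n: "\<not> entries_in (mults 3) b vs"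
  shows "\<exists>v ws. equ \<int> vs (v # ws) \<and> b v v \<notin> mults 3"
proof -
  from n obtain i j where ij: "i < length vs" "j < length vs" "b (vs ! i) (vs ! j) \<notin> mults 3"
    unfolding entries_in_def by (metis in_set_conv_nth)
  let ?v = "vs ! i" and ?w = "vs ! j"
  show ?thesis
  proof (cases "b ?v ?v \<in> mults 3 \<and> b ?w ?w \<in> mults 3")
    case False
    thus ?thesis using equ_front[OF star_ring_Ints ij(1)] equ_front[OF star_ring_Ints ij(2)] by blast
  next
    case True
    have ne: "i \<noteq> j" using True ij(3) by auto
    let ?us = "mv i j 1 vs"
    have "b ?v ?w \<in> \<int>" "b ?v ?v \<in> \<int>" "b ?w ?w \<in> \<int>" using e ij by (auto simp: entries_in_def)
    then obtain p where p: "b ?v ?w = of_int p" by (auto elim: Ints_cases)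
    obtain \<alpha> \<beta> where ab: "b ?v ?v = of_int (3 * \<alpha>)" "b ?w ?w = of_int (3 * \<beta>)" using True by (meson multsE)
    have "b ?w ?v = of_int p" using hermitianD(5)[OF h, of ?v ?w] p by simp
    hence "b (vadd ?v (smul 1 ?w)) (vadd ?v (smul 1 ?w)) = of_int (3 * \<alpha> + 3 * \<beta> + 2 * p)"
      using p ab by (simp add: hermitianD[OF h])
    moreover have "\<not> 3 dvd p" using ij(3) unfolding p mults_iff .
    hence "\<not> 3 dvd 3 * \<alpha> + 3 * \<beta> + 2 * p" by presburger
    ultimately have "b (vadd ?v (smul 1 ?w)) (vadd ?v (smul 1 ?w)) \<notin> mults 3" by (simp only: mults_iff not_False_eq_True)
    moreover have "?us ! i = vadd ?v (smul 1 ?w)" using ij by (simp add: mv_def)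
    ultimately have "b (?us ! i) (?us ! i) \<notin> mults 3" by simp
    moreover have "equ \<int> vs ?us" using ij ne by (intro equ_one) auto
    moreover have "i < length ?us" using ij by simp
    ultimately show ?thesis using equ_front[OF star_ring_Ints, of i ?us] equ_trans by blast
  qed
qed

lemma equ_add_second: "a \<in> R \<Longrightarrow> equ R (v # w # ws) (vadd v (smul a w) # w # ws)"
  using equ_add_head[of a R v "[]" w ws] by simp

lemma equ_add_third: "a \<in> R \<Longrightarrow> equ R (v # u # w # ws) (vadd v (smul a w) # u # w # ws)"
  using equ_add_head[of a R v "[u]" w ws] by simp

text \<open>After division of the form by 3, a vector of norm divisible by 3 is wanted. In rank at
  least 3 there always is one; in rank 2 the factor 27 in the determinant makes the quotient form
  degenerate modulo 3; in rank 1 it gives the claim outright, and rank 0 has determinant 1.\<close>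

lemma three_step_divisible:
  assumes h: "hermitian b" and e: "entries_in (mults 3) b vs" and d: "gdet b vs \<in> mults 27"
  shows "\<exists>x ws. equ \<int> vs (x # ws) \<and> b x x \<in> mults 9"
proof -
  have sym: "b y x = of_int m" if "b x y = of_int m" for x y m
    using hermitianD(5)[OF h, of x y] that by simp
  note hh = hermitianD(1-4)[OF h]
  have ex: "\<exists>n. b x y = of_int (3 * n)" if "x \<in> set vs" "y \<in> set vs" for x y
    using e that multsE[of "b x y" 3] unfolding entries_in_def by blast
  consider "vs = []" | u where "vs = [u]" | u v where "vs = [u, v]" | u v w us where "vs = u # v # w # us"
    by (metis list.exhaust)
  thus ?thesis
  proof cases
    case 1
    hence "of_int 1 \<in> mults 27" using d by simp
    thus ?thesis by (simp only: mults_iff) simp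
  next
    case 2
    hence "b u u \<in> mults 27" using d by (simp add: gdet_single)
    then obtain n where "b u u = of_int (27 * n)" by (meson multsE)
    hence "b u u \<in> mults 9" by (simp only: mults_iff) presburger
    thus ?thesis using 2 equ_refl by blast
  next
    case 3
    obtain \<alpha> \<beta> p where ab: "b u u = of_int (3 * \<alpha>)" "b v v = of_int (3 * \<beta>)" "b u v = of_int (3 * p)"
      using ex 3 by (metis list.set_intros)
    have "of_int (9 * (\<alpha> * \<beta> - p * p)) \<in> mults 27"
      using d 3 ab sym[OF ab(3)] by (simp add: gdet_pair algebra_simps)
    hence "3 dvd \<alpha> * \<beta> - p * p" by (simp only: mults_iff) presburger
    from binary_mod3[OF this] show ?thesis
    proof (elim disjE exE)
      assume "3 dvd \<alpha>"
      hence "b u u \<in> mults 9" unfolding ab mults_iff by presburger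
      thus ?thesis using 3 equ_refl by blast
    next
      fix c assume c: "3 dvd \<beta> + c * c * \<alpha> + 2 * c * p"
      let ?x = "vadd v (smul (of_int (- c)) (smul (-1) u))"
      have "b ?x ?x = of_int (3 * (\<beta> + c * c * \<alpha> + 2 * c * p))"
        using ab sym[OF ab(3)] by (simp add: hh algebra_simps)
      hence "b ?x ?x \<in> mults 9" using c by (simp only: mults_iff) presburger
      moreover have "equ \<int> vs (?x # smul (-1) u # [])"
        unfolding 3 by (rule equ_trans[OF equ_swap[OF star_ring_Ints] equ_add_second]) simp
      ultimately show ?thesis by blast
    qed
  next
    case 4
    obtain \<alpha> \<beta> \<gamma> where ab: "b u u = of_int (3 * \<alpha>)" "b v v = of_int (3 * \<beta>)" "b w w = of_int (3 * \<gamma>)"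
      using ex 4 by (metis list.set_intros)
    obtain p q r where pq: "b u v = of_int (3 * p)" "b u w = of_int (3 * q)" "b v w = of_int (3 * r)"
      using ex 4 by (metis list.set_intros)
    note qp = sym[OF pq(1)] sym[OF pq(2)] sym[OF pq(3)]
    from ternary_mod3[of \<gamma> \<beta> r \<alpha> p q] show ?thesis
    proof (elim disjE bexE)
      assume "3 dvd \<gamma>"
      hence "b w w \<in> mults 9" unfolding ab mults_iff by presburger
      thus ?thesis using equ_front[OF star_ring_Ints, of 2 vs] 4 by auto
    next
      fix c assume c: "3 dvd \<beta> + c * c * \<gamma> + 2 * c * r"
      let ?x = "vadd v (smul (of_int c) w)"
      have "b ?x ?x = of_int (3 * (\<beta> + c * c * \<gamma> + 2 * c * r))"
        using ab pq qp by (simp add: hh algebra_simps)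
      hence "b ?x ?x \<in> mults 9" using c by (simp only: mults_iff) presburger
      moreover have "equ \<int> vs (?x # smul (-1) u # w # us)"
        unfolding 4 by (rule equ_trans[OF equ_swap[OF star_ring_Ints] equ_add_third]) simp
      ultimately show ?thesis by blast
    next
      fix c d assume c: "3 dvd \<alpha> + c * c * \<beta> + d * d * \<gamma> + 2 * c * p + 2 * d * q + 2 * c * d * r"
      let ?y = "vadd u (smul (of_int c) v)"
      let ?x = "vadd ?y (smul (of_int d) w)"
      have "b ?x ?x = of_int (3 * (\<alpha> + c * c * \<beta> + d * d * \<gamma> + 2 * c * p + 2 * d * q + 2 * c * d * r))"
        using ab pq qp by (simp add: hh algebra_simps)
      hence "b ?x ?x \<in> mults 9" using c by (simp only: mults_iff) presburger
      moreover have "equ \<int> vs (?x # v # w # us)"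
        unfolding 4 by (rule equ_trans[OF equ_add_second equ_add_third]) simp_all
      ultimately show ?thesis by blast
    qed
  qed
qed

text \<open>The divisibility conditions on \<open>x\<close> are what is needed to adjoin
  \<open>x / 3\<close> and keep integral values. Vectors of norm prime to 3 are split off, as in a
  3-adic Jordan decomposition, until the remaining form is divisible by 3; the vector found there is
  then corrected along those split off.\<close>

lemma three_step:
  assumes "hermitian b" "entries_in \<int> b vs" "gdet b vs \<in> mults 27"
  shows "\<exists>x ws. equ \<int> vs (x # ws) \<and> b x x \<in> mults 9 \<and> (\<forall>y\<in>set ws. b x y \<in> mults 3)"
  using assms
proof (induction "length vs" arbitrary: b vs rule: less_induct)
  case less
  note h = less.prems(1)
  show ?case
  proof (cases "entries_in (mults 3) b vs")
    case True
    from three_step_divisible[OF h True less.prems(3)] obtain x ws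
      where x: "equ \<int> vs (x # ws)" "b x x \<in> mults 9" by blast
    from equ_entries_in[OF x(1) h star_ring_Ints ideal_mults True] x show ?thesis
      by (auto simp: entries_in_def)
  next
    case False
    from entries_in_unit_pivot[OF h less.prems(2) False] obtain v ws
      where v: "equ \<int> vs (v # ws)" "b v v \<notin> mults 3" by blast
    have e: "entries_in \<int> b (v # ws)"
      by (rule equ_entries_in[OF v(1) h star_ring_Ints ideal_in_self[OF star_ring_Ints] less.prems(2)])
    then obtain a where a: "b v v = of_int a" by (auto simp: entries_in_def elim: Ints_cases)
    have na: "\<not> 3 dvd a" using v(2) a by (simp add: mults_iff)
    have v0: "b v v \<noteq> 0" using na a by auto
    have cop: "coprime a 3" using na prime_imp_coprime[of "3::int" a] by (simp add: coprime_commute)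
    hence cop9: "coprime a 9" using coprime_mult_right_iff[of a 3 3] by simp
    hence cop27: "coprime a 27" using coprime_mult_right_iff[of a 9 3] cop by simp
    \<comment> \<open>the Schur complement is scaled by \<open>b v v\<close>, which is prime to 3, to keep integral values\<close>
    define c where "c = (\<lambda>x y. b v v * schur b v x y)"
    have c: "c x y = b v v * b x y - b x v * b v y" for x y
      using v0 by (simp add: c_def schur_def field_simps)
    have hc: "hermitian c" unfolding c_def
      by (rule hermitian_scale[OF hermitian_schur[OF h]]) (simp add: a)
    have ec: "entries_in \<int> c ws" using e by (auto simp: entries_in_def c)
    have "of_int a * gdet c ws = b v v ^ length ws * gdet b (v # ws)"
      unfolding c_def gdet_scale gdet_Cons[of b, OF v0] by (simp add: a)
    also have "gdet b (v # ws) = gdet b vs" by (rule equ_gdet[OF v(1) h])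
    finally have "of_int a * gdet c ws \<in> mults 27"
      using less.prems(3) ideal_mults[of 27] by (auto simp: a ideal_in_def)
    hence dc: "gdet c ws \<in> mults 27"
      by (rule mults_cancel[OF gdet_in[OF star_ring_Ints ec] _ cop27])
    have "length ws < length vs" using equ_length[OF v(1)] by simp
    from less.hyps[OF this hc ec dc] obtain x zs
      where x: "equ \<int> ws (x # zs)" "c x x \<in> mults 9" "\<And>y. y \<in> set zs \<Longrightarrow> c x y \<in> mults 3" by blast
    have e1: "equ \<int> vs (v # x # zs)" by (rule equ_trans[OF v(1) equ_Cons[OF x(1)]])
    hence "entries_in \<int> b (v # x # zs)"
      by (rule equ_entries_in[OF _ h star_ring_Ints ideal_in_self[OF star_ring_Ints] less.prems(2)])
    then obtain t where t: "b x v = of_int t" by (auto simp: entries_in_def elim: Ints_cases)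
    \<comment> \<open>Since \<open>a\<close> is invertible modulo 9, subtracting a multiple of
      \<open>v\<close> makes \<open>x\<close> orthogonal to \<open>v\<close> modulo 9. Its values
      under \<open>c\<close> do not change, because \<open>v\<close> lies in the radical of
      \<open>c\<close>.\<close>
    obtain s where s: "9 dvd t - s * a"
    proof -
      obtain f g where "f * a + g * 9 = 1" using bezout_int[of a 9] cop9 by auto
      hence "t = t * (f * a + g * 9)" by simp
      hence "t - (t * f) * a = 9 * (t * g)" by (simp add: algebra_simps)
      thus ?thesis using that[of "t * f"] by simp
    qed
    let ?y = "vadd x (smul (of_int s) (smul (-1) v))"
    have e2: "equ \<int> vs (?y # smul (-1) v # zs)"
      by (rule equ_trans[OF e1 equ_trans[OF equ_swap[OF star_ring_Ints] equ_add_second]]) simp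
    have e3: "entries_in \<int> b (?y # smul (-1) v # zs)"
      by (rule equ_entries_in[OF e2 h star_ring_Ints ideal_in_self[OF star_ring_Ints] less.prems(2)])
    have yv: "b ?y v = of_int (t - s * a)" by (simp add: hermitianD[OF h] t a)
    obtain k where "t - s * a = 9 * k" using s by (auto elim: dvdE)
    hence k: "b ?y v = of_int (9 * k)" using yv by simp
    have vy: "b v ?y = of_int (9 * k)" using hermitianD(5)[OF h, of ?y v] k by simp
    have "c v z = 0" for z using schur_radical[OF h v0] by (simp add: c_def)
    hence cy: "c ?y z = c x z" for z by (simp add: hermitianD[OF hc])
    hence cyy: "c ?y ?y = c x x" using hermitianD(5)[OF hc] by metis
    have "of_int a * b ?y ?y = c x x + b ?y v * b v ?y"
      using c[of ?y ?y] cyy by (simp add: a)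
    also have "\<dots> \<in> mults 9"
    proof -
      obtain n where "c x x = of_int (9 * n)" using x(2) by (meson multsE)
      hence "c x x + b ?y v * b v ?y = of_int (9 * n + 9 * k * (9 * k))" by (simp add: k vy)
      thus ?thesis by (simp only: mults_iff) simp
    qed
    finally have "b ?y ?y \<in> mults 9"
      by (rule mults_cancel[OF _ _ cop9, rotated]) (use e3 in \<open>simp add: entries_in_def\<close>)
    moreover have "b ?y z \<in> mults 3" if "z \<in> set (smul (-1) v # zs)" for z
    proof (cases "z = smul (-1) v")
      case True
      have "b ?y z = of_int (3 * (- 3 * k))" unfolding True using k by (simp add: hermitianD[OF h])
      thus ?thesis by (simp only: mults_iff) simp
    next
      case False
      hence z: "z \<in> set zs" using that by simp
      have bz: "b v z \<in> \<int>" "b ?y z \<in> \<int>"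
        using equ_entries_in[OF e1 h star_ring_Ints ideal_in_self[OF star_ring_Ints] less.prems(2)] e3 z
        by (auto simp: entries_in_def)
      then obtain l where l: "b v z = of_int l" by (auto elim: Ints_cases)
      obtain n where "c x z = of_int (3 * n)" using x(3)[OF z] by (meson multsE)
      hence "of_int a * b ?y z = of_int (3 * n + 9 * k * l)"
        using c[of ?y z] by (simp add: a cy k l)
      moreover have "3 * n + 9 * k * l = 3 * (n + 3 * k * l)" by simp
      ultimately have "of_int a * b ?y z \<in> mults 3" by (simp only: mults_iff dvd_triv_left)
      thus ?thesis by (rule mults_cancel[OF bz(2) _ cop])
    qed
    ultimately show ?thesis using e2 by blast
  qed
qed

lemma gdet_head_smul:
  assumes h: "hermitian b" and x: "b x x \<noteq> 0" and c: "c \<noteq> 0"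
  shows "gdet b (smul c x # ws) = c * cnj c * gdet b (x # ws)"
proof -
  have "schur b (smul c x) = schur b x"
    by (intro ext) (use c in \<open>simp add: schur_def hermitianD[OF h]\<close>)
  moreover have "b (smul c x) (smul c x) \<noteq> 0" using x c by (simp add: hermitianD[OF h])
  ultimately show ?thesis using x by (simp add: gdet_Cons hermitianD[OF h])
qed

text \<open>Replacing the head \<open>x\<close> by \<open>x / 3\<close> enlarges the lattice by
  index 3. Anisotropy survives because three times any vector of the larger lattice lies in the old
  one.\<close>

lemma three_descent:
  assumes h: "hermitian b" and e: "entries_in \<int> b vs" and a: "aniso \<int> b vs" and d: "gdet b vs \<in> mults 27"
  shows "\<exists>ws. length ws = length vs \<and> entries_in \<int> b ws \<and> aniso \<int> b ws \<and> gdet b ws = gdet b vs / 9"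
proof -
  from three_step[OF h e d] obtain x ws where x: "equ \<int> vs (x # ws)" "b x x \<in> mults 9"
    "\<And>y. y \<in> set ws \<Longrightarrow> b x y \<in> mults 3" by blast
  let ?y = "smul (1 / 3) x"
  note hh = hermitianD[OF h]
  have e1: "entries_in \<int> b (x # ws)"
    by (rule equ_entries_in[OF x(1) h star_ring_Ints ideal_in_self[OF star_ring_Ints] e])
  have a1: "aniso \<int> b (x # ws)" by (rule equ_good[OF x(1) star_ring_Ints a])
  have x0: "b x x \<noteq> 0" by (rule good_head[OF star_ring_Ints a1])
  show ?thesis
  proof (intro exI conjI)
    show "length (?y # ws) = length vs" using equ_length[OF x(1)] by simp
    show "gdet b (?y # ws) = gdet b vs / 9"
      using gdet_head_smul[where b = b and c = "1/3" and ws = ws, OF h x0] equ_gdet[OF x(1) h] by simp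
    have yy: "b ?y ?y \<in> \<int>" using multsE[OF x(2)] by (auto simp: hh)
    have yz: "b ?y z \<in> \<int>" "b z ?y \<in> \<int>" if "z \<in> set ws" for z
    proof -
      from multsE[OF x(3)[OF that]] show 1: "b ?y z \<in> \<int>" by (auto simp: hh)
      have "b z ?y = cnj (b ?y z)" using hh(5)[of ?y z] by simp
      with 1 show "b z ?y \<in> \<int>" by (auto elim!: Ints_cases)
    qed
    show "entries_in \<int> b (?y # ws)" using yy yz e1 by (auto simp: entries_in_def)
    show "aniso \<int> b (?y # ws)" unfolding good_def
    proof (intro allI impI)
      fix c assume c: "nontriv \<int> (length (?y # ws)) c"
      let ?d = "\<lambda>i. if i = 0 then c 0 else 3 * c i"
      have "nontriv \<int> (length (x # ws)) ?d" using c by (auto simp: nontriv_def less_Suc_eq_0_disj)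
      hence "b (comb ?d (x # ws)) (comb ?d (x # ws)) \<noteq> 0" using a1 unfolding good_def by blast
      moreover have "comb c (?y # ws) = smul (1 / 3) (comb ?d (x # ws))"
        by (simp add: comb_Cons comb_smul) (auto simp: vadd_def smul_def algebra_simps)
      ultimately show "b (comb c (?y # ws)) (comb c (?y # ws)) \<noteq> 0" by (simp add: hh)
    qed
  qed
qed

section \<open>Isotropic vectors of Lorentzian lattices\<close>

definition nonneg :: "cform \<Rightarrow> bool" where
  "nonneg b \<longleftrightarrow> (\<forall>x. 0 \<le> Re (b x x))"

text \<open>At most one negative direction, phrased so as to be inherited by Schur forms: along a
  negative vector they become \<open>nonneg\<close>, and along any non-isotropic vector they stay
  \<open>lorentzian\<close>. No rank enters, since Schur forms live on the whole space and are
  degenerate there.\<close>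

definition lorentzian :: "cform \<Rightarrow> bool" where
  "lorentzian b \<longleftrightarrow> (\<forall>v. Re (b v v) < 0 \<longrightarrow> nonneg (schur b v))"

lemma hermitian_nz: "hermitian b \<Longrightarrow> b v v \<noteq> 0 \<longleftrightarrow> Re (b v v) \<noteq> 0"
  using hermitianD(7)[of b v] by (auto simp: complex_eq_iff)

lemma nonneg_schur:
  assumes h: "hermitian b" and n: "nonneg b" and v: "b v v \<noteq> 0" shows "nonneg (schur b v)"
  using n unfolding nonneg_def schur_proj[OF h v] by blast

text \<open>The iterated Schur form along \<open>v\<close> is the Schur form of \<open>b\<close>
  along the projection of \<open>v\<close>, evaluated at projected vectors.\<close>

lemma lorentzian_schur:
  assumes h: "hermitian b" and l: "lorentzian b" and u: "b u u \<noteq> 0" shows "lorentzian (schur b u)"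
  unfolding lorentzian_def
proof (intro allI impI)
  fix v assume v: "Re (schur b u v v) < 0"
  let ?P = "\<lambda>x. vadd x (smul (- (b x u / b u u)) u)"
  note s = schur_proj[OF h u]
  have "nonneg (schur b (?P v))" using l v unfolding lorentzian_def s by blast
  moreover have "schur (schur b u) v x x = schur b (?P v) (?P x) (?P x)" for x
    unfolding schur_def[of "schur b u"] s schur_def[of b "?P v"] ..
  ultimately show "nonneg (schur (schur b u) v)" by (simp add: nonneg_def)
qed

section \<open>Pivots of reduced lists and lower bounds for their product\<close>

fun pivots :: "cform \<Rightarrow> cvec list \<Rightarrow> real list" where
  "pivots b [] = []"
| "pivots b (v # vs) = Re (b v v) # pivots (schur b v) vs"

lemma length_pivots [simp]: "length (pivots b vs) = length vs"
  by (induction vs arbitrary: b) auto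

fun chain :: "real list \<Rightarrow> bool" where
  "chain (a # c # l) \<longleftrightarrow> a \<noteq> 0 \<and> \<bar>c\<bar> \<ge> 3 / 4 * \<bar>a\<bar> \<and> (a * c < 0 \<longrightarrow> \<bar>c\<bar> \<ge> 5 / 4 * \<bar>a\<bar>) \<and> chain (c # l)"
| "chain [a] \<longleftrightarrow> a \<noteq> 0"
| "chain [] \<longleftrightarrow> True"

fun one_neg :: "real list \<Rightarrow> bool" where
  "one_neg (a # l) \<longleftrightarrow> (if a < 0 then (\<forall>c\<in>set l. c \<ge> 0) else one_neg l)"
| "one_neg [] \<longleftrightarrow> True"

lemma nonneg_pivots:
  assumes "hermitian b" "nonneg b" "aniso R b vs" "scaled_in R b vs" "star_ring R"
  shows "\<forall>c\<in>set (pivots b vs). c > 0"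
  using assms(1-4)
proof (induction vs arbitrary: b)
  case (Cons v vs)
  have v: "b v v \<noteq> 0" by (rule good_head[OF assms(5) Cons.prems(3)])
  have "Re (b v v) \<ge> 0" using Cons.prems(2) by (auto simp: nonneg_def)
  hence "Re (b v v) > 0" using v hermitian_nz[OF Cons.prems(1)] by force
  thus ?case
    using Cons.IH[OF hermitian_schur nonneg_schur aniso_schur scaled_in_schur] Cons.prems v assms(5) by auto
qed auto

lemma lorentzian_pivots:
  assumes "hermitian b" "lorentzian b" "aniso R b vs" "scaled_in R b vs" "star_ring R"
  shows "one_neg (pivots b vs)"
  using assms(1-4)
proof (induction vs arbitrary: b)
  case (Cons v vs)
  have v: "b v v \<noteq> 0" by (rule good_head[OF assms(5) Cons.prems(3)])
  note n = hermitian_schur[OF Cons.prems(1), of v] aniso_schur[OF Cons.prems(1) assms(5) Cons.prems(3,4)]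
    scaled_in_schur[OF Cons.prems(1) assms(5) Cons.prems(3,4)]
  show ?case
  proof (cases "Re (b v v) < 0")
    case True
    hence "nonneg (schur b v)" using Cons.prems(2) by (auto simp: lorentzian_def)
    from nonneg_pivots[OF n(1) this n(2,3) assms(5)] True show ?thesis by (auto intro: less_imp_le)
  next
    case False
    thus ?thesis using Cons.IH[OF n(1) lorentzian_schur[OF Cons.prems(1,2) v] n(2,3)] by simp
  qed
qed auto

lemma gdet_pivots:
  assumes "hermitian b" "aniso R b vs" "scaled_in R b vs" "star_ring R"
  shows "gdet b vs = of_real (prod_list (pivots b vs))"
  using assms(1-3)
proof (induction vs arbitrary: b)
  case (Cons v vs)
  have v: "b v v \<noteq> 0" by (rule good_head[OF assms(4) Cons.prems(2)])
  have "b v v = of_real (Re (b v v))" using hermitianD(7)[OF Cons.prems(1)] by (simp add: complex_eq_iff)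
  thus ?case using Cons.IH[OF hermitian_schur[OF Cons.prems(1)] aniso_schur scaled_in_schur] Cons.prems v assms(4)
    by (simp add: gdet_Cons)
qed auto

lemma entries_real_schur:
  assumes "hermitian b" "entries_in \<real> b (v # ws)" shows "entries_in \<real> (schur b v) ws"
  using assms(2) unfolding entries_in_def schur_def by (auto intro!: Reals_diff Reals_divide Reals_mult)

text \<open>Completing the square in \<open>m\<close>: the distance of
  \<open>- b w v / b v v\<close> from the ring controls how small the norm of \<open>w + m v\<close>
  can be made.\<close>

lemma schur_translate:
  assumes h: "hermitian b" and v: "b v v \<noteq> 0"
  shows "b (vadd w (smul m v)) (vadd w (smul m v)) =
    schur b v w w + b v v * of_real ((cmod (b w v / b v v + m))\<^sup>2)"
proof -
  note hh = hermitianD[OF h]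
  have "of_real ((cmod (b w v / b v v + m))\<^sup>2) = (b w v / b v v + m) * cnj (b w v / b v v + m)"
    by (simp only: complex_norm_square)
  also have "\<dots> = (b w v / b v v + m) * (b v w / b v v + cnj m)" by (simp add: hh)
  finally show ?thesis using v by (simp add: schur_def hh field_simps)
qed

text \<open>With \<open>s = b w v / a\<close>, the norm of \<open>w + m v\<close> is
  \<open>c + a * (s + m)\<^sup>2\<close>. A translate with
  \<open>\<bar>s + m\<bar> \<le> 1/2\<close> yields the factor \<open>1 - 1/4\<close>. For opposite
  signs the summands cancel, so a square \<open>y\<close> between \<open>1/4\<close> and
  \<open>1\<close> is chosen instead: \<open>\<bar>a\<bar> * y\<close> is at most
  \<open>\<bar>a\<bar>\<close>, so the sum must have the sign of \<open>c\<close>, whence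
  \<open>\<bar>c\<bar> \<ge> \<bar>a\<bar> + \<bar>a\<bar> * y\<close>.\<close>

lemma reduced_step:
  assumes h: "hermitian b" and r: "reduced \<int> b (v # w # ws)" and v: "b v v \<noteq> 0" and re: "b w v \<in> \<real>"
    and c0: "schur b v w w \<noteq> 0"
  defines "a \<equiv> Re (b v v)" and "c \<equiv> Re (schur b v w w)"
  shows "\<bar>c\<bar> \<ge> 3 / 4 * \<bar>a\<bar>" "a * c < 0 \<Longrightarrow> \<bar>c\<bar> \<ge> 5 / 4 * \<bar>a\<bar>"
proof -
  have bv: "b v v = of_real a" using hermitianD(7)[OF h] by (simp add: a_def complex_eq_iff)
  have bc: "schur b v w w = of_real c"
    using hermitianD(7)[OF hermitian_schur[OF h]] by (simp add: c_def complex_eq_iff)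
  obtain t where t: "b w v = of_real t" using re by (auto elim: Reals_cases)
  define s where "s = t / a"
  have key: "\<bar>a\<bar> \<le> \<bar>c + a * (s + of_int m)\<^sup>2\<bar>" for m :: int
  proof -
    have eq: "b w v / of_real a + of_int m = of_real (s + of_int m)" by (simp add: t s_def)
    have "b (vadd w (smul (of_int m) v)) (vadd w (smul (of_int m) v)) = of_real (c + a * (s + of_int m)\<^sup>2)"
      unfolding schur_translate[OF h v] bc bv eq norm_of_real power2_abs by simp
    moreover have "cmod (b v v) \<le> cmod (b (vadd w (smul (of_int m) v)) (vadd w (smul (of_int m) v)))"
      using r by simp
    ultimately show ?thesis by (simp only: bv norm_of_real)
  qed
  define m where "m = - round s"
  define x where "x = s + of_int m"
  have x: "\<bar>x\<bar> \<le> 1 / 2" using of_int_round_abs_le[of s] by (simp add: x_def m_def abs_minus_commute)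
  have x2: "x\<^sup>2 \<le> 1 / 4" using power_mono[OF x, of 2] by (simp add: power2_eq_square)
  have "\<bar>a\<bar> \<le> \<bar>c\<bar> + \<bar>a\<bar> * x\<^sup>2"
    using key[of m] abs_triangle_ineq[of c "a * x\<^sup>2"] by (simp add: x_def abs_mult)
  also have "\<dots> \<le> \<bar>c\<bar> + \<bar>a\<bar> * (1 / 4)" using x2 by (intro add_left_mono mult_left_mono) auto
  finally show "\<bar>c\<bar> \<ge> 3 / 4 * \<bar>a\<bar>" by simp
  assume ac: "a * c < 0"
  \<comment> \<open>The neighbour of the nearest integer, on the other side of zero:
    \<open>\<bar>x\<bar> \<le> 1/2\<close> puts \<open>1 - \<bar>x\<bar>\<close> between
    \<open>1/2\<close> and \<open>1\<close>.\<close>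
  obtain n :: int where n: "1 / 4 \<le> (s + of_int n)\<^sup>2" "(s + of_int n)\<^sup>2 \<le> 1"
  proof (cases "x \<ge> 0")
    case True
    have "\<bar>1 - x\<bar> \<le> 1" "\<bar>1 / 2\<bar> \<le> \<bar>1 - x\<bar>" using True x by auto
    hence "(1 - x)\<^sup>2 \<le> 1" "(1 / 2)\<^sup>2 \<le> (1 - x)\<^sup>2" by (metis abs_1 abs_le_square_iff one_power2, metis abs_le_square_iff)
    moreover have "s + of_int (m - 1) = - (1 - x)" by (simp add: x_def)
    ultimately show ?thesis using that[of "m - 1"] by (simp only: power2_minus) (simp add: power2_eq_square)
  next
    case False
    have "\<bar>1 + x\<bar> \<le> 1" "\<bar>1 / 2\<bar> \<le> \<bar>1 + x\<bar>" using False x by auto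
    hence "(1 + x)\<^sup>2 \<le> 1" "(1 / 2)\<^sup>2 \<le> (1 + x)\<^sup>2" by (metis abs_1 abs_le_square_iff one_power2, metis abs_le_square_iff)
    moreover have "s + of_int (m + 1) = 1 + x" by (simp add: x_def)
    ultimately show ?thesis using that[of "m + 1"] by (simp only:) (simp add: power2_eq_square)
  qed
  define y where "y = (s + of_int n)\<^sup>2"
  have y: "1 / 4 \<le> y" "y \<le> 1" using n by (auto simp: y_def)
  have k: "\<bar>a\<bar> \<le> \<bar>c + a * y\<bar>" using key[of n] by (simp add: y_def)
  show "\<bar>c\<bar> \<ge> 5 / 4 * \<bar>a\<bar>"
  proof (cases "a > 0")
    case True
    hence c: "c < 0" using ac by (simp add: mult_less_0_iff)
    have "a * (1 / 4) \<le> a * y" "a * y \<le> a * 1" using True y by (auto intro!: mult_left_mono)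
    thus ?thesis using k True c by linarith
  next
    case False
    hence a: "a < 0" and c: "c > 0" using ac by (auto simp: mult_less_0_iff)
    have "a * y \<le> a * (1 / 4)" "a * 1 \<le> a * y" using a y by (auto intro!: mult_left_mono_neg)
    thus ?thesis using k a c by linarith
  qed
qed

lemma chain_pivots:
  assumes "hermitian b" "reduced \<int> b vs" "aniso \<int> b vs" "scaled_in \<int> b vs" "entries_in \<real> b vs"
  shows "chain (pivots b vs)"
  using assms
proof (induction vs arbitrary: b)
  case (Cons v vs)
  note h = Cons.prems(1)
  have v: "b v v \<noteq> 0" by (rule good_head[OF star_ring_Ints Cons.prems(3)])
  hence v': "Re (b v v) \<noteq> 0" using hermitian_nz[OF h] by simp
  note n = hermitian_schur[OF h, of v] aniso_schur[OF h star_ring_Ints Cons.prems(3,4)]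
    scaled_in_schur[OF h star_ring_Ints Cons.prems(3,4)] entries_real_schur[OF h Cons.prems(5)]
  show ?case
  proof (cases vs)
    case (Cons w ws)
    have r: "reduced \<int> b (v # w # ws)" "reduced \<int> (schur b v) vs" using Cons.prems(2) Cons by auto
    have w: "schur b v w w \<noteq> 0" using good_head[OF star_ring_Ints] n(2) Cons by blast
    have "b w v \<in> \<real>" using Cons.prems(5) Cons by (auto simp: entries_in_def)
    from reduced_step[OF h r(1) v this w] Cons.IH[OF n(1) r(2) n(2-4)] Cons v' show ?thesis by simp
  qed (use v' in simp)
qed auto

text \<open>A lower bound for the absolute product of \<open>n + 1\<close> pivots, the first of
  absolute value at least \<open>x\<close>, from the factor 3/4 at every step.\<close>

fun chain_lb :: "nat \<Rightarrow> real \<Rightarrow> real" where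
  "chain_lb 0 x = x"
| "chain_lb (Suc n) x = x * chain_lb n (3 / 4 * x)"

text \<open>
  The value at \<open>0\<close> is arbitrary: a single positive pivot has no negative product. It only has to be
  large enough not to attain the minimum.
\<close>

fun neg_chain_lb :: "nat \<Rightarrow> real \<Rightarrow> real" where
  "neg_chain_lb 0 x = 4"
| "neg_chain_lb (Suc n) x = x * min (chain_lb n (5 / 4 * x)) (neg_chain_lb n (3 / 4 * x))"

lemma chain_lb_nonneg: "0 \<le> x \<Longrightarrow> 0 \<le> chain_lb n x"
  by (induction n arbitrary: x) auto

lemma neg_chain_lb_nonneg: "0 \<le> x \<Longrightarrow> 0 \<le> neg_chain_lb n x"
  by (induction n arbitrary: x) (auto simp: chain_lb_nonneg min_def)

lemma chain_lb:
  assumes "chain (a # l)" "0 \<le> x" "x \<le> \<bar>a\<bar>"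
  shows "chain_lb (length l) x \<le> \<bar>prod_list (a # l)\<bar>"
  using assms
proof (induction l arbitrary: a x)
  case (Cons c l)
  have "chain_lb (length l) (3 / 4 * x) \<le> \<bar>prod_list (c # l)\<bar>"
    by (rule Cons.IH) (use Cons.prems in auto)
  hence "x * chain_lb (length l) (3 / 4 * x) \<le> \<bar>a\<bar> * \<bar>prod_list (c # l)\<bar>"
    using Cons.prems(2,3) by (intro mult_mono chain_lb_nonneg) auto
  thus ?case by (simp add: abs_mult)
qed auto

text \<open>A negative product of several pivots, at most one of them negative, contains a change of
  sign. If it occurs at the first step, the factor there is 5/4 and the rest is bounded by
  \<open>chain_lb\<close>; otherwise the two leading pivots are positive and the tail still has a
  negative product.\<close>

lemma neg_chain_lb:
  assumes "chain (a # l)" "one_neg (a # l)" "prod_list (a # l) < 0" "l \<noteq> [] \<or> a > 0" "0 \<le> x" "x \<le> \<bar>a\<bar>"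
  shows "neg_chain_lb (length l) x \<le> \<bar>prod_list (a # l)\<bar>"
  using assms
proof (induction l arbitrary: a x)
  case (Cons c l)
  have "min (chain_lb (length l) (5 / 4 * x)) (neg_chain_lb (length l) (3 / 4 * x)) \<le> \<bar>prod_list (c # l)\<bar>"
  proof (cases "a * c < 0")
    case True
    have "chain_lb (length l) (5 / 4 * x) \<le> \<bar>prod_list (c # l)\<bar>"
      by (rule chain_lb) (use Cons.prems True in auto)
    thus ?thesis by simp
  next
    case False
    have "a \<noteq> 0" "c \<noteq> 0" using Cons.prems(1) by (cases l, auto)+
    moreover have "\<not> a < 0" using Cons.prems(2) False \<open>c \<noteq> 0\<close> by (auto simp: mult_less_0_iff)
    ultimately have a: "a > 0" "c > 0" using False by (auto simp: mult_less_0_iff)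
    hence "prod_list (c # l) < 0" using Cons.prems(3) by (simp add: mult_less_0_iff)
    hence "neg_chain_lb (length l) (3 / 4 * x) \<le> \<bar>prod_list (c # l)\<bar>"
      by (intro Cons.IH) (use Cons.prems a in auto)
    thus ?thesis by simp
  qed
  hence "x * min (chain_lb (length l) (5 / 4 * x)) (neg_chain_lb (length l) (3 / 4 * x)) \<le> \<bar>a\<bar> * \<bar>prod_list (c # l)\<bar>"
    using Cons.prems(5,6) chain_lb_nonneg[of "5 / 4 * x"] neg_chain_lb_nonneg[of "3 / 4 * x"] by (intro mult_mono) auto
  thus ?case by (simp add: abs_mult)
qed auto

text \<open>The margin is thin. For five pivots starting at 2 the worst case has its change of sign
  at the last step, with bound \<open>2^5 * (3/4)^10 * (5/3)\<close>, about 3.003; with 3/4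
  throughout it would be about 1.8 and exclude nothing.\<close>

lemma chain_bound:
  assumes "chain (a # l)" "one_neg (a # l)" "prod_list (a # l) = -3" "1 \<le> length l" "length l \<le> 4"
  shows "\<bar>a\<bar> < 2"
proof (rule ccontr)
  assume "\<not> \<bar>a\<bar> < 2"
  hence "neg_chain_lb (length l) 2 \<le> \<bar>prod_list (a # l)\<bar>"
    by (intro neg_chain_lb[OF assms(1,2)]) (use assms(3,4) in auto)
  hence le: "neg_chain_lb (length l) 2 \<le> 3" unfolding assms(3) by simp
  have "length l \<in> {1, 2, 3, 4}" using assms(4,5) by auto
  moreover have "neg_chain_lb 1 2 > 3" "neg_chain_lb 2 2 > 3" "neg_chain_lb 3 2 > 3" "neg_chain_lb 4 2 > 3"
    by (simp_all add: eval_nat_numeral min_def)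
  ultimately show False using le by auto
qed

section \<open>Small values of lattices of determinant 3 and -3\<close>

definition represents :: "cform \<Rightarrow> cvec list \<Rightarrow> int \<Rightarrow> bool" where
  "represents b vs s \<longleftrightarrow> (\<exists>c. nontriv \<int> (length vs) c \<and> b (comb c vs) (comb c vs) = of_int s)"

lemma represents_head: "b v v = of_int s \<Longrightarrow> represents b (v # ws) s"
  unfolding represents_def
  using nontriv_single[OF star_ring_Ints, of "length ws"] comb_single[of 1 v ws] by auto

lemma aniso_represents: "aniso \<int> b vs \<Longrightarrow> \<not> represents b vs 0"
  by (auto simp: good_def represents_def)

text \<open>A vector of the tail may be changed by multiples of \<open>v\<close>. As
  \<open>v\<close> has norm \<open>e = \<plusminus>1\<close>, its component along \<open>v\<close>
  can be made any integer \<open>m\<close>, which adds \<open>e * m\<^sup>2\<close> to the Schur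
  value.\<close>

lemma represents_lift:
  assumes h: "hermitian b" and e: "entries_in \<int> b (v # ws)" and v: "b v v = of_int e" "e = 1 \<or> e = -1"
    and r: "represents (schur b v) ws s"
  shows "represents b (v # ws) (s + e * (m * m))"
proof -
  from r obtain c where c: "nontriv \<int> (length ws) c" "schur b v (comb c ws) (comb c ws) = of_int s"
    by (auto simp: represents_def)
  let ?x = "comb c ws"
  have "b ?x v \<in> \<int>"
    unfolding form_comb[OF h]
    by (rule star_ring_sum[OF star_ring_Ints]) (use c(1) e in \<open>auto simp: nontriv_def entries_in_def\<close>)
  then obtain k where k: "b ?x v = of_int k" by (auto elim: Ints_cases)
  \<comment> \<open>The component \<open>b ?x v / b v v\<close> equals \<open>e * k\<close>; this
    coefficient turns it into \<open>m\<close>.\<close>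
  let ?d = "\<lambda>i. if i = 0 then of_int (m - e * k) else c (i - 1)"
  have d: "nontriv \<int> (length (v # ws)) ?d" using c(1) by (auto simp: nontriv_def less_Suc_eq_0_disj)
  have "comb ?d (v # ws) = vadd ?x (smul (of_int (m - e * k)) v)"
    by (auto simp: comb_Cons vadd_def)
  moreover have "b (vadd ?x (smul (of_int (m - e * k)) v)) (vadd ?x (smul (of_int (m - e * k)) v)) = of_int (s + e * (m * m))"
  proof -
    have "b ?x v / b v v + of_int (m - e * k) = of_int m" using v k by auto
    moreover have "b v v \<noteq> 0" using v by auto
    ultimately show ?thesis by (simp add: schur_translate[OF h] c(2) v(1) power2_eq_square flip: of_int_mult)
  qed
  ultimately show ?thesis unfolding represents_def using d by metis
qed

lemma scaled_in_Ints: "entries_in \<int> b vs \<Longrightarrow> scaled_in \<int> b vs"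
  unfolding scaled_in_def by (intro exI[of _ "1::nat"]) simp

lemma entries_in_mono: "entries_in S b vs \<Longrightarrow> S \<subseteq> T \<Longrightarrow> entries_in T b vs"
  by (auto simp: entries_in_def)

lemma entries_Ints_schur:
  assumes "entries_in \<int> b (v # ws)" "b v v = 1 \<or> b v v = -1" shows "entries_in \<int> (schur b v) ws"
  using assms unfolding entries_in_def schur_def by auto

lemma reduced_tail: "reduced R b (v # ws) \<Longrightarrow> reduced R (schur b v) ws"
  by (cases ws) auto

definition reduced_state :: "cform \<Rightarrow> cvec list \<Rightarrow> bool" where
  "reduced_state b vs \<longleftrightarrow> hermitian b \<and> aniso \<int> b vs \<and> entries_in \<int> b vs \<and> reduced \<int> b vs"

lemma reduced_stateD:
  assumes "reduced_state b vs"
  shows "hermitian b" "aniso \<int> b vs" "entries_in \<int> b vs" "reduced \<int> b vs" "scaled_in \<int> b vs"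
    "chain (pivots b vs)" "gdet b vs = of_real (prod_list (pivots b vs))"
proof -
  show 1: "hermitian b" "aniso \<int> b vs" "entries_in \<int> b vs" "reduced \<int> b vs"
    using assms by (auto simp: reduced_state_def)
  show 2: "scaled_in \<int> b vs" by (rule scaled_in_Ints[OF 1(3)])
  have "entries_in \<real> b vs" by (rule entries_in_mono[OF 1(3)]) (auto elim: Ints_cases)
  thus "chain (pivots b vs)" by (rule chain_pivots[OF 1(1,4,2) 2])
  show "gdet b vs = of_real (prod_list (pivots b vs))" by (rule gdet_pivots[OF 1(1,2) 2 star_ring_Ints])
qed

lemma reduced_state_schur:
  assumes s: "reduced_state b (v # ws)" and v: "b v v = 1 \<or> b v v = -1"
  shows "reduced_state (schur b v) ws"
  unfolding reduced_state_def
  using reduced_stateD(1-5)[OF s] v entries_Ints_schur reduced_tail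
  by (auto intro: hermitian_schur aniso_schur star_ring_Ints)

lemma int_pivot:
  assumes s: "reduced_state b (v # ws)"
  obtains a :: int where "b v v = of_int a" "Re (b v v) = of_int a" "a \<noteq> 0"
proof -
  have "b v v \<in> \<int>" using reduced_stateD(3)[OF s] by (simp add: entries_in_def)
  moreover have "b v v \<noteq> 0" by (rule good_head[OF star_ring_Ints reduced_stateD(2)[OF s]])
  ultimately show ?thesis using that by (auto elim!: Ints_cases)
qed

lemma pivot_pm_one:
  assumes s: "reduced_state b (v # ws)" and l: "lorentzian b" and d: "gdet b (v # ws) = -3"
    and n: "1 \<le> length ws" "length ws \<le> 4"
  shows "b v v = 1 \<or> b v v = -1"
proof -
  note p = reduced_stateD[OF s]
  have "of_real (prod_list (pivots b (v # ws))) = (of_real (-3) :: complex)" using p(7) d by simp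
  hence "prod_list (pivots b (v # ws)) = -3" by (simp only: of_real_eq_iff)
  hence "\<bar>Re (b v v)\<bar> < 2"
    using chain_bound[of "Re (b v v)" "pivots (schur b v) ws"] p(6) n
      lorentzian_pivots[OF p(1) l p(2,5) star_ring_Ints] by simp
  moreover obtain a :: int where a: "b v v = of_int a" "Re (b v v) = of_int a" "a \<noteq> 0" by (rule int_pivot[OF s])
  ultimately have "\<bar>a\<bar> < 2" by linarith
  hence "a = 1 \<or> a = -1" using a(3) by auto
  thus ?thesis using a(1) by auto
qed

lemma gdet_tail:
  assumes "b v v = 1 \<or> b v v = -1" shows "gdet (schur b v) ws = b v v * gdet b (v # ws)"
proof -
  have "b v v \<noteq> 0" using assms by auto
  thus ?thesis using assms by (auto simp: gdet_Cons)
qed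

text \<open>Without a pivot \<open>-1\<close> the pivots are \<open>1, 1, 1, -3\<close>, and
  \<open>-3 + 1 + 1 = -1\<close>. A pivot \<open>-1\<close> gives the value at once and is carried
  upwards with \<open>m = 0\<close>. The claims for ranks 1 to 3 record the values \<open>-3\<close>
  and \<open>-2\<close> met on the way.\<close>

lemma lorentzian_represents_minus_one:
  assumes s: "reduced_state b vs" and l: "lorentzian b" and d: "gdet b vs = -3"
    and n: "length vs = 4"
  shows "represents b vs (-1)"
proof -
  have 1: "represents b vs (-3)" if "reduced_state b vs" "gdet b vs = -3" "length vs = 1" for b vs
  proof -
    obtain v where "vs = [v]" using \<open>length vs = 1\<close> by (auto simp: length_Suc_conv)
    thus ?thesis using represents_head[of b v "-3" "[]"] \<open>gdet b vs = -3\<close> by (simp add: gdet_single)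
  qed
  have step: "represents b (v # ws) (-1) \<or>
      (reduced_state (schur b v) ws \<and> lorentzian (schur b v) \<and> gdet (schur b v) ws = -3 \<and>
       (\<forall>s m. represents (schur b v) ws s \<longrightarrow> represents b (v # ws) (s + m * m)))"
    if a: "reduced_state b (v # ws)" "lorentzian b" "gdet b (v # ws) = -3" "1 \<le> length ws" "length ws \<le> 4" for b v ws
  proof -
    have v: "b v v = 1 \<or> b v v = -1" by (rule pivot_pm_one[OF a])
    show ?thesis
    proof (cases "b v v = 1")
      case True
      have "represents b (v # ws) (s + m * m)" if "represents (schur b v) ws s" for s m
        using represents_lift[OF reduced_stateD(1,3)[OF a(1)] _ _ that, of 1 m] True by simp
      thus ?thesis using True reduced_state_schur[OF a(1) v] gdet_tail[of b v ws, OF v] a(3)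
          lorentzian_schur[OF reduced_stateD(1)[OF a(1)] a(2), of v] by simp
    next
      case False
      thus ?thesis using v represents_head[of b v "-1" ws] by simp
    qed
  qed
  have 2: "represents b vs (-3) \<or> represents b vs (-1)"
    if a: "reduced_state b vs" "lorentzian b" "gdet b vs = -3" "length vs = 2" for b vs
  proof -
    obtain v ws where [simp]: "vs = v # ws" "length ws = 1" using \<open>length vs = 2\<close> by (cases vs) auto
    from step[of b v ws] a 1[of "schur b v" ws] show ?thesis by (metis \<open>vs = v # ws\<close> \<open>length ws = 1\<close> add.right_neutral le_refl mult_zero_left one_le_numeral)
  qed
  have 3: "represents b vs (-2) \<or> represents b vs (-1)"
    if a: "reduced_state b vs" "lorentzian b" "gdet b vs = -3" "length vs = 3" for b vs
  proof -
    obtain v ws where v: "vs = v # ws" "length ws = 2" using \<open>length vs = 3\<close> by (cases vs) auto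
    from step[of b v ws] a v
    consider "represents b vs (-1)" | "represents (schur b v) ws (-3) \<or> represents (schur b v) ws (-1)"
      "\<And>s m. represents (schur b v) ws s \<Longrightarrow> represents b vs (s + m * m)"
      using 2[of "schur b v" ws] by auto
    thus ?thesis
    proof cases
      case 2
      thus ?thesis using 2(2)[of "-3" 1] 2(2)[of "-1" 0] by auto
    qed simp
  qed
  have 4: "represents b vs (-1)"
    if a: "reduced_state b vs" "lorentzian b" "gdet b vs = -3" "length vs = 4" for b vs
  proof -
    obtain v ws where v: "vs = v # ws" "length ws = 3" using \<open>length vs = 4\<close> by (cases vs) auto
    from step[of b v ws] a v
    consider "represents b vs (-1)" | "represents (schur b v) ws (-2) \<or> represents (schur b v) ws (-1)"
      "\<And>s m. represents (schur b v) ws s \<Longrightarrow> represents b vs (s + m * m)"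
      using 3[of "schur b v" ws] by auto
    thus ?thesis
    proof cases
      case 2
      thus ?thesis using 2(2)[of "-2" 1] 2(2)[of "-1" 0] by auto
    qed simp
  qed
  show ?thesis by (rule 4[OF s l d n])
qed

text \<open>Excludes minimum 2 or more for a positive form of rank 4 and determinant 3. For minimum
  2 the pivot estimates alone give only \<open>2^4 * (3/4)^6\<close>, about 2.85, so the integrality
  of the leading minors \<open>m\<close> and \<open>q\<close> is used too: the inequalities become
  \<open>3 * m * m \<le> 8 * q\<close> and \<open>q * q \<le> 4 * m\<close>, which contradict
  \<open>m \<ge> 3\<close>.\<close>

lemma quaternary_min:
  fixes a m q :: int and c d e :: real
  assumes "2 \<le> a" "3 / 4 * a \<le> c" "3 / 4 * c \<le> d" "3 / 4 * d \<le> e" "a * c * d * e = 3"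
    and m: "a * c = of_int m" and q: "a * c * d = of_int q"
  shows False
proof -
  have pos: "0 < a" "0 < c" "0 < d" "0 < e" using assms(1-4) by linarith+
  have "a = 2"
  proof (rule ccontr)
    assume "a \<noteq> 2"
    hence a: "3 \<le> real_of_int a" using assms(1) by linarith
    hence c: "9/4 \<le> c" and d: "27/16 \<le> d" and e: "81/64 \<le> e" using assms(2-4) by linarith+
    have "3 * (9/4) * (27/16) * (81/64) \<le> a * c * d * e"
      using a c d e by (intro mult_mono mult_nonneg_nonneg) auto
    thus False using assms(5) by simp
  qed
  have mc: "2 * c = m" using m \<open>a = 2\<close> by simp
  have qd: "m * d = q" using q \<open>a = 2\<close> mc by simp
  have m3: "3 \<le> m" using mc assms(2) \<open>a = 2\<close> by simp
  have q0: "0 < q"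
  proof -
    have "0 < real_of_int m * d" using m3 pos by simp
    thus ?thesis using qd by simp
  qed
  have "q * e = 3" using assms(5) q by simp
  have "3 * m * m \<le> 8 * q"
  proof -
    have "real_of_int m * (3 * m / 8) \<le> m * d" using assms(3) mc m3 by (intro mult_left_mono) auto
    hence "3 * real_of_int m * m \<le> 8 * q" using qd by simp
    thus ?thesis by (metis of_int_le_iff of_int_mult of_int_numeral)
  qed
  moreover have "q * q \<le> 4 * m"
  proof -
    have x1: "real_of_int (m * q) * (3 / 4 * d) \<le> real_of_int (m * q) * e"
      using assms(4) m3 q0 by (intro mult_left_mono) auto
    have x2: "real_of_int (m * q) * (3 / 4 * d) = 3 / 4 * real_of_int (q * q)" using qd by (simp add: mult.commute)
    have x3: "real_of_int (m * q) * e = 3 * real_of_int m" using \<open>q * e = 3\<close> by simp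
    have "real_of_int (q * q) \<le> 4 * m" using x1[unfolded x2 x3] by simp
    thus ?thesis by linarith
  qed
  ultimately have 1: "3 * m * m \<le> 8 * q" and 2: "q * q \<le> 4 * m" .
  show False
  proof (cases "m = 3")
    case True
    hence "4 \<le> q" using 1 by simp
    hence "4 * 4 \<le> q * q" by (intro mult_mono) auto
    thus False using 2 True by simp
  next
    case False
    have "4 * 3 * m \<le> 3 * m * m" using m3 False by simp
    hence "3 * m \<le> 2 * q" using 1 by simp
    hence "(3 * m) * (3 * m) \<le> (2 * q) * (2 * q)" using m3 q0 by - (rule mult_mono, linarith+)
    hence "9 * (m * m) \<le> 16 * m" using 2 by simp
    moreover have "4 * m \<le> m * m" using m3 False by (intro mult_right_mono) auto
    ultimately show False using m3 by simp
  qed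
qed

lemma nonneg_represents_one:
  assumes s: "reduced_state b vs" and l: "nonneg b" and d: "gdet b vs = 3" and n: "length vs = 4"
  shows "represents b vs 1"
proof -
  obtain v1 v2 v3 v4 where vs: "vs = [v1, v2, v3, v4]" using n by (auto simp: length_Suc_conv eval_nat_numeral)
  note p = reduced_stateD[OF s]
  obtain a :: int where a: "b v1 v1 = of_int a" "Re (b v1 v1) = of_int a" "a \<noteq> 0"
    using int_pivot s unfolding vs by metis
  obtain c d e where cde: "pivots b vs = [of_int a, c, d, e]" "c = Re (schur b v1 v2 v2)"
    "d = Re (schur (schur b v1) v2 v3 v3)" unfolding vs using a by simp
  have pos: "of_int a > (0::real)" "c > 0" "d > 0" "e > 0"
    using nonneg_pivots[OF p(1) l p(2,5) star_ring_Ints] unfolding cde by auto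
  have ch: "3 / 4 * of_int a \<le> c" "3 / 4 * c \<le> d" "3 / 4 * d \<le> e" using p(6) pos unfolding cde by auto
  have "of_real (prod_list (pivots b vs)) = (of_real 3 :: complex)" using p(7) \<open>gdet b vs = 3\<close> by simp
  hence pr: "of_int a * c * d * e = 3" unfolding of_real_eq_iff cde by (simp add: mult.assoc)
  have v1: "b v1 v1 \<noteq> 0" using a by simp
  note h1 = hermitian_schur[OF p(1), of v1]
  have v2: "schur b v1 v2 v2 \<noteq> 0" using hermitian_nz[OF h1] cde(2) pos by auto
  note h2 = hermitian_schur[OF h1, of v2]
  have cc: "schur b v1 v2 v2 = of_real c" "schur (schur b v1) v2 v3 v3 = of_real d"
    using hermitianD(7)[OF h1, of v2] hermitianD(7)[OF h2, of v3] cde(2,3) by (auto simp: complex_eq_iff)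
  have "gdet b [v1, v2] \<in> \<int>" "gdet b [v1, v2, v3] \<in> \<int>"
    using p(3) unfolding vs by (auto intro!: gdet_in[OF star_ring_Ints] simp: entries_in_def)
  hence "of_int a * of_real c \<in> (\<int>::complex set)" "of_int a * of_real c * of_real d \<in> (\<int>::complex set)"
    using v1 v2 by (simp_all add: gdet_Cons a cc gdet_single mult.assoc)
  hence "of_real (of_int a * c) \<in> (\<int>::complex set)" "of_real (of_int a * c * d) \<in> (\<int>::complex set)" by simp_all
  then obtain m q :: int where mq: "of_real (of_int a * c) = (of_int m :: complex)"
      "of_real (of_int a * c * d) = (of_int q :: complex)" by (meson Ints_cases)
  hence mq': "of_int a * c = of_int m" "of_int a * c * d = of_int q"
    by (metis of_real_eq_iff of_real_of_int_eq)+
  have "a = 1"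
  proof (rule ccontr)
    assume "a \<noteq> 1"
    hence "2 \<le> a" using pos(1) by simp
    from quaternary_min[OF this ch pr mq'] show False .
  qed
  thus ?thesis using represents_head[of b v1 1 "[v2, v3, v4]"] a vs by simp
qed

text \<open>The first pivot is a unit and its complement represents the opposite unit: for pivot 1
  the complement is Lorentzian of determinant -3, for pivot -1 it is positive of determinant 3.
  Either way \<open>1 - 1 = 0\<close> is represented.\<close>

lemma lorentzian_det3_isotropic:
  assumes h: "hermitian b" and l: "lorentzian b" and a: "aniso \<int> b vs" and e: "entries_in \<int> b vs"
    and d: "gdet b vs = -3" and n: "length vs = 5"
  shows False
proof -
  obtain ws where ws: "equ \<int> vs ws" "reduced \<int> b ws"
    using hermite_reduction[OF h star_ring_Ints a scaled_in_Ints[OF e]] by blast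
  have s: "reduced_state b ws" unfolding reduced_state_def
    using h ws equ_good[OF ws(1) star_ring_Ints a]
      equ_entries_in[OF ws(1) h star_ring_Ints ideal_in_self[OF star_ring_Ints] e] by blast
  have d': "gdet b ws = -3" using equ_gdet[OF ws(1) h] d by simp
  have na: "\<not> represents b ws 0" using reduced_stateD(2)[OF s] aniso_represents[of b ws] by blast
  obtain v us where v: "ws = v # us" "length us = 4" using equ_length[OF ws(1)] n by (cases ws) auto
  have pm: "b v v = 1 \<or> b v v = -1"
    by (rule pivot_pm_one[OF s[unfolded v(1)] l d'[unfolded v(1)]]) (simp_all add: v)
  have s': "reduced_state (schur b v) us" by (rule reduced_state_schur[OF s[unfolded v(1)] pm])
  have en: "entries_in \<int> b (v # us)" using reduced_stateD(3)[OF s] v by simp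
  show False
  proof (cases "b v v = 1")
    case True
    have "represents (schur b v) us (-1)"
      using lorentzian_represents_minus_one[OF s' lorentzian_schur[OF h l]] True gdet_tail[of b v us, OF pm] d' v by simp
    from represents_lift[OF h en _ _ this, of 1 1] True na v show False by simp
  next
    case False
    hence m: "b v v = -1" using pm by simp
    have "nonneg (schur b v)" using l m by (auto simp: lorentzian_def)
    hence "represents (schur b v) us 1"
      using nonneg_represents_one[OF s'] gdet_tail[of b v us, OF pm] d' v m by simp
    from represents_lift[OF h en _ _ this, of "-1" 1] m na v show False by simp
  qed
qed

lemma lorentzian_odd_isotropic:
  assumes "hermitian b" "lorentzian b" "aniso \<int> b vs" "entries_in \<int> b vs" "gdet b vs = - (3 ^ (2 * k + 1))" "length vs = 5"
  shows False
  using assms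
proof (induction k arbitrary: vs)
  case 0 thus ?case using lorentzian_det3_isotropic[of b vs] by simp
next
  case (Suc k)
  have "gdet b vs = of_int (27 * (- (3 ^ (2 * k))))" using Suc.prems(5) by simp
  hence "gdet b vs \<in> mults 27" unfolding mults_def by blast
  from three_descent[OF Suc.prems(1,4,3) this] obtain ws where
    "length ws = length vs" "entries_in \<int> b ws" "aniso \<int> b ws" "gdet b ws = gdet b vs / 9" by blast
  thus ?case using Suc.IH[of ws] Suc.prems by simp
qed

lemma lorentzian_scale: "lorentzian b \<Longrightarrow> lorentzian (\<lambda>x y. 3 * b x y)"
proof -
  assume l: "lorentzian b"
  have "schur (\<lambda>x y. 3 * b x y) v x y = 3 * schur b v x y" for v x y
    by (simp add: schur_def algebra_simps)
  thus ?thesis using l by (auto simp: lorentzian_def nonneg_def)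
qed

theorem lorentzian_isotropic:
  assumes h: "hermitian b" and l: "lorentzian b" and a: "aniso \<int> b vs" and e: "entries_in \<int> b vs"
    and d: "gdet b vs = - (3 ^ k)" and n: "length vs = 5"
  shows False
proof (cases "odd k")
  case True
  thus False using lorentzian_odd_isotropic[OF h l a e _ n] d by (metis oddE)
next
  case False
  then obtain m where m: "k = 2 * m" by (auto elim: evenE)
  let ?b = "\<lambda>x y. 3 * b x y"
  show False
  \<comment> \<open>In rank 5 the scaling contributes \<open>3 ^ 5\<close>, and
    \<open>5 + 2 * m = 2 * (m + 2) + 1\<close>.\<close>
  proof (rule lorentzian_odd_isotropic[of ?b vs "m + 2"])
    show "hermitian ?b" by (rule hermitian_scale[OF h]) simp
    show "lorentzian ?b" by (rule lorentzian_scale[OF l])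
    show "aniso \<int> ?b vs" using a by (simp add: good_def)
    show "entries_in \<int> ?b vs" using e by (auto simp: entries_in_def)
    show "gdet ?b vs = - (3 ^ (2 * (m + 2) + 1))"
      by (simp add: gdet_scale d n m power_add)
  qed (rule n)
qed

section \<open>The Eisenstein lattice\<close>

definition theta :: complex where "theta = omega - cnj omega"

lemma omega_Complex: "omega = Complex (-1/2) (sqrt 3 / 2)"
proof -
  have "2 * pi / 3 = pi - pi / 3" by simp
  hence "cos (2 * pi / 3) = - cos (pi / 3)" "sin (2 * pi / 3) = sin (pi / 3)"
    by (simp_all only: cos_pi_minus sin_pi_minus)
  thus ?thesis by (simp add: omega_def cis.ctr cos_60 sin_60)
qed

lemma omega_sq: "omega * omega = - 1 - omega"
  by (simp add: omega_Complex complex_eq_iff field_simps)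

lemma cnj_omega: "cnj omega = - 1 - omega"
  by (simp add: omega_Complex complex_eq_iff)

lemma theta_eq: "theta = 2 * omega + 1"
  by (simp add: theta_def cnj_omega)

lemma theta_sq: "theta * theta = - 3"
proof -
  have "theta * theta = 4 * (omega * omega) + 4 * omega + 1" by (simp add: theta_eq algebra_simps)
  thus ?thesis by (simp add: omega_sq)
qed

lemma cnj_theta: "cnj theta = - theta"
  by (simp add: theta_def)

lemma theta_nz: "theta \<noteq> 0"
  using theta_sq by auto

lemma EisI: "of_int a + of_int b * omega \<in> Eis"
  by (auto simp: Eis_def)

lemma EisE: assumes "z \<in> Eis" obtains a b where "z = of_int a + of_int b * omega"
  using assms by (auto simp: Eis_def)

lemma star_ring_Eis: "star_ring Eis"
proof -
  have 0: "0 \<in> Eis" using EisI[of 0 0] by simp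
  have 1: "1 \<in> Eis" using EisI[of 1 0] by simp
  have add: "x + y \<in> Eis" if xy: "x \<in> Eis" "y \<in> Eis" for x y
  proof -
    obtain a b where x: "x = of_int a + of_int b * omega" using xy(1) by (rule EisE)
    obtain c d where y: "y = of_int c + of_int d * omega" using xy(2) by (rule EisE)
    have "x + y = of_int (a + c) + of_int (b + d) * omega" by (simp add: x y algebra_simps)
    thus ?thesis using EisI by metis
  qed
  have mult: "x * y \<in> Eis" if xy: "x \<in> Eis" "y \<in> Eis" for x y
  proof -
    obtain a b where x: "x = of_int a + of_int b * omega" using xy(1) by (rule EisE)
    obtain c d where y: "y = of_int c + of_int d * omega" using xy(2) by (rule EisE)
    have "x * y = of_int (a * c) + of_int (a * d + b * c) * omega + of_int (b * d) * (omega * omega)"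
      by (simp add: x y algebra_simps)
    also have "\<dots> = of_int (a * c - b * d) + of_int (a * d + b * c - b * d) * omega"
      by (simp add: omega_sq algebra_simps)
    finally show ?thesis using EisI by metis
  qed
  have neg: "- x \<in> Eis" if xe: "x \<in> Eis" for x
  proof -
    obtain a b where x: "x = of_int a + of_int b * omega" using xe by (rule EisE)
    have "- x = of_int (- a) + of_int (- b) * omega" by (simp add: x)
    thus ?thesis using EisI by metis
  qed
  have c: "cnj x \<in> Eis" if xe: "x \<in> Eis" for x
  proof -
    obtain a b where x: "x = of_int a + of_int b * omega" using xe by (rule EisE)
    have "cnj x = of_int (a - b) + of_int (- b) * omega" by (simp add: x cnj_omega algebra_simps)
    thus ?thesis using EisI by metis
  qed
  have r: "x \<in> \<int>" if xe: "x \<in> Eis" "x \<in> \<real>" for x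
  proof -
    obtain a b where x: "x = of_int a + of_int b * omega" using xe(1) by (rule EisE)
    have "Im x = 0" using xe(2) by (simp add: complex_is_Real_iff)
    hence "b = 0" by (simp add: x omega_Complex)
    thus ?thesis by (simp add: x)
  qed
  show ?thesis unfolding star_ring_def
    by (intro conjI ballI subsetI) (simp_all add: 0 1 add mult neg c r)
qed

lemmas Eis_closed = star_ringD[OF star_ring_Eis]

lemma omega_Eis: "omega \<in> Eis" using EisI[of 0 1] by simp
lemma theta_Eis: "theta \<in> Eis" using EisI[of 1 2] by (simp add: theta_eq add.commute)
lemma of_int_Eis: "of_int n \<in> Eis" by (rule star_ring_of_int[OF star_ring_Eis])
lemma Ints_Eis: "z \<in> \<int> \<Longrightarrow> z \<in> Eis" by (auto elim!: Ints_cases intro: of_int_Eis)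

lemma Eis_norm_nat:
  assumes "z \<in> Eis" obtains n :: nat where "(cmod z)\<^sup>2 = real n" "z * cnj z = of_nat n"
proof -
  have c: "of_real ((cmod z)\<^sup>2) = z * cnj z" by (rule complex_norm_square)
  have "z * cnj z \<in> Eis" using assms by (intro Eis_closed(4,7))
  moreover have "z * cnj z \<in> \<real>" unfolding c[symmetric] by simp
  ultimately have "z * cnj z \<in> \<int>" by (rule Eis_closed(8))
  then obtain k :: int where k: "z * cnj z = of_int k" by (auto elim: Ints_cases)
  hence "of_real ((cmod z)\<^sup>2) = (of_real (of_int k) :: complex)" using c by simp
  hence k2: "(cmod z)\<^sup>2 = of_int k" by (simp only: of_real_eq_iff)
  hence "k \<ge> 0" by (metis of_int_0_le_iff zero_le_power2)
  thus ?thesis using that[of "nat k"] k k2 by simp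
qed

lemma cmod_theta: "(cmod theta)\<^sup>2 = 3"
proof -
  have "of_real ((cmod theta)\<^sup>2) = (of_real 3 :: complex)"
    unfolding complex_norm_square cnj_theta using theta_sq by simp
  thus ?thesis by (simp only: of_real_eq_iff)
qed

section \<open>The Lorentzian form on the Eisenstein lattice\<close>

definition sgnw :: "nat \<Rightarrow> complex" where "sgnw i = (if i = 0 then -1 else 1)"

lemma hform_sgnw: "hform x y = (\<Sum>i<5. sgnw i * x i * cnj (y i))"
  by (simp add: hform_def sgnw_def)

lemma hermitian_hform: "hermitian hform"
proof -
  have "cnj (hform x y) = hform y x" for x y
    unfolding hform_sgnw cnj_sum by (rule sum.cong) (auto simp: sgnw_def)
  moreover have "hform (vadd x y) z = hform x z + hform y z" for x y z
    by (simp add: hform_sgnw vadd_def algebra_simps sum.distrib)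
  moreover have "hform (smul a x) y = a * hform x y" for a x y
    by (simp add: hform_sgnw smul_def sum_distrib_left algebra_simps)
  ultimately show ?thesis by (simp add: hermitian_def)
qed

lemmas hf = hermitianD[OF hermitian_hform]

lemma sum5: "(\<Sum>i<5. f i) = f 0 + (\<Sum>i\<in>{1..4::nat}. f i)"
proof -
  have "{..<5::nat} = insert 0 {1..4}" by auto
  thus ?thesis by simp
qed

lemma Re_hform_self: "Re (hform x x) = (\<Sum>i\<in>{1..4}. (cmod (x i))\<^sup>2) - (cmod (x 0))\<^sup>2"
proof -
  have "hform x x = (\<Sum>i\<in>{1..4}. x i * cnj (x i)) - x 0 * cnj (x 0)"
    unfolding hform_sgnw sum5 by (simp add: sgnw_def)
  also have "\<dots> = of_real ((\<Sum>i\<in>{1..4}. (cmod (x i))\<^sup>2) - (cmod (x 0))\<^sup>2)"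
    by (simp only: of_real_diff of_real_sum complex_norm_square)
  finally show ?thesis by (metis Re_complex_of_real)
qed

text \<open>The reversed Cauchy-Schwarz argument. Orthogonality bounds
  \<open>\<bar>y 0\<bar>\<^sup>2 * \<bar>v 0\<bar>\<^sup>2\<close> by \<open>Y * V\<close>, while
  \<open>Y \<le> \<bar>y 0\<bar>\<^sup>2\<close> and \<open>V < \<bar>v 0\<bar>\<^sup>2\<close>; so
  \<open>y 0\<close> vanishes, and \<open>Y\<close> with it. Both the signature of
  \<open>hform\<close> and the anisotropy of complements of negative vectors come from here.\<close>

lemma hform_orth_neg:
  assumes v: "Re (hform v v) < 0" and o: "hform y v = 0" and n: "Re (hform y y) \<le> 0" and i: "i < 5"
  shows "y i = 0"
proof -
  define Y where "Y = (\<Sum>i\<in>{1..4::nat}. (cmod (y i))\<^sup>2)"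
  define V where "V = (\<Sum>i\<in>{1..4::nat}. (cmod (v i))\<^sup>2)"
  have Y0: "Y \<ge> 0" and V0: "V \<ge> 0" by (auto simp: Y_def V_def intro: sum_nonneg)
  have y: "Y \<le> (cmod (y 0))\<^sup>2" and v': "V < (cmod (v 0))\<^sup>2"
    using v n by (simp_all add: Re_hform_self Y_def V_def)
  have "y 0 * cnj (v 0) = (\<Sum>i\<in>{1..4}. y i * cnj (v i))"
    using o unfolding hform_sgnw sum5 by (simp add: sgnw_def)
  hence "cmod (y 0) * cmod (v 0) = cmod (\<Sum>i\<in>{1..4}. y i * cnj (v i))"
    by (metis complex_mod_cnj norm_mult)
  also have "\<dots> \<le> (\<Sum>i\<in>{1..4}. \<bar>cmod (y i)\<bar> * \<bar>cmod (v i)\<bar>)"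
    by (rule order.trans[OF norm_sum]) (simp add: norm_mult)
  also have "\<dots> \<le> L2_set (\<lambda>i. cmod (y i)) {1..4} * L2_set (\<lambda>i. cmod (v i)) {1..4}"
    by (rule L2_set_mult_ineq)
  also have "\<dots> = sqrt Y * sqrt V" by (simp add: L2_set_def Y_def V_def)
  finally have "(cmod (y 0) * cmod (v 0))\<^sup>2 \<le> (sqrt Y * sqrt V)\<^sup>2" by (intro power_mono) auto
  hence le: "(cmod (y 0))\<^sup>2 * (cmod (v 0))\<^sup>2 \<le> Y * V" using Y0 V0 by (simp add: power_mult_distrib)
  have "y 0 = 0"
  proof (rule ccontr)
    assume "y 0 \<noteq> 0"
    hence "(cmod (y 0))\<^sup>2 * V < (cmod (y 0))\<^sup>2 * (cmod (v 0))\<^sup>2" using v' by (intro mult_strict_left_mono) auto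
    moreover have "Y * V \<le> (cmod (y 0))\<^sup>2 * V" using y V0 by (rule mult_right_mono)
    ultimately show False using le by simp
  qed
  hence "Y = 0" using y Y0 by simp
  hence "\<forall>i\<in>{1..4::nat}. y i = 0" unfolding Y_def by (simp add: sum_nonneg_eq_0_iff)
  thus ?thesis using \<open>y 0 = 0\<close> i by (cases "i = 0") auto
qed

lemma lorentzian_hform: "lorentzian hform"
  unfolding lorentzian_def nonneg_def
proof (intro allI impI)
  fix v x assume v: "Re (hform v v) < 0"
  hence v0: "hform v v \<noteq> 0" by auto
  let ?y = "vadd x (smul (- (hform x v / hform v v)) v)"
  have "hform ?y v = 0" using v0 by (simp add: hf)
  hence "Re (hform ?y ?y) \<ge> 0"
  proof (cases "Re (hform ?y ?y) \<le> 0")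
    case True
    from hform_orth_neg[OF v \<open>hform ?y v = 0\<close> True] have "\<forall>i<5. ?y i = 0" by blast
    thus ?thesis by (simp only: Re_hform_self) simp
  qed simp
  thus "0 \<le> Re (schur hform v x x)" unfolding schur_proj[OF hermitian_hform v0] .
qed

lemma LamI: "(\<And>i. i < 5 \<Longrightarrow> x i \<in> Eis) \<Longrightarrow> (\<And>i. i \<ge> 5 \<Longrightarrow> x i = 0) \<Longrightarrow> x \<in> Lam"
  by (auto simp: Lam_def)

lemma Lam_vadd: "x \<in> Lam \<Longrightarrow> y \<in> Lam \<Longrightarrow> vadd x y \<in> Lam"
  by (auto simp: Lam_def vadd_def Eis_closed)

lemma Lam_smul: "a \<in> Eis \<Longrightarrow> x \<in> Lam \<Longrightarrow> smul a x \<in> Lam"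
  by (auto simp: Lam_def smul_def Eis_closed)

lemma Lam_comb:
  assumes "\<And>i. i < length vs \<Longrightarrow> c i \<in> Eis" "set vs \<subseteq> Lam" shows "comb c vs \<in> Lam"
proof (rule LamI)
  fix k :: nat assume "k < 5"
  thus "comb c vs k \<in> Eis" unfolding comb_def
    using assms nth_mem by (intro star_ring_sum[OF star_ring_Eis] Eis_closed(4)) (auto simp: Lam_def subset_iff)
next
  fix k :: nat assume k: "k \<ge> 5"
  have "(vs ! i) k = 0" if "i < length vs" for i
    using assms(2) nth_mem[OF that] k by (auto simp: Lam_def)
  thus "comb c vs k = 0" by (simp add: comb_def)
qed

lemma Lam_supp: "x \<in> Lam \<Longrightarrow> i \<ge> 5 \<Longrightarrow> x i = 0"
  by (auto simp: Lam_def)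

lemma hform_Eis: "x \<in> Lam \<Longrightarrow> y \<in> Lam \<Longrightarrow> hform x y \<in> Eis"
  unfolding hform_sgnw
  by (intro star_ring_sum[OF star_ring_Eis] Eis_closed(4,7)) (auto simp: Lam_def sgnw_def Eis_closed)

definition ev :: "nat \<Rightarrow> cvec" where "ev i = (\<lambda>k. if k = i then 1 else 0)"

lemma ev_Lam: "i < 5 \<Longrightarrow> ev i \<in> Lam"
  by (auto simp: Lam_def ev_def Eis_closed)

lemma hform_ev: "i < 5 \<Longrightarrow> hform x (ev i) = sgnw i * x i"
  unfolding hform_sgnw by (simp add: ev_def if_distrib[of "\<lambda>t. _ * t"] if_distrib[of cnj] cong: if_cong)

lemma hform_nondegenerate: "\<lbrakk>\<And>i. i < 5 \<Longrightarrow> hform x (ev i) = 0\<rbrakk> \<Longrightarrow> \<forall>i<5. x i = 0"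
proof (intro allI impI)
  fix i :: nat assume a: "\<And>i. i < 5 \<Longrightarrow> hform x (ev i) = 0" and "i < 5"
  from a[OF this(2)] this(2) show "x i = 0" by (cases "i = 0") (simp_all add: hform_ev sgnw_def)
qed

section \<open>Coordinate determinants and Cramer's rule\<close>

definition cmat :: "cvec list \<Rightarrow> complex mat" where
  "cmat vs = mat 5 5 (\<lambda>(i, j). (vs ! i) j)"

lemma cmat_carrier [simp]: "cmat vs \<in> carrier_mat 5 5" by (simp add: cmat_def)

definition sgn_mat :: "complex mat" where
  "sgn_mat = mat 5 5 (\<lambda>(i, j). if i = j then sgnw i else 0)"

lemma sgn_mat_carrier: "sgn_mat \<in> carrier_mat 5 5" by (simp add: sgn_mat_def)

lemma det_sgn_mat: "det sgn_mat = -1"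
proof -
  have "det sgn_mat = prod_list (diag_mat sgn_mat)"
    by (rule det_lower_triangular[OF _ sgn_mat_carrier]) (auto simp: sgn_mat_def)
  also have "diag_mat sgn_mat = map sgnw [0..<5]"
    unfolding diag_mat_def by (rule map_cong) (auto simp: sgn_mat_def)
  also have "prod_list \<dots> = -1" by (simp add: upt_rec sgnw_def)
  finally show ?thesis .
qed

text \<open>The Gram matrix is the product of the coordinate matrix, the diagonal matrix of signs
  and the conjugate transpose. For lattice vectors the Gram determinant is thus minus the norm of an
  Eisenstein integer.\<close>

lemma gdet_hform:
  assumes n: "length vs = 5"
  shows "gdet hform vs = - (det (cmat vs) * cnj (det (cmat vs)))"
proof -
  define D where "D = sgn_mat"
  define C where "C = transpose_mat (map_mat cnj (cmat vs))"
  have D: "D \<in> carrier_mat 5 5" and C: "C \<in> carrier_mat 5 5" by (auto simp: D_def C_def cmat_def sgn_mat_def)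
  have dD: "det D = -1" by (simp add: D_def det_sgn_mat)
  interpret cnjh: comm_ring_hom cnj by unfold_locales auto
  have dC: "det C = cnj (det (cmat vs))"
    unfolding C_def using det_transpose[of "map_mat cnj (cmat vs)" 5] cnjh.hom_det[of "cmat vs"] by simp
  have "gram hform vs = cmat vs * (D * C)"
  proof (rule eq_matI)
    fix i j assume "i < dim_row (cmat vs * (D * C))" "j < dim_col (cmat vs * (D * C))"
    hence ij: "i < 5" "j < 5" using C by (auto simp: cmat_def)
    have DC: "(D * C) $$ (k, j) = sgnw k * cnj ((vs ! j) k)" if k: "k < 5" for k
    proof -
      have "(D * C) $$ (k, j) = (\<Sum>l<5. D $$ (k, l) * C $$ (l, j))"
        using k ij D C by (simp add: scalar_prod_def lessThan_atLeast0)
      also have "\<dots> = (\<Sum>l<5. if l = k then sgnw k * cnj ((vs ! j) k) else 0)"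
        by (rule sum.cong) (use ij k in \<open>auto simp: D_def C_def cmat_def sgn_mat_def\<close>)
      finally show ?thesis using k by simp
    qed
    have "(cmat vs * (D * C)) $$ (i, j) = (\<Sum>k<5. cmat vs $$ (i, k) * (D * C) $$ (k, j))"
      using ij D C by (simp add: scalar_prod_def lessThan_atLeast0 cmat_def)
    also have "\<dots> = (\<Sum>k<5. sgnw k * (vs ! i) k * cnj ((vs ! j) k))"
      by (rule sum.cong) (use ij in \<open>auto simp: DC cmat_def\<close>)
    finally show "gram hform vs $$ (i, j) = (cmat vs * (D * C)) $$ (i, j)"
      using ij n by (simp add: gram_def hform_sgnw)
  qed (use n C in \<open>auto simp: gram_def cmat_def\<close>)
  hence "gdet hform vs = det (cmat vs) * (det D * det C)"
    unfolding gdet_def using D C by (simp add: det_mult[of _ 5])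
  thus ?thesis by (simp add: dD dC)
qed

lemma det_cmat_update:
  assumes n: "length vs = 5" and i: "i < 5"
  shows "det (cmat (vs[i := x])) = (\<Sum>j<5. x j * cofactor (cmat vs) i j)"
proof -
  have "det (cmat (vs[i := x])) = (\<Sum>j<5. cmat (vs[i := x]) $$ (i, j) * cofactor (cmat (vs[i := x])) i j)"
    by (rule laplace_expansion_row[OF cmat_carrier i])
  also have "\<dots> = (\<Sum>j<5. x j * cofactor (cmat vs) i j)"
  proof (rule sum.cong[OF refl])
    fix j :: nat assume "j \<in> {..<5}"
    have "mat_delete (cmat (vs[i := x])) i j = mat_delete (cmat vs) i j"
      using i n by (intro eq_matI) (auto simp: mat_delete_def cmat_def nth_list_update)
    thus "cmat (vs[i := x]) $$ (i, j) * cofactor (cmat (vs[i := x])) i j = x j * cofactor (cmat vs) i j"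
      using \<open>j \<in> {..<5}\<close> i n by (simp add: cofactor_def cmat_def)
  qed
  finally show ?thesis .
qed

lemma det_cmat_row_linear:
  assumes "length vs = 5" "i < 5"
  shows "det (cmat (vs[i := vadd x (smul a y)])) = det (cmat (vs[i := x])) + a * det (cmat (vs[i := y]))"
  unfolding det_cmat_update[OF assms]
  by (simp add: vadd_def smul_def algebra_simps sum.distrib sum_distrib_left)

text \<open>Cramer's rule through the adjugate. The coefficients are arbitrary complex numbers;
  integrality is a separate matter.\<close>

lemma span5:
  assumes n: "length vs = 5" and d: "det (cmat vs) \<noteq> 0"
    and s: "\<And>i k. i < 5 \<Longrightarrow> k \<ge> 5 \<Longrightarrow> (vs ! i) k = 0" "\<And>k. k \<ge> 5 \<Longrightarrow> x k = 0"
  shows "\<exists>c. x = comb c vs"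
proof -
  let ?A = "cmat vs"
  have adj: "adj_mat ?A * ?A = det ?A \<cdot>\<^sub>m 1\<^sub>m 5" "adj_mat ?A \<in> carrier_mat 5 5"
    using adj_mat[OF cmat_carrier] by auto
  define c where "c i = (\<Sum>k<5. x k * adj_mat ?A $$ (k, i)) / det ?A" for i
  have "comb c vs j = x j" for j
  proof (cases "j < 5")
    case False thus ?thesis using s n by (simp add: comb_def)
  next
    case j: True
    have e: "(\<Sum>i<5. adj_mat ?A $$ (k, i) * (vs ! i) j) = (if k = j then det ?A else 0)" if k: "k < 5" for k
    proof -
      have "(\<Sum>i<5. adj_mat ?A $$ (k, i) * (vs ! i) j) = (adj_mat ?A * ?A) $$ (k, j)"
        using adj(2) j k by (simp add: scalar_prod_def lessThan_atLeast0 cmat_def)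
      also have "\<dots> = (if k = j then det ?A else 0)" unfolding adj(1) using j k by simp
      finally show ?thesis .
    qed
    have cd: "c i * det ?A = (\<Sum>k<5. x k * adj_mat ?A $$ (k, i))" for i using d by (simp add: c_def)
    have "comb c vs j * det ?A = (\<Sum>i<5. (c i * det ?A) * (vs ! i) j)"
      unfolding comb_def n sum_distrib_right by (rule sum.cong) simp_all
    also have "\<dots> = (\<Sum>i<5. \<Sum>k<5. x k * (adj_mat ?A $$ (k, i) * (vs ! i) j))"
      unfolding cd by (simp add: sum_distrib_right mult.assoc)
    also have "\<dots> = (\<Sum>k<5. x k * (\<Sum>i<5. adj_mat ?A $$ (k, i) * (vs ! i) j))"
      by (subst sum.swap) (simp add: sum_distrib_left)
    also have "\<dots> = (\<Sum>k<5. if k = j then x k * det ?A else 0)"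
      by (rule sum.cong) (auto simp: e)
    also have "\<dots> = x j * det ?A" using j by simp
    finally show ?thesis using d by simp
  qed
  hence "comb c vs = x" by (rule ext)
  thus ?thesis by blast
qed

lemma indep5:
  assumes n: "length vs = 5" and d: "det (cmat vs) \<noteq> 0" and z: "\<And>j. j < 5 \<Longrightarrow> comb c vs j = 0" and k: "k < 5"
  shows "c k = 0"
proof -
  let ?A = "cmat vs"
  have adj: "?A * adj_mat ?A = det ?A \<cdot>\<^sub>m 1\<^sub>m 5" "adj_mat ?A \<in> carrier_mat 5 5"
    using adj_mat[OF cmat_carrier] by auto
  have e: "(\<Sum>j<5. (vs ! i) j * adj_mat ?A $$ (j, k)) = (if i = k then det ?A else 0)" if i: "i < 5" for i
  proof -
    have "(\<Sum>j<5. (vs ! i) j * adj_mat ?A $$ (j, k)) = (?A * adj_mat ?A) $$ (i, k)"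
      using adj(2) i k by (simp add: scalar_prod_def lessThan_atLeast0 cmat_def)
    also have "\<dots> = (if i = k then det ?A else 0)" unfolding adj(1) using i k by simp
    finally show ?thesis .
  qed
  have "0 = (\<Sum>j<5. comb c vs j * adj_mat ?A $$ (j, k))" using z by simp
  also have "\<dots> = (\<Sum>j<5. \<Sum>i<5. c i * ((vs ! i) j * adj_mat ?A $$ (j, k)))"
    using n by (simp add: comb_def sum_distrib_right mult.assoc)
  also have "\<dots> = (\<Sum>i<5. c i * (\<Sum>j<5. (vs ! i) j * adj_mat ?A $$ (j, k)))"
    by (subst sum.swap) (simp add: sum_distrib_left)
  also have "\<dots> = (\<Sum>i<5. if i = k then c i * det ?A else 0)"
    by (rule sum.cong) (auto simp: e)
  also have "\<dots> = c k * det ?A" using k by simp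
  finally show ?thesis using d by simp
qed

text \<open>The transition matrix differs from the identity in row \<open>i\<close> only, so its
  determinant is the diagonal entry \<open>d i\<close>. Exchanging a basis vector for one with a
  fractional coefficient therefore shrinks the determinant by that factor.\<close>

lemma det_cmat_comb:
  assumes n: "length vs = 5" and i: "i < 5"
  shows "det (cmat (vs[i := comb d vs])) = d i * det (cmat vs)"
proof -
  define T where "T = mat 5 5 (\<lambda>(k, l). if k = i then d l else if k = l then 1 else 0)"
  have T: "T \<in> carrier_mat 5 5" by (simp add: T_def)
  have "cmat (vs[i := comb d vs]) = T * cmat vs"
  proof (rule eq_matI)
    fix k j assume "k < dim_row (T * cmat vs)" "j < dim_col (T * cmat vs)"
    hence kj: "k < 5" "j < 5" by (auto simp: T_def cmat_def)
    have "(T * cmat vs) $$ (k, j) = (\<Sum>l<5. T $$ (k, l) * (vs ! l) j)"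
      using kj T by (simp add: scalar_prod_def lessThan_atLeast0 cmat_def)
    also have "\<dots> = (\<Sum>l<5. if k = i then d l * (vs ! l) j else if l = k then (vs ! k) j else 0)"
      by (rule sum.cong) (use kj in \<open>auto simp: T_def\<close>)
    also have "\<dots> = (if k = i then comb d vs j else (vs ! k) j)"
      using kj n by (cases "k = i") (simp_all add: comb_def)
    finally show "cmat (vs[i := comb d vs]) $$ (k, j) = (T * cmat vs) $$ (k, j)"
      using kj n i by (simp add: cmat_def nth_list_update)
  qed (auto simp: T_def cmat_def)
  moreover have "det T = d i"
  proof -
    have "det T = (\<Sum>k<5. T $$ (k, i) * cofactor T k i)"
      by (rule laplace_expansion_column[OF T i])
    also have "\<dots> = (\<Sum>k<5. if k = i then d i * cofactor T i i else 0)"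
      by (rule sum.cong) (use i in \<open>auto simp: T_def\<close>)
    also have "\<dots> = d i * cofactor T i i" using i by simp
    also have "mat_delete T i i = 1\<^sub>m 4"
      using i by (intro eq_matI) (auto simp: mat_delete_def T_def)
    hence "cofactor T i i = 1" by (simp add: cofactor_def)
    finally show ?thesis by simp
  qed
  ultimately show ?thesis using T by (simp add: det_mult[of _ 5])
qed

section \<open>Isotropic vectors fixed by an anti-involution\<close>

definition Lfix :: "(cvec \<Rightarrow> cvec) \<Rightarrow> cvec set" where
  "Lfix \<xi> = {x \<in> Lam. \<xi> x = x}"

lemma anti_involutionD:
  assumes "anti_involution \<xi>"
  shows "x \<in> Lam \<Longrightarrow> \<xi> x \<in> Lam" "x \<in> Lam \<Longrightarrow> y \<in> Lam \<Longrightarrow> \<xi> (vadd x y) = vadd (\<xi> x) (\<xi> y)"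
    "a \<in> Eis \<Longrightarrow> x \<in> Lam \<Longrightarrow> \<xi> (smul a x) = smul (cnj a) (\<xi> x)" "x \<in> Lam \<Longrightarrow> \<xi> (\<xi> x) = x"
    "x \<in> Lam \<Longrightarrow> y \<in> Lam \<Longrightarrow> hform (\<xi> x) (\<xi> y) = cnj (hform x y)"
  using assms unfolding anti_involution_def by (auto simp: bij_betw_def)

lemma cnj_Ints: "z \<in> \<int> \<Longrightarrow> cnj z = z"
  by (auto elim: Ints_cases)

lemma Lfix_Lam: "x \<in> Lfix \<xi> \<Longrightarrow> x \<in> Lam" "x \<in> Lfix \<xi> \<Longrightarrow> \<xi> x = x"
  by (auto simp: Lfix_def)

lemma Lfix_add:
  assumes \<xi>: "anti_involution \<xi>" and "x \<in> Lfix \<xi>" "y \<in> Lfix \<xi>" "a \<in> \<int>"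
  shows "vadd x (smul a y) \<in> Lfix \<xi>"
proof -
  have "cnj a = a" using assms(4) by (auto elim: Ints_cases)
  thus ?thesis
    using assms Ints_Eis by (auto simp: Lfix_def anti_involutionD[OF \<xi>] Lam_vadd Lam_smul)
qed

lemma smul_zero: "smul 0 x = (\<lambda>_. 0)" by (simp add: smul_def)

lemma zero_Lam: "(\<lambda>_. 0) \<in> Lam" by (simp add: Lam_def Eis_closed)

lemma Lfix_zero: "anti_involution \<xi> \<Longrightarrow> (\<lambda>_. 0) \<in> Lfix \<xi>"
  using anti_involutionD(3)[of \<xi> 0 "\<lambda>_. 0"] zero_Lam Eis_closed(1) by (auto simp: Lfix_def smul_zero)

lemma Lfix_smul: "anti_involution \<xi> \<Longrightarrow> x \<in> Lfix \<xi> \<Longrightarrow> a \<in> \<int> \<Longrightarrow> smul a x \<in> Lfix \<xi>"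
  using Lfix_add[OF _ Lfix_zero, of \<xi> x a] by (simp add: vadd_def)

lemma Lfix_comb:
  assumes "anti_involution \<xi>" "set vs \<subseteq> Lfix \<xi>" "\<And>i. i < length vs \<Longrightarrow> c i \<in> \<int>"
  shows "comb c vs \<in> Lfix \<xi>"
  using assms(2,3)
proof (induction vs arbitrary: c)
  case Nil thus ?case using Lfix_zero[OF assms(1)] by simp
next
  case (Cons v vs)
  have "comb (\<lambda>i. c (Suc i)) vs \<in> Lfix \<xi>" by (rule Cons.IH) (use Cons.prems in auto)
  moreover have "c 0 \<in> \<int>" using Cons.prems(2)[of 0] by simp
  ultimately have "vadd (comb (\<lambda>i. c (Suc i)) vs) (smul (c 0) v) \<in> Lfix \<xi>"
    using Cons.prems by (intro Lfix_add[OF assms(1)]) auto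
  moreover have "comb c (v # vs) = vadd (comb (\<lambda>i. c (Suc i)) vs) (smul (c 0) v)"
    by (auto simp: comb_Cons vadd_def)
  ultimately show ?case by simp
qed

lemma Lfix_hform_Ints:
  assumes \<xi>: "anti_involution \<xi>" and x: "x \<in> Lfix \<xi>" "y \<in> Lfix \<xi>"
  shows "hform x y \<in> \<int>"
proof -
  have "hform x y = cnj (hform x y)"
    using anti_involutionD(5)[OF \<xi> Lfix_Lam(1)[OF x(1)] Lfix_Lam(1)[OF x(2)]] Lfix_Lam(2)[OF x(1)] Lfix_Lam(2)[OF x(2)]
    by simp
  hence "hform x y \<in> \<real>" by (simp add: Reals_cnj_iff)
  thus ?thesis using hform_Eis[OF x[THEN Lfix_Lam(1)]] Eis_closed(8) by blast
qed

definition trace1 :: "(cvec \<Rightarrow> cvec) \<Rightarrow> cvec \<Rightarrow> cvec" where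
  "trace1 \<xi> x = vadd x (\<xi> x)"

definition trace2 :: "(cvec \<Rightarrow> cvec) \<Rightarrow> cvec \<Rightarrow> cvec" where
  "trace2 \<xi> x = vadd (smul omega x) (smul (cnj omega) (\<xi> x))"

lemma vadd_commute: "vadd x y = vadd y x" by (simp add: vadd_def add.commute)

lemma trace_Lfix:
  assumes \<xi>: "anti_involution \<xi>" and x: "x \<in> Lam"
  shows "trace1 \<xi> x \<in> Lfix \<xi>" "trace2 \<xi> x \<in> Lfix \<xi>"
  using x omega_Eis Eis_closed(7)[OF omega_Eis]
  by (auto simp: trace1_def trace2_def Lfix_def anti_involutionD[OF \<xi>] Lam_vadd Lam_smul vadd_commute)

text \<open>The two traces are those of \<open>x\<close> and of \<open>omega\<close> times
  \<open>x\<close>; eliminating \<open>\<xi> x\<close> between them leaves \<open>theta\<close>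
  times \<open>x\<close>. All control over the determinant of the fixed lattice comes from this
  identity.\<close>

lemma theta_trace: "smul theta x = vadd (trace2 \<xi> x) (smul (- cnj omega) (trace1 \<xi> x))"
  by (rule ext) (simp add: trace1_def trace2_def vadd_def smul_def theta_def algebra_simps)

lemma det_scalar_list: "det (cmat (map (\<lambda>i. smul a (ev i)) [0..<5])) = a ^ 5"
proof -
  have "cmat (map (\<lambda>i. smul a (ev i)) [0..<5]) = a \<cdot>\<^sub>m 1\<^sub>m 5"
    by (rule eq_matI) (auto simp: cmat_def smul_def ev_def)
  thus ?thesis by simp
qed

text \<open>An exchange argument starting from \<open>theta\<close> times the standard basis. The
  determinant is linear in each row, and each row is a combination of two traces, so one of the two
  can replace it with nonzero determinant.\<close>

lemma Lfix_frame_exists: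
  assumes \<xi>: "anti_involution \<xi>"
  shows "\<exists>vs. length vs = 5 \<and> set vs \<subseteq> Lfix \<xi> \<and> det (cmat vs) \<noteq> 0"
proof -
  have "\<exists>vs. length vs = 5 \<and> det (cmat vs) \<noteq> 0 \<and> (\<forall>i<5. if i < k then vs ! i \<in> Lfix \<xi> else vs ! i = smul theta (ev i))"
    if "k \<le> 5" for k
    using that
  proof (induction k)
    case 0
    show ?case
      by (intro exI[of _ "map (\<lambda>i. smul theta (ev i)) [0..<5]"]) (simp add: det_scalar_list theta_nz)
  next
    case (Suc k)
    then obtain vs where vs: "length vs = 5" "det (cmat vs) \<noteq> 0"
      "\<forall>i<5. if i < k then vs ! i \<in> Lfix \<xi> else vs ! i = smul theta (ev i)" by auto
    have k: "k < 5" using Suc.prems by simp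
    hence "vs ! k = smul theta (ev k)" using vs(3) by simp
    hence "vs = vs[k := vadd (trace2 \<xi> (ev k)) (smul (- cnj omega) (trace1 \<xi> (ev k)))]"
      unfolding theta_trace[of _ \<xi>, symmetric] by (metis list_update_id)
    hence "det (cmat vs) = det (cmat (vs[k := trace2 \<xi> (ev k)])) + - cnj omega * det (cmat (vs[k := trace1 \<xi> (ev k)]))"
      using det_cmat_row_linear[OF vs(1) k] by metis
    hence "det (cmat (vs[k := trace2 \<xi> (ev k)])) \<noteq> 0 \<or> det (cmat (vs[k := trace1 \<xi> (ev k)])) \<noteq> 0"
      using vs(2) by auto
    then obtain l where l: "l \<in> Lfix \<xi>" "det (cmat (vs[k := l])) \<noteq> 0"
      using trace_Lfix[OF \<xi> ev_Lam[OF k]] by blast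
    show ?case
    proof (intro exI[of _ "vs[k := l]"] conjI)
      show "\<forall>i<5. if i < Suc k then vs[k := l] ! i \<in> Lfix \<xi> else vs[k := l] ! i = smul theta (ev i)"
        using vs(1,3) l(1) by (auto simp: nth_list_update less_Suc_eq)
    qed (use vs l in auto)
  qed
  from this[of 5] show ?thesis by (fastforce simp: in_set_conv_nth)
qed

lemma det_cmat_Eis: "length vs = 5 \<Longrightarrow> set vs \<subseteq> Lam \<Longrightarrow> det (cmat vs) \<in> Eis"
  by (rule det_in[OF star_ring_Eis cmat_carrier]) (auto simp: cmat_def Lam_def subset_iff in_set_conv_nth)

text \<open>Among independent lists of fixed vectors one has a determinant of least absolute value.
  The coefficients of a fixed vector in it are real, because their imaginary parts give a vector
  orthogonal to everything; and they are integers, because a fractional part would produce a smaller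
  determinant.\<close>

lemma Lfix_basis:
  assumes \<xi>: "anti_involution \<xi>"
  shows "\<exists>vs. length vs = 5 \<and> set vs \<subseteq> Lfix \<xi> \<and> det (cmat vs) \<noteq> 0 \<and>
    (\<forall>x\<in>Lfix \<xi>. \<exists>c. (\<forall>i<5. c i \<in> \<int>) \<and> x = comb c vs)"
proof -
  define P where "P vs \<longleftrightarrow> length vs = 5 \<and> set vs \<subseteq> Lfix \<xi> \<and> det (cmat vs) \<noteq> 0" for vs
  define f where "f vs = nat \<lfloor>(cmod (det (cmat vs)))\<^sup>2\<rfloor>" for vs
  have f: "real (f vs) = (cmod (det (cmat vs)))\<^sup>2" if "P vs" for vs
  proof -
    have "det (cmat vs) \<in> Eis" using that by (intro det_cmat_Eis) (auto simp: P_def Lfix_def)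
    then obtain n :: nat where "(cmod (det (cmat vs)))\<^sup>2 = real n" by (rule Eis_norm_nat)
    thus ?thesis by (simp add: f_def)
  qed
  obtain ws where "P ws" using Lfix_frame_exists[OF \<xi>] by (auto simp: P_def)
  then obtain vs where vs: "P vs" "\<And>us. P us \<Longrightarrow> f vs \<le> f us"
    using ex_has_least_nat[of P ws f] by blast
  have n: "length vs = 5" and L: "set vs \<subseteq> Lfix \<xi>" and d: "det (cmat vs) \<noteq> 0" using vs(1) by (auto simp: P_def)
  have L': "vs ! i \<in> Lfix \<xi>" if "i < 5" for i using L n that by auto
  have supp: "(vs ! i) k = 0" if "i < 5" "k \<ge> 5" for i k using L'[OF that(1)] that(2) by (auto simp: Lfix_def Lam_def)
  have "\<exists>c. (\<forall>i<5. c i \<in> \<int>) \<and> x = comb c vs" if x: "x \<in> Lfix \<xi>" for x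
  proof -
    obtain c where c: "x = comb c vs" using span5[OF n d supp, of x] x by (auto simp: Lfix_def Lam_def)
    \<comment> \<open>The imaginary parts up to a constant. Values of \<open>hform\<close> between
      fixed vectors are integers, so conjugation shows that this combination is orthogonal to every
      member of the list.\<close>
    define e where "e i = c i - cnj (c i)" for i
    have "hform (comb e vs) (vs ! j) = 0" if j: "j < 5" for j
    proof -
      have "hform x (vs ! j) = (\<Sum>i<5. c i * hform (vs ! i) (vs ! j))"
        unfolding c form_comb[OF hermitian_hform] n ..
      moreover have "cnj (hform x (vs ! j)) = (\<Sum>i<5. cnj (c i) * hform (vs ! i) (vs ! j))"
        unfolding c form_comb[OF hermitian_hform] n cnj_sum complex_cnj_mult
        using Lfix_hform_Ints[OF \<xi> L' L'[OF j]] cnj_Ints by (intro sum.cong) auto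
      moreover have "cnj (hform x (vs ! j)) = hform x (vs ! j)"
        using Lfix_hform_Ints[OF \<xi> x L'[OF j]] by (auto elim: Ints_cases)
      ultimately show ?thesis
        unfolding form_comb[OF hermitian_hform] n e_def by (simp add: algebra_simps sum_subtractf)
    qed
    hence orth: "hform (vs ! j) (comb e vs) = 0" if "j < 5" for j using that hf(5)[of "comb e vs" "vs ! j"] by simp
    have "\<forall>i<5. comb e vs i = 0"
    proof (rule hform_nondegenerate)
      fix i :: nat assume i: "i < 5"
      obtain d where d: "ev i = comb d vs"
        using span5[OF n d supp, of "ev i"] i by (auto simp: ev_def)
      have "hform (ev i) (comb e vs) = 0"
        unfolding d form_comb[OF hermitian_hform, of d] n using orth by simp
      thus "hform (comb e vs) (ev i) = 0" using hf(5)[of "ev i" "comb e vs"] by simp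
    qed
    hence "e i = 0" if "i < 5" for i using indep5[OF n d _ that, of e] by blast
    hence cr: "Im (c i) = 0" if "i < 5" for i using that by (auto simp: e_def complex_eq_iff)
    have "c i \<in> \<int>" if i: "i < 5" for i
    proof (rule ccontr)
      assume ci: "c i \<notin> \<int>"
      \<comment> \<open>Only the fractional part of \<open>c i\<close> survives in \<open>y\<close>,
        and it is the factor by which the determinant shrinks.\<close>
      define m where "m = \<lfloor>Re (c i)\<rfloor>"
      define r where "r = Re (c i) - of_int m"
      have cm: "c i - of_int m = of_real r" using cr[OF i] by (simp add: r_def complex_eq_iff)
      have r0: "r \<noteq> 0" using cm ci by auto
      have r: "0 \<le> r" "r < 1" unfolding r_def m_def by linarith+
      define y where "y = vadd x (smul (of_int (- m)) (vs ! i))"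
      have yL: "y \<in> Lfix \<xi>" unfolding y_def by (rule Lfix_add[OF \<xi> x L'[OF i]]) simp
      have "y = comb (c(i := c i - of_int m)) vs"
      proof
        fix k
        have "comb (c(i := c i - of_int m)) vs k
            = (\<Sum>l<5. c l * (vs ! l) k + (if l = i then - of_int m * (vs ! i) k else 0))"
          unfolding comb_def n by (rule sum.cong) (auto simp: algebra_simps)
        also have "\<dots> = y k" using i n by (simp add: sum.distrib y_def c comb_def vadd_def smul_def)
        finally show "y k = comb (c(i := c i - of_int m)) vs k" ..
      qed
      hence dy: "det (cmat (vs[i := y])) = of_real r * det (cmat vs)"
        using det_cmat_comb[OF n i, of "c(i := c i - of_int m)"] cm by simp
      have P: "P (vs[i := y])"
        unfolding P_def using n d dy r0 yL set_update_subset_insert[of vs i y] L by auto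
      have "r\<^sup>2 < 1" using r by (simp add: power_less_one_iff)
      hence "(cmod (det (cmat (vs[i := y]))))\<^sup>2 < (cmod (det (cmat vs)))\<^sup>2"
        using d by (simp add: dy norm_mult power_mult_distrib)
      thus False using vs(2)[OF P] f[OF P] f[OF vs(1)] by linarith
    qed
    thus ?thesis using c by blast
  qed
  thus ?thesis using vs(1) unfolding P_def by blast
qed

text \<open>Writing \<open>theta\<close> times the standard basis in an integral basis of the fixed
  lattice gives an Eisenstein matrix \<open>C\<close> with
  \<open>det C * det (cmat vs) = theta ^ 5\<close>. Taking norms, the norm of
  \<open>det (cmat vs)\<close> divides \<open>3 ^ 5\<close>, which makes the Gram determinant minus
  a power of 3.\<close>

lemma Lfix_isotropic:
  assumes \<xi>: "anti_involution \<xi>"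
  shows "\<exists>\<rho>\<in>Lfix \<xi>. \<rho> \<noteq> (\<lambda>_. 0) \<and> hform \<rho> \<rho> = 0"
proof (rule ccontr)
  assume no: "\<not> ?thesis"
  obtain vs where n: "length vs = 5" and L: "set vs \<subseteq> Lfix \<xi>" and d: "det (cmat vs) \<noteq> 0"
    and span: "\<And>x. x \<in> Lfix \<xi> \<Longrightarrow> \<exists>c. (\<forall>i<5. c i \<in> \<int>) \<and> x = comb c vs"
    using Lfix_basis[OF \<xi>] by blast
  have a: "aniso \<int> hform vs" unfolding good_def
  proof (intro allI impI)
    fix c assume c: "nontriv \<int> (length vs) c"
    have "comb c vs \<in> Lfix \<xi>" using c by (intro Lfix_comb[OF \<xi> L]) (auto simp: nontriv_def)
    moreover have "comb c vs \<noteq> (\<lambda>_. 0)"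
      using indep5[OF n d, of c] c n unfolding nontriv_def by metis
    ultimately show "hform (comb c vs) (comb c vs) \<noteq> 0" using no by blast
  qed
  have e: "entries_in \<int> hform vs" using L Lfix_hform_Ints[OF \<xi>] by (auto simp: entries_in_def)
  have "\<exists>c. (\<forall>j<5. c j \<in> Eis) \<and> smul theta (ev i) = comb c vs" if i: "i < 5" for i
  proof -
    obtain c1 where c1: "\<forall>j<5. c1 j \<in> \<int>" "trace1 \<xi> (ev i) = comb c1 vs"
      using span[OF trace_Lfix(1)[OF \<xi> ev_Lam[OF i]]] by blast
    obtain c2 where c2: "\<forall>j<5. c2 j \<in> \<int>" "trace2 \<xi> (ev i) = comb c2 vs"
      using span[OF trace_Lfix(2)[OF \<xi> ev_Lam[OF i]]] by blast
    have "smul theta (ev i) = comb (\<lambda>j. c2 j + - cnj omega * c1 j) vs"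
      unfolding theta_trace[of _ \<xi>] c1(2) c2(2)
      by (rule ext) (simp add: comb_def vadd_def smul_def sum.distrib sum_subtractf sum_negf sum_distrib_left algebra_simps)
    moreover have "\<forall>j<5. c2 j + - cnj omega * c1 j \<in> Eis"
    proof (intro allI impI)
      fix j :: nat assume "j < 5"
      hence "c1 j \<in> Eis" "c2 j \<in> Eis" using c1(1) c2(1) Ints_Eis by auto
      moreover have "- cnj omega \<in> Eis" by (intro Eis_closed(5,7) omega_Eis)
      ultimately show "c2 j + - cnj omega * c1 j \<in> Eis" by (intro Eis_closed(3,4))
    qed
    ultimately show ?thesis by (intro exI[of _ "\<lambda>j. c2 j + - cnj omega * c1 j"] conjI)
  qed
  hence "\<forall>i\<in>{..<5}. \<exists>c. (\<forall>j<5. c j \<in> Eis) \<and> smul theta (ev i) = comb c vs" by simp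
  from bchoice[OF this] obtain c where "\<forall>i\<in>{..<5}. (\<forall>j<5. c i j \<in> Eis) \<and> smul theta (ev i) = comb (c i) vs" ..
  hence c: "\<And>i j. i < 5 \<Longrightarrow> j < 5 \<Longrightarrow> c i j \<in> Eis" "\<And>i. i < 5 \<Longrightarrow> smul theta (ev i) = comb (c i) vs"
    by simp_all
  define C where "C = mat 5 5 (\<lambda>(i, j). c i j)"
  have C: "C \<in> carrier_mat 5 5" by (simp add: C_def)
  have "C * cmat vs = cmat (map (\<lambda>i. smul theta (ev i)) [0..<5])"
  proof (rule eq_matI)
    fix i j assume "i < dim_row (cmat (map (\<lambda>i. smul theta (ev i)) [0..<5]))" "j < dim_col (cmat (map (\<lambda>i. smul theta (ev i)) [0..<5]))"
    hence ij: "i < 5" "j < 5" by (auto simp: cmat_def)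
    have "(C * cmat vs) $$ (i, j) = (\<Sum>l<5. c i l * (vs ! l) j)"
      using ij C by (simp add: scalar_prod_def lessThan_atLeast0 cmat_def C_def)
    also have "\<dots> = smul theta (ev i) j" using c(2)[OF ij(1)] n by (simp add: comb_def)
    finally show "(C * cmat vs) $$ (i, j) = cmat (map (\<lambda>i. smul theta (ev i)) [0..<5]) $$ (i, j)"
      using ij by (simp add: cmat_def)
  qed (auto simp: cmat_def C_def)
  hence "det C * det (cmat vs) = theta ^ 5"
    using det_mult[OF C cmat_carrier, of vs] by (simp add: det_scalar_list)
  hence "(cmod (det C))\<^sup>2 * (cmod (det (cmat vs)))\<^sup>2 = ((cmod theta)\<^sup>2) ^ 5"
    by (metis norm_mult norm_power power_mult_distrib power_mult mult.commute)
  moreover obtain p :: nat where p: "(cmod (det C))\<^sup>2 = real p"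
    using Eis_norm_nat[OF det_in[OF star_ring_Eis C]] c(1) by (metis (no_types, lifting) C_def index_mat(1) prod.simps(2))
  moreover obtain q :: nat where q: "(cmod (det (cmat vs)))\<^sup>2 = real q" "det (cmat vs) * cnj (det (cmat vs)) = of_nat q"
    using Eis_norm_nat[OF det_cmat_Eis[OF n]] L by (metis Lfix_Lam(1) subset_iff)
  ultimately have "real (p * q) = real (3 ^ 5)" by (simp add: cmod_theta)
  hence "p * q = 3 ^ 5" by (simp only: of_nat_eq_iff)
  hence "q dvd 3 ^ 5" by (metis dvd_triv_right)
  then obtain k where "q = 3 ^ k" using divides_primepow_nat[of 3 q 5] by auto
  hence "gdet hform vs = - (3 ^ k)" using gdet_hform[OF n] q(2) by simp
  from lorentzian_isotropic[OF hermitian_hform lorentzian_hform a e this n] show False .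
qed

section \<open>Euclidean reduction over the Eisenstein integers\<close>

lemma cmod_omega_comb: "(cmod (of_real x + of_real y * omega))\<^sup>2 = x * x - x * y + y * y"
proof -
  have ri: "Re (of_real x + of_real y * omega) = x - y / 2" "Im (of_real x + of_real y * omega) = y * sqrt 3 / 2"
    by (simp_all add: omega_Complex)
  hence "(cmod (of_real x + of_real y * omega))\<^sup>2 = (x - y / 2)\<^sup>2 + (y * sqrt 3 / 2)\<^sup>2"
    by (simp only: cmod_power2 ri)
  also have "(y * sqrt 3 / 2)\<^sup>2 = 3 * (y * y) / 4" by (simp add: power2_eq_square)
  finally show ?thesis by (simp add: power2_eq_square field_simps)
qed

text \<open>The bound \<open>4/9\<close> is weaker than the exact value \<open>1/3\<close> for the
  hexagonal lattice, but as the square of \<open>2/3\<close> it needs only linear comparisons: the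
  first norm is at most the square of \<open>s + t\<close>, and if \<open>s + t\<close> exceeds
  \<open>2/3\<close> then \<open>1 - s\<close> is below \<open>2/3\<close> and its square bounds the
  second norm.\<close>

lemma Eis_covering_aux:
  fixes s t :: real
  assumes "0 \<le> s" "0 \<le> t" "s \<le> 1/2" "t \<le> 1/2" "t \<le> s"
  shows "s * s + s * t + t * t \<le> 4/9 \<or> (1 - s) * (1 - s) - (1 - s) * t + t * t \<le> 4/9"
proof (cases "s + t \<le> 2/3")
  case True
  have "s * s + s * t + t * t \<le> (s + t) * (s + t)" using assms by (simp add: algebra_simps)
  also have "\<dots> \<le> (2/3) * (2/3)" using True assms by - (rule mult_mono, linarith+)
  finally show ?thesis by simp
next
  case False
  define r where "r = 1 - s"
  have r: "0 \<le> r" "r \<le> 2/3" "t \<le> r" using False assms by (simp_all add: r_def)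
  have "r * r - r * t + t * t \<le> r * r" using mult_right_mono[OF r(3) assms(2)] by simp
  also have "\<dots> \<le> (2/3) * (2/3)" using r by - (rule mult_mono, linarith+)
  finally show ?thesis by (simp add: r_def)
qed

text \<open>Rounding both coordinates leaves \<open>x\<close> and \<open>y\<close> of absolute value
  at most \<open>1/2\<close>. For equal signs the norm is at most the larger of the two squares. For
  opposite signs one of two neighbouring lattice points is near enough; which two depends on the
  signs and on the larger coordinate, hence the four cases.\<close>

lemma Eis_covering: "\<exists>m\<in>Eis. (cmod (z + m))\<^sup>2 \<le> 4/9"
proof -
  define q where "q = 2 * Im z / sqrt 3"
  define p where "p = Re z + q / 2"
  have z: "z = of_real p + of_real q * omega"
    by (simp add: p_def q_def omega_Complex complex_eq_iff)
  define x where "x = p - round p"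
  define y where "y = q - round q"
  have xy: "\<bar>x\<bar> \<le> 1/2" "\<bar>y\<bar> \<le> 1/2"
    using of_int_round_abs_le[of p] of_int_round_abs_le[of q] by (simp_all add: x_def y_def abs_minus_commute)
  have key: ?thesis if "(x + of_int k) * (x + of_int k) - (x + of_int k) * (y + of_int l) + (y + of_int l) * (y + of_int l) \<le> 4/9" for k l :: int
  proof -
    have "z + (of_int (k - round p) + of_int (l - round q) * omega) = of_real (x + of_int k) + of_real (y + of_int l) * omega"
      by (simp add: z x_def y_def algebra_simps)
    hence "(cmod (z + (of_int (k - round p) + of_int (l - round q) * omega)))\<^sup>2 \<le> 4/9"
      using that cmod_omega_comb by metis
    thus ?thesis using EisI by blast
  qed
  consider "0 \<le> x * y" | "0 \<le> x" "y \<le> 0" "- y \<le> x" | "0 \<le> x" "y \<le> 0" "x \<le> - y"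
    | "x \<le> 0" "0 \<le> y" "y \<le> - x" | "x \<le> 0" "0 \<le> y" "- x \<le> y"
    by (metis linear mult_nonneg_nonneg mult_nonpos_nonpos)
  thus ?thesis
  proof cases
    case 1
    have "x * x \<le> (1/2) * (1/2)" "y * y \<le> (1/2) * (1/2)"
      using mult_mono[OF xy(1) xy(1)] mult_mono[OF xy(2) xy(2)] by simp_all
    moreover have "x * x - x * y + y * y \<le> max (x * x) (y * y)"
    proof -
      have "min (x * x) (y * y) \<le> x * y"
      proof (cases "\<bar>x\<bar> \<le> \<bar>y\<bar>")
        case True
        have "x * x \<le> \<bar>x\<bar> * \<bar>y\<bar>" using mult_left_mono[OF True, of "\<bar>x\<bar>"] by simp
        thus ?thesis using 1 by (simp add: abs_mult[symmetric])
      next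
        case False
        hence "y * y \<le> \<bar>x\<bar> * \<bar>y\<bar>" using mult_right_mono[of "\<bar>y\<bar>" "\<bar>x\<bar>" "\<bar>y\<bar>"] by simp
        thus ?thesis using 1 by (simp add: abs_mult[symmetric])
      qed
      thus ?thesis by (simp add: max_def min_def split: if_splits)
    qed
    ultimately show ?thesis using key[of 0 0] by simp
  next
    case 2
    have "x * x + x * (- y) + (- y) * (- y) \<le> 4/9 \<or> (1 - x) * (1 - x) - (1 - x) * (- y) + (- y) * (- y) \<le> 4/9"
      using 2 xy by (intro Eis_covering_aux) auto
    thus ?thesis
    proof (elim disjE, goal_cases)
      case 1 thus ?case by (intro key[of 0 0]) (simp add: algebra_simps)
    next
      case 2 thus ?case by (intro key[of "-1" "0"]) (simp add: algebra_simps)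
    qed
  next
    case 3
    have "(- y) * (- y) + (- y) * x + x * x \<le> 4/9 \<or> (1 - (- y)) * (1 - (- y)) - (1 - (- y)) * x + x * x \<le> 4/9"
      using 3 xy by (intro Eis_covering_aux) auto
    thus ?thesis
    proof (elim disjE, goal_cases)
      case 1 thus ?case by (intro key[of 0 0]) (simp add: algebra_simps)
    next
      case 2 thus ?case by (intro key[of "0" "1"]) (simp add: algebra_simps)
    qed
  next
    case 4
    have "(- x) * (- x) + (- x) * y + y * y \<le> 4/9 \<or> (1 - (- x)) * (1 - (- x)) - (1 - (- x)) * y + y * y \<le> 4/9"
      using 4 xy by (intro Eis_covering_aux) auto
    thus ?thesis
    proof (elim disjE, goal_cases)
      case 1 thus ?case by (intro key[of 0 0]) (simp add: algebra_simps)
    next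
      case 2 thus ?case by (intro key[of "1" "0"]) (simp add: algebra_simps)
    qed
  next
    case 5
    have "y * y + y * (- x) + (- x) * (- x) \<le> 4/9 \<or> (1 - y) * (1 - y) - (1 - y) * (- x) + (- x) * (- x) \<le> 4/9"
      using 5 xy by (intro Eis_covering_aux) auto
    thus ?thesis
    proof (elim disjE, goal_cases)
      case 1 thus ?case by (intro key[of 0 0]) (simp add: algebra_simps)
    next
      case 2 thus ?case by (intro key[of "0" "-1"]) (simp add: algebra_simps)
    qed
  qed
qed

text \<open>The Euclidean algorithm on the coefficient vector, phrased as minimising the sum of
  squared absolute values. If two coefficients were nonzero, dividing the larger by the smaller with
  remainder would lower the sum, as \<open>4/9 < 1\<close>; so at most one is left, and moves bring
  its vector to the front.\<close>

lemma equ_primitive: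
  assumes "x = comb c vs" "\<forall>i<length vs. c i \<in> Eis" "vs \<noteq> []"
  shows "\<exists>ws d. equ Eis vs ws \<and> d \<in> Eis \<and> x = smul d (hd ws)"
proof -
  let ?n = "length vs"
  define P where "P p \<longleftrightarrow> equ Eis vs (fst p) \<and> (\<forall>i<?n. snd p i \<in> Eis) \<and> x = comb (snd p) (fst p)" for p :: "cvec list \<times> (nat \<Rightarrow> complex)"
  define f where "f p = nat \<lfloor>\<Sum>i<?n. (cmod (snd p i))\<^sup>2\<rfloor>" for p :: "cvec list \<times> (nat \<Rightarrow> complex)"
  have f: "real (f p) = (\<Sum>i<?n. (cmod (snd p i))\<^sup>2)" if "P p" for p
  proof -
    have "(cmod (snd p i))\<^sup>2 \<in> \<int>" if "i < ?n" for i
      using \<open>P p\<close> that Eis_norm_nat[of "snd p i"] unfolding P_def by (metis Ints_of_nat)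
    hence "(\<Sum>i<?n. (cmod (snd p i))\<^sup>2) \<in> \<int>" by (intro Ints_sum) auto
    then obtain k :: int where k: "(\<Sum>i<?n. (cmod (snd p i))\<^sup>2) = of_int k" by (auto elim: Ints_cases)
    moreover have "0 \<le> (\<Sum>i<?n. (cmod (snd p i))\<^sup>2)" by (intro sum_nonneg) auto
    ultimately show ?thesis by (simp add: f_def)
  qed
  have "P (vs, c)" using assms equ_refl by (auto simp: P_def)
  then obtain p where p: "P p" "\<And>q. P q \<Longrightarrow> f p \<le> f q" using ex_has_least_nat[of P "(vs, c)" f] by blast
  obtain ws e where we: "p = (ws, e)" by (cases p)
  have ws: "equ Eis vs ws" "\<And>i. i < ?n \<Longrightarrow> e i \<in> Eis" "x = comb e ws" and len: "length ws = ?n"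
    using p(1) we equ_length[of Eis vs ws] by (auto simp: P_def)
  have one: "e j = 0" if ij: "i < ?n" "j < ?n" "i \<noteq> j" "cmod (e j) \<le> cmod (e i)" for i j
  proof (rule ccontr)
    assume ej: "e j \<noteq> 0"
    obtain m where m: "m \<in> Eis" "(cmod (e i / e j + m))\<^sup>2 \<le> 4/9" using Eis_covering by blast
    define e' where "e' = e(i := e i + m * e j)"
    define us where "us = mv j i (- m) ws"
    have "e'(i := e' i + e' j * - m) = e" using ij by (auto simp: e'_def)
    hence "comb e' us = x"
      unfolding us_def using comb_mv[of j ws i e' "- m"] ij len ws(3) by simp
    moreover have "equ Eis vs us" unfolding us_def
      using ws(1) ij len Eis_closed(5)[OF m(1)] by (intro equ_step) auto
    moreover have "e' k \<in> Eis" if "k < ?n" for k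
      using that ws(2) ij m(1) by (auto simp: e'_def intro!: Eis_closed(3,4))
    ultimately have P: "P (us, e')" by (simp add: P_def)
    have "e i + m * e j = (e i / e j + m) * e j" using ej by (simp add: field_simps)
    hence "(cmod (e i + m * e j))\<^sup>2 = (cmod (e i / e j + m))\<^sup>2 * (cmod (e j))\<^sup>2"
      by (metis norm_mult power_mult_distrib)
    also have "\<dots> \<le> 4/9 * (cmod (e j))\<^sup>2" by (intro mult_right_mono m(2)) simp
    also have "\<dots> < (cmod (e j))\<^sup>2" using ej by simp
    also have "\<dots> \<le> (cmod (e i))\<^sup>2" using ij(4) by (intro power_mono) auto
    finally have lt: "(cmod (e' i))\<^sup>2 < (cmod (e i))\<^sup>2" by (simp add: e'_def)
    have "(\<Sum>k<?n. (cmod (e' k))\<^sup>2) < (\<Sum>k<?n. (cmod (e k))\<^sup>2)"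
    proof (rule sum_strict_mono_ex1)
      show "\<forall>k\<in>{..<?n}. (cmod (e' k))\<^sup>2 \<le> (cmod (e k))\<^sup>2"
      proof
        fix k show "(cmod (e' k))\<^sup>2 \<le> (cmod (e k))\<^sup>2"
          using less_imp_le[OF lt] by (cases "k = i") (simp_all only:, simp add: e'_def)
      qed
    qed (use lt ij(1) in auto)
    hence "f (us, e') < f p" using f[OF P] f[OF p(1)] we by simp
    thus False using p(2)[OF P] by simp
  qed
  obtain i where i: "i < ?n" "\<And>j. j < ?n \<Longrightarrow> j \<noteq> i \<Longrightarrow> e j = 0"
  proof (cases "\<exists>i<?n. e i \<noteq> 0")
    case True
    then obtain i where i: "i < ?n" "e i \<noteq> 0" by blast
    have "e j = 0" if "j < ?n" "j \<noteq> i" for j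
      using one[of i j] one[of j i] i that by (metis linear)
    thus ?thesis using that i by blast
  next
    case False thus ?thesis using that[of 0] assms(3) by auto
  qed
  have "x = smul (e i) (ws ! i)"
  proof
    fix k
    have "x k = (\<Sum>l<?n. if l = i then e i * (ws ! i) k else 0)"
      unfolding ws(3) comb_def len by (rule sum.cong) (use i(2) in auto)
    thus "x k = smul (e i) (ws ! i) k" using i(1) by (simp add: smul_def)
  qed
  moreover obtain us where "equ Eis ws (ws ! i # us)"
    using equ_front[OF star_ring_Eis, of i ws] i(1) len by auto
  hence "equ Eis vs (ws ! i # us)" by (rule equ_trans[OF ws(1)])
  ultimately show ?thesis using ws(2)[OF i(1)] by (metis list.sel(1))
qed

text \<open>One round of Gram-Schmidt against the head, carried out by transvections;
  \<open>us\<close> collects the vectors already treated.\<close>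

lemma equ_adjust_tail:
  assumes "\<And>w. w \<in> set ws \<Longrightarrow> g w \<in> R"
  shows "equ R (v # us @ ws) (v # us @ map (\<lambda>w. vadd w (smul (g w) v)) ws)"
  using assms
proof (induction ws arbitrary: us)
  case Nil thus ?case by (simp add: equ_refl)
next
  case (Cons w ws)
  have "equ R (v # us @ w # ws) (mv (Suc (length us)) 0 (g w) (v # us @ w # ws))"
    by (rule equ_one) (use Cons.prems in auto)
  also have "mv (Suc (length us)) 0 (g w) (v # us @ w # ws) = v # (us @ [vadd w (smul (g w) v)]) @ ws"
    by (simp add: mv_def)
  finally have "equ R (v # us @ w # ws) (v # (us @ [vadd w (smul (g w) v)]) @ ws)" .
  from equ_trans[OF this Cons.IH] Cons.prems show ?case by simp
qed

lemma gdet_cong: "(\<And>x y. x \<in> set vs \<Longrightarrow> y \<in> set vs \<Longrightarrow> b x y = c x y) \<Longrightarrow> gdet b vs = gdet c vs"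
proof -
  assume "\<And>x y. x \<in> set vs \<Longrightarrow> y \<in> set vs \<Longrightarrow> b x y = c x y"
  hence "gram b vs = gram c vs" by (intro eq_matI) (auto simp: gram_def)
  thus ?thesis by (simp add: gdet_def)
qed

lemma comb_base: "x \<in> Lam \<Longrightarrow> x = comb x (map ev [0..<5])"
proof
  fix k assume "x \<in> Lam"
  have "comb x (map ev [0..<5]) k = (\<Sum>i<5. if i = k then x k else 0)"
    unfolding comb_def by (rule sum.cong) (auto simp: ev_def)
  thus "x k = comb x (map ev [0..<5]) k" using \<open>x \<in> Lam\<close> by (cases "k < 5") (auto simp: Lam_def)
qed

lemma good_base: "good Eis (\<lambda>x. x \<noteq> (\<lambda>_. 0)) (map ev [0..<5])"
  unfolding good_def
proof (intro allI impI notI)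
  fix c assume c: "nontriv Eis (length (map ev [0..<5])) c" and z: "comb c (map ev [0..<5]) = (\<lambda>_. 0)"
  have e: "comb c (map ev [0..<5]) k = (\<Sum>i<5. if i = k then c k else 0)" for k
    unfolding comb_def by (rule sum.cong) (auto simp: ev_def)
  have "c k = 0" if "k < 5" for k using e[of k] that unfolding z by simp
  thus False using c by (auto simp: nontriv_def)
qed

lemma gdet_base: "gdet hform (map ev [0..<5]) = -1"
  using gdet_hform[of "map ev [0..<5]"] det_scalar_list[of 1] by simp

section \<open>Orthonormal bases of definite complements\<close>

text \<open>The covering bound leaves the factor \<open>1 - 4/9 = 5/9\<close> between consecutive
  pivots.\<close>

lemma reduced_step_Eis:
  assumes h: "hermitian b" and r: "reduced Eis b (v # w # ws)" and v: "Re (b v v) > 0" and c: "Re (schur b v w w) \<ge> 0"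
  shows "Re (schur b v w w) \<ge> 5/9 * Re (b v v)"
proof -
  have v0: "b v v \<noteq> 0" using v by auto
  have bv: "b v v = of_real (Re (b v v))" using hermitianD(7)[OF h] by (simp add: complex_eq_iff)
  have bc: "schur b v w w = of_real (Re (schur b v w w))"
    using hermitianD(7)[OF hermitian_schur[OF h]] by (simp add: complex_eq_iff)
  define a where "a = Re (b v v)"
  define d where "d = Re (schur b v w w)"
  obtain m where m: "m \<in> Eis" "(cmod (b w v / b v v + m))\<^sup>2 \<le> 4/9" using Eis_covering by blast
  define t where "t = (cmod (b w v / b v v + m))\<^sup>2"
  have "b (vadd w (smul m v)) (vadd w (smul m v)) = of_real (d + a * t)"
    unfolding schur_translate[OF h v0] t_def[symmetric] d_def a_def using bv bc by simp
  moreover have "cmod (b v v) \<le> cmod (b (vadd w (smul m v)) (vadd w (smul m v)))" using r m(1) by simp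
  moreover have "cmod (b v v) = a" using bv v unfolding a_def by (metis abs_of_pos norm_of_real)
  ultimately have "a \<le> \<bar>d + a * t\<bar>" by (simp only: norm_of_real)
  moreover have "0 \<le> a * t" using v by (simp add: a_def t_def)
  moreover have "a * t \<le> a * (4/9)" using v m(2) by (intro mult_left_mono) (auto simp: a_def t_def)
  ultimately show ?thesis using c by (simp add: a_def d_def)
qed

lemma Eis_pivot_int:
  assumes "hermitian b" "b v v \<in> Eis"
  obtains a :: int where "b v v = of_int a" "Re (b v v) = of_int a"
  using Eis_closed(8)[OF assms(2) hermitianD(6)[OF assms(1)]] that by (auto elim!: Ints_cases)

text \<open>A first pivot of at least 2 would make the product at least
  \<open>2 * (10/9) * (50/81)\<close>, which exceeds 1. Once it is 1, the second pivot is an integer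
  as well and the same comparison applies; the product then fixes the last one.\<close>

lemma unimodular_rank3_pivots:
  assumes h: "hermitian b" and n: "nonneg b" and a: "aniso Eis b [x, y, z]" and e: "entries_in Eis b [x, y, z]"
    and d: "gdet b [x, y, z] = 1" and r: "reduced Eis b [x, y, z]"
  shows "b x x = 1" "schur b x y y = 1" "schur (schur b x) y z z = 1"
proof -
  let ?s = "schur b x" let ?u = "schur ?s y"
  have sc: "scaled_in Eis b [x, y, z]" unfolding scaled_in_def using e by (intro exI[of _ "1::nat"]) simp
  note hs = hermitian_schur[OF h, of x]
  have pos: "Re (b x x) > 0" "Re (?s y y) > 0" "Re (?u z z) > 0"
    using nonneg_pivots[OF h n a sc star_ring_Eis] by auto
  have "of_real (prod_list (pivots b [x, y, z])) = (of_real 1 :: complex)"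
    using gdet_pivots[OF h a sc star_ring_Eis] d by simp
  hence pr: "Re (b x x) * Re (?s y y) * Re (?u z z) = 1" unfolding of_real_eq_iff by (simp add: mult.assoc)
  have s1: "Re (?s y y) \<ge> 5/9 * Re (b x x)" by (rule reduced_step_Eis[OF h r pos(1)]) (use pos in simp)
  have s2: "Re (?u z z) \<ge> 5/9 * Re (?s y y)"
    by (rule reduced_step_Eis[OF hs _ pos(2), of z "[]"]) (use pos r in auto)
  have "b x x \<in> Eis" using e by (simp add: entries_in_def)
  then obtain k :: int where k: "b x x = of_int k" "Re (b x x) = of_int k" by (rule Eis_pivot_int[OF h])
  have "k = 1"
  proof (rule ccontr)
    assume "k \<noteq> 1"
    hence 1: "2 \<le> Re (b x x)" using pos(1) k by simp
    hence 2: "10/9 \<le> Re (?s y y)" and 3: "50/81 \<le> Re (?u z z)" using s1 s2 by linarith+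
    have "2 * (10/9) * (50/81) \<le> Re (b x x) * Re (?s y y) * Re (?u z z)"
      using 1 2 3 by (intro mult_mono mult_nonneg_nonneg) auto
    thus False using pr by simp
  qed
  thus x1: "b x x = 1" using k by simp
  have "?s y y \<in> Eis" unfolding schur_def x1 using e by (auto simp: entries_in_def intro!: Eis_closed(4,6))
  then obtain l :: int where l: "?s y y = of_int l" "Re (?s y y) = of_int l" by (rule Eis_pivot_int[OF hs])
  have pr2: "Re (?s y y) * Re (?u z z) = 1" using pr x1 by simp
  have "l = 1"
  proof (rule ccontr)
    assume "l \<noteq> 1"
    hence 2: "2 \<le> Re (?s y y)" using pos(2) l by simp
    hence 3: "10/9 \<le> Re (?u z z)" using s2 by linarith
    have "2 * (10/9) \<le> Re (?s y y) * Re (?u z z)" using 2 3 by (intro mult_mono mult_nonneg_nonneg) auto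
    thus False using pr2 by simp
  qed
  thus y1: "?s y y = 1" using l by simp
  have "Re (?u z z) = 1" using pr2 y1 by simp
  thus "?u z z = 1" using hermitianD(7)[OF hermitian_schur[OF hs], of y z] by (simp add: complex_eq_iff)
qed

lemma form_comb_orth: "hermitian b \<Longrightarrow> (\<And>w. w \<in> set ws \<Longrightarrow> b w v = 0) \<Longrightarrow> b (comb c ws) v = 0"
  unfolding form_comb by (intro sum.neutral) auto

text \<open>The norm of \<open>d\<close> is a natural number dividing \<open>\<plusminus>1\<close>,
  hence equal to 1: vectors of norm \<open>\<plusminus>1\<close> are primitive.\<close>

lemma unit_of_norm:
  assumes "x = smul d v" "d \<in> Eis" "v \<in> Lam" "hform x x = of_int e" "e = 1 \<or> e = -1"
  shows "hform v v = of_int e" "d \<noteq> 0"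
proof -
  have ev: "d * (cnj d * hform v v) = of_int e" using assms(1,4) by (simp add: hf mult.left_commute)
  thus d0: "d \<noteq> 0" using assms(5) by auto
  obtain n :: nat where n: "d * cnj d = of_nat n" using assms(2) by (rule Eis_norm_nat)
  obtain k :: int where k: "hform v v = of_int k"
    using Eis_pivot_int[OF hermitian_hform hform_Eis[OF assms(3,3)]] by metis
  have "of_int (int n * k) = (of_int e :: complex)" using ev n k by (simp add: mult.assoc[symmetric])
  hence nk: "int n * k = e" by (simp only: of_int_eq_iff)
  hence "\<bar>int n * k\<bar> = 1" using assms(5) by auto
  hence "\<bar>int n\<bar> = 1" by (rule abs_zmult_eq_1)
  hence "int n = 1" by simp
  thus "hform v v = of_int e" using nk k by simp
qed

text \<open>A vector of norm \<open>\<plusminus>1\<close> can, up to a unit, be made the head of a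
  basis, and the other members can be projected off it integrally; so the complement is again
  unimodular. After \<open>f0\<close> and \<open>f1\<close> a positive lattice of rank 3 and
  determinant 1 is left, whose reduced basis has all pivots 1.\<close>

lemma orthonormal_complement:
  assumes f: "f0 \<in> Lam" "f1 \<in> Lam" "hform f0 f0 = -1" "hform f1 f1 = 1" "hform f1 f0 = 0"
  shows "\<exists>e1 e2 e3. {e1, e2, e3} \<subseteq> {x \<in> Lam. hform x f0 = 0 \<and> hform x f1 = 0} \<and>
    hform e1 e1 = 1 \<and> hform e2 e2 = 1 \<and> hform e3 e3 = 1 \<and>
    hform e1 e2 = 0 \<and> hform e1 e3 = 0 \<and> hform e2 e3 = 0"
proof -
  let ?base = "map ev [0..<5]"
  let ?good = "good Eis (\<lambda>x. x \<noteq> (\<lambda>_. 0))"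
  have LamR: "vadd x (smul a y) \<in> Lam" if "x \<in> Lam" "y \<in> Lam" "a \<in> Eis" for x y a
    using that by (intro Lam_vadd Lam_smul)
  have base: "set ?base \<subseteq> Lam" using ev_Lam by auto
  have f_Eis: "\<forall>i<length ?base. f0 i \<in> Eis" "\<forall>i<length ?base. f1 i \<in> Eis" using f by (auto simp: Lam_def)
  obtain ws1 d where ws1: "equ Eis ?base ws1" "d \<in> Eis" "f0 = smul d (hd ws1)"
    using equ_primitive[OF comb_base[OF f(1)] f_Eis(1)] by auto
  obtain v us where vu: "ws1 = v # us" using equ_length[OF ws1(1)] by (cases ws1) auto
  have "set ws1 \<subseteq> Lam" by (rule equ_set_closed[OF ws1(1) base LamR])
  hence vL: "v \<in> Lam" and usL: "set us \<subseteq> Lam" using vu by auto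
  have vv: "hform v v = -1" and d0: "d \<noteq> 0"
    using unit_of_norm[of f0 d v "-1"] ws1 vu vL f(3) by auto
  \<comment> \<open>The sign is plus because \<open>v\<close> has norm \<open>-1\<close>.\<close>
  define ws2 where "ws2 = map (\<lambda>w. vadd w (smul (hform w v) v)) us"
  have e2: "equ Eis ?base (v # ws2)"
    using equ_trans[OF ws1(1)[unfolded vu]] equ_adjust_tail[of us "\<lambda>w. hform w v" Eis v "[]"] hform_Eis vL usL
    by (auto simp: ws2_def)
  let ?M = "{x \<in> Lam. hform x v = 0}"
  have ws2M: "set ws2 \<subseteq> ?M" using usL vL vv hform_Eis by (auto simp: ws2_def hf intro!: LamR)
  have MR: "vadd x (smul a y) \<in> ?M" if "x \<in> ?M" "y \<in> ?M" "a \<in> Eis" for x y a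
    using that by (auto simp: hf intro: LamR)
  have g2: "gdet hform ws2 = 1"
  proof -
    have "-1 = gdet hform (v # ws2)" using equ_gdet[OF e2 hermitian_hform] gdet_base by simp
    also have "\<dots> = - gdet (schur hform v) ws2" using vv by (simp add: gdet_Cons)
    also have "gdet (schur hform v) ws2 = gdet hform ws2"
      by (rule gdet_cong) (use ws2M in \<open>auto simp: schur_def\<close>)
    finally show ?thesis by simp
  qed
  have good2: "?good ws2" by (rule good_tail[OF star_ring_Eis equ_good[OF e2 star_ring_Eis good_base]])
  obtain c where c: "\<forall>i<length (v # ws2). c i \<in> Eis" "f1 = comb c (v # ws2)"
    using equ_comb[OF e2 star_ring_Eis f_Eis(2)] comb_base[OF f(2)] by metis
  have f1v: "hform f1 v = 0" using f(5) ws1(3) vu d0 by (simp add: hf)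
  have "hform (comb (\<lambda>i. c (Suc i)) ws2) v = 0"
    by (rule form_comb_orth[OF hermitian_hform]) (use ws2M in auto)
  hence "c 0 = 0" using f1v vv unfolding c(2) by (simp add: comb_Cons hf)
  hence "f1 = comb (\<lambda>i. c (Suc i)) ws2" unfolding c(2) by (simp add: comb_Cons vadd_def smul_def)
  moreover have "ws2 \<noteq> []" using equ_length[OF e2] by auto
  ultimately obtain ws3 d' where ws3: "equ Eis ws2 ws3" "d' \<in> Eis" "f1 = smul d' (hd ws3)"
    using equ_primitive[of f1 "\<lambda>i. c (Suc i)" ws2] c(1) by auto
  obtain u ts where ut: "ws3 = u # ts" using equ_length[OF ws3(1)] \<open>ws2 \<noteq> []\<close> by (cases ws3) auto
  have "set ws3 \<subseteq> ?M" by (rule equ_set_closed[OF ws3(1) ws2M MR])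
  hence uM: "u \<in> ?M" and tsM: "set ts \<subseteq> ?M" using ut by auto
  have uu: "hform u u = 1" and d'0: "d' \<noteq> 0"
    using unit_of_norm[of f1 d' u 1] ws3 ut uM f(4) by auto
  define zs where "zs = map (\<lambda>w. vadd w (smul (- hform w u) u)) ts"
  have e3: "equ Eis ws2 (u # zs)"
    using equ_trans[OF ws3(1)[unfolded ut]] equ_adjust_tail[of ts "\<lambda>w. - hform w u" Eis u "[]"] hform_Eis uM tsM
    by (auto simp: zs_def subset_iff intro!: Eis_closed(5))
  let ?N = "{x \<in> Lam. hform x v = 0 \<and> hform x u = 0}"
  have zsN: "set zs \<subseteq> ?N"
  proof
    fix z assume "z \<in> set zs"
    then obtain w where w: "w \<in> ?M" "z = vadd w (smul (- hform w u) u)" using tsM by (auto simp: zs_def)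
    have "z \<in> ?M" unfolding w(2) using w(1) uM hform_Eis by (intro MR) (auto intro: Eis_closed(5))
    moreover have "hform z u = 0" by (simp add: w(2) hf uu)
    ultimately show "z \<in> ?N" by simp
  qed
  have NR: "vadd x (smul a y) \<in> ?N" if "x \<in> ?N" "y \<in> ?N" "a \<in> Eis" for x y a
    using that by (auto simp: hf intro: LamR)
  have g3: "gdet hform zs = 1"
  proof -
    have "1 = gdet hform (u # zs)" using equ_gdet[OF e3 hermitian_hform] g2 by simp
    also have "\<dots> = gdet (schur hform u) zs" using uu by (simp add: gdet_Cons)
    also have "\<dots> = gdet hform zs" by (rule gdet_cong) (use zsN in \<open>auto simp: schur_def\<close>)
    finally show ?thesis by simp
  qed
  have good3: "?good zs" by (rule good_tail[OF star_ring_Eis equ_good[OF e3 star_ring_Eis good2]])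
  \<comment> \<open>\<open>hform\<close> is indefinite on the whole space. Its Schur form along the
    negative vector \<open>v\<close> is \<open>nonneg\<close> there and agrees with
    \<open>hform\<close> on \<open>?N\<close>.\<close>
  define b where "b = schur hform v"
  have b: "b x y = hform x y" if "x \<in> ?N" for x y using that by (simp add: b_def schur_def)
  have hb: "hermitian b" unfolding b_def by (rule hermitian_schur[OF hermitian_hform])
  have nb: "nonneg b" unfolding b_def using lorentzian_hform vv by (simp add: lorentzian_def)
  have ab: "aniso Eis b zs" unfolding good_def
  proof (intro allI impI)
    fix c assume c: "nontriv Eis (length zs) c"
    let ?x = "comb c zs"
    have nz: "?x \<noteq> (\<lambda>_. 0)" using good3 c by (auto simp: good_def)
    have xL: "?x \<in> Lam" using c zsN by (intro Lam_comb) (auto simp: nontriv_def)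
    have xv: "hform ?x v = 0" "hform ?x u = 0"
      by (rule form_comb_orth[OF hermitian_hform], use zsN in auto)+
    have "hform ?x ?x \<noteq> 0"
    proof
      assume "hform ?x ?x = 0"
      hence "?x i = 0" for i
        using hform_orth_neg[of v ?x i] xv vv Lam_supp[OF xL, of i] by (cases "i < 5") auto
      thus False using nz by blast
    qed
    thus "b ?x ?x \<noteq> 0" using b[of ?x ?x] xL xv by simp
  qed
  have eb: "entries_in Eis b zs" using zsN b hform_Eis by (auto simp: entries_in_def subset_iff)
  have sb: "scaled_in Eis b zs" unfolding scaled_in_def using eb by (intro exI[of _ "1::nat"]) simp
  obtain ys where ys: "equ Eis zs ys" "reduced Eis b ys" using hermite_reduction[OF hb star_ring_Eis ab sb] by blast
  have "length ys = 3" using equ_length[OF ys(1)] equ_length[OF e3] equ_length[OF e2] by simp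
  then obtain x y z where xyz: "ys = [x, y, z]" by (auto simp: length_Suc_conv eval_nat_numeral)
  have ysN: "set ys \<subseteq> ?N" by (rule equ_set_closed[OF ys(1) zsN NR])
  have gb: "gdet b ys = 1"
    using equ_gdet[OF ys(1) hb] gdet_cong[of zs b hform] b zsN g3 by (auto simp: subset_iff)
  note p = unimodular_rank3_pivots[OF hb nb equ_good[OF ys(1) star_ring_Eis ab, unfolded xyz]
      equ_entries_in[OF ys(1) hb star_ring_Eis ideal_in_self[OF star_ring_Eis] eb, unfolded xyz]
      gb[unfolded xyz] ys(2)[unfolded xyz]]
  have N: "x \<in> ?N" "y \<in> ?N" "z \<in> ?N" using ysN xyz by auto
  \<comment> \<open>Gram-Schmidt needs no division here, because the pivots are 1.\<close>
  define y' where "y' = vadd y (smul (- hform y x) x)"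
  define z' where "z' = vadd z (smul (- hform z x) x)"
  define w where "w = vadd z' (smul (- hform z' y') y')"
  have NN: "vadd s (smul (- hform s t) t) \<in> ?N" if "s \<in> ?N" "t \<in> ?N" for s t
    by (rule NR[OF that]) (use that hform_Eis Eis_closed(5) in auto)
  have N': "y' \<in> ?N" "z' \<in> ?N" unfolding y'_def z'_def by (rule NN[OF N(2,1)], rule NN[OF N(3,1)])
  have Nw: "w \<in> ?N" unfolding w_def by (rule NN[OF N'(2,1)])
  have xx: "hform x x = 1" using p(1) b[OF N(1)] by simp
  have x0: "b x x \<noteq> 0" using p(1) by simp
  have bx: "b s x / b x x = hform s x" if "s \<in> ?N" for s using b[OF that] p(1) by simp
  have sch: "schur b x s t = hform (vadd s (smul (- hform s x) x)) (vadd t (smul (- hform t x) x))" if "s \<in> ?N" "t \<in> ?N" for s t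
  proof -
    show ?thesis unfolding schur_proj[OF hb x0] bx[OF that(1)] bx[OF that(2)]
      by (rule b[OF NN[OF that(1) N(1)]])
  qed
  have yy: "hform y' y' = 1" using p(2) sch[OF N(2) N(2)] by (simp add: y'_def)
  have zz: "hform z' z' - hform z' y' * hform y' z' = 1"
    using p(3) unfolding schur_def[of "schur b x"] p(2) sch[OF N(3) N(3)] sch[OF N(3) N(2)] sch[OF N(2) N(3)]
    by (simp add: y'_def z'_def)
  have xy: "hform x y' = 0" "hform y' x = 0" "hform x z' = 0" "hform z' x = 0"
    using hf(5)[of y x] hf(5)[of z x] by (simp_all add: y'_def z'_def hf xx)
  have ww: "hform w w = 1" using zz by (simp add: w_def hf yy algebra_simps)
  have xw: "hform x w = 0" using xy by (simp add: w_def hf)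
  have yw: "hform y' w = 0" by (simp add: w_def hf yy)
  have orth: "hform s f0 = 0" "hform s f1 = 0" if "s \<in> ?N" for s
    using that ws1(3) ws3(3) vu ut by (simp_all add: hf)
  show ?thesis
    using xx yy ww xy xw yw orth N(1) N'(1) Nw by (intro exI[of _ x] exI[of _ y'] exI[of _ w]) auto
qed

section \<open>Orthonormal frames, and lines permuted by an anti-involution\<close>

definition frame :: "cvec list \<Rightarrow> bool" where
  "frame F \<longleftrightarrow> length F = 5 \<and> set F \<subseteq> Lam \<and>
     (\<forall>i<5. \<forall>j<5. hform (F ! i) (F ! j) = (if i = j then sgnw i else 0))"

lemma sgnw_sq: "sgnw i * sgnw i = 1" "cnj (sgnw i) = sgnw i" by (auto simp: sgnw_def)

text \<open>The Gram determinant of a frame is -1, so its coordinate matrix is invertible; pairing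
  with the frame vectors then reads off the coefficients.\<close>

lemma frame_comb:
  assumes F: "frame F" and x: "x \<in> Lam"
  shows "x = comb (\<lambda>i. sgnw i * hform x (F ! i)) F"
proof -
  have n: "length F = 5" and L: "set F \<subseteq> Lam"
    and o: "\<And>i j. i < 5 \<Longrightarrow> j < 5 \<Longrightarrow> hform (F ! i) (F ! j) = (if i = j then sgnw i else 0)"
    using F by (auto simp: frame_def)
  have "gram hform F = sgn_mat" by (rule eq_matI) (auto simp: gram_def sgn_mat_def n o)
  hence "gdet hform F = -1" by (simp add: gdet_def det_sgn_mat)
  hence d: "det (cmat F) \<noteq> 0" using gdet_hform[OF n] by auto
  have supp: "(F ! i) k = 0" if "i < 5" "k \<ge> 5" for i k
    using L n that nth_mem[of i F] by (auto simp: Lam_def subset_iff)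
  obtain c where c: "x = comb c F" using span5[OF n d supp, of x] Lam_supp[OF x] by blast
  have "c j = sgnw j * hform x (F ! j)" if j: "j < 5" for j
  proof -
    have "hform x (F ! j) = (\<Sum>i<5. if i = j then c j * sgnw j else 0)"
      unfolding c form_comb[OF hermitian_hform] n by (rule sum.cong) (use o j in auto)
    thus ?thesis using j by (simp add: mult.left_commute[of "sgnw j"] sgnw_sq)
  qed
  hence "comb c F = comb (\<lambda>i. sgnw i * hform x (F ! i)) F"
    unfolding comb_def n by (intro ext sum.cong) auto
  thus ?thesis using c by simp
qed

lemma frame_form:
  assumes F: "frame F" and x: "x \<in> Lam"
  shows "hform x y = (\<Sum>i<5. sgnw i * hform x (F ! i) * hform (F ! i) y)"
proof -
  have "hform x y = hform (comb (\<lambda>i. sgnw i * hform x (F ! i)) F) y" using frame_comb[OF F x] by simp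
  thus ?thesis using F by (simp add: form_comb[OF hermitian_hform] frame_def)
qed

definition orthonormal :: "cvec list \<Rightarrow> bool" where
  "orthonormal xs \<longleftrightarrow> distinct xs \<and> (\<forall>a\<in>set xs. \<forall>c\<in>set xs. hform a c = (if a = c then 1 else 0))"

lemma frame_Cons:
  assumes "f0 \<in> Lam" "hform f0 f0 = -1" "length xs = 4" "set xs \<subseteq> Lam" "orthonormal xs" "\<And>a. a \<in> set xs \<Longrightarrow> hform a f0 = 0"
  shows "frame (f0 # xs)"
proof -
  have o: "hform f0 a = 0" if "a \<in> set xs" for a using assms(6)[OF that] hf(5)[of a f0] by simp
  have "hform ((f0 # xs) ! i) ((f0 # xs) ! j) = (if i = j then sgnw i else 0)" if ij: "i < 5" "j < 5" for i j
  proof (cases i; cases j)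
    fix k l assume kl: "i = Suc k" "j = Suc l"
    hence "k < length xs" "l < length xs" using ij assms(3) by auto
    thus ?thesis using kl assms(5) nth_eq_iff_index_eq[of xs k l] by (auto simp: orthonormal_def sgnw_def)
  qed (use assms o ij in \<open>auto simp: sgnw_def\<close>)
  thus ?thesis using assms by (simp add: frame_def)
qed

lemma hform_sym0: "hform x y = 0 \<Longrightarrow> hform y x = 0"
  using hf(5)[of x y] by simp

lemma orthonormal4:
  assumes "hform a a = 1" "hform b b = 1" "hform c c = 1" "hform d d = 1"
    "hform a b = 0" "hform a c = 0" "hform a d = 0" "hform b c = 0" "hform b d = 0" "hform c d = 0"
  shows "orthonormal [a, b, c, d]"
proof -
  note s = assms(5-10)[THEN hform_sym0]
  show ?thesis using assms s unfolding orthonormal_def by auto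
qed

text \<open>The norms of the three coordinates are natural numbers with sum 1, so exactly one
  coordinate is nonzero and it is a unit. This is why the three coordinate lines can only be
  permuted.\<close>

lemma norm_one_in_complement:
  assumes F: "frame [f0, f1, e1, e2, e3]" and x: "x \<in> Lam" "hform x f0 = 0" "hform x f1 = 0" "hform x x = 1"
  shows "\<exists>e\<in>{e1, e2, e3}. \<exists>\<alpha>\<in>Eis. \<alpha> * cnj \<alpha> = 1 \<and> x = smul \<alpha> e"
proof -
  have eL: "e1 \<in> Lam" "e2 \<in> Lam" "e3 \<in> Lam" using F by (auto simp: frame_def)
  define a where "a = hform x e1"
  define b where "b = hform x e2"
  define c where "c = hform x e3"
  have E: "a \<in> Eis" "b \<in> Eis" "c \<in> Eis" using eL x hform_Eis by (auto simp: a_def b_def c_def)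
  have s5: "(\<Sum>i<5. f i) = f 0 + f 1 + f 2 + f 3 + f 4" for f :: "nat \<Rightarrow> complex"
    by (simp add: eval_nat_numeral)
  have "1 = a * cnj a + b * cnj b + c * cnj c"
    using frame_form[OF F x(1), of x] x(2-4) unfolding s5 by (simp add: sgnw_def a_def b_def c_def hf(5))
  moreover obtain k where k: "a * cnj a = of_nat k" by (rule Eis_norm_nat[OF E(1)])
  moreover obtain l where l: "b * cnj b = of_nat l" by (rule Eis_norm_nat[OF E(2)])
  moreover obtain m where m: "c * cnj c = of_nat m" by (rule Eis_norm_nat[OF E(3)])
  ultimately have "(of_nat 1 :: complex) = of_nat (k + l + m)" by simp
  hence klm: "1 = k + l + m" by (simp only: of_nat_eq_iff)
  have xe: "x = (\<lambda>i. a * e1 i + b * e2 i + c * e3 i)"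
    using frame_comb[OF F x(1)] x(2,3) by (simp add: comb_Cons vadd_def smul_def sgnw_def a_def b_def c_def add.assoc)
  have z: "t = 0" if "t * cnj t = of_nat 0" for t using that by simp
  from klm consider "k = 1 \<and> l = 0 \<and> m = 0" | "l = 1 \<and> k = 0 \<and> m = 0" | "m = 1 \<and> k = 0 \<and> l = 0" by linarith
  thus ?thesis
  proof cases
    case 1
    hence "x = smul a e1" using xe z[of b] z[of c] l m by (simp add: smul_def)
    thus ?thesis using E k 1 by auto
  next
    case 2
    hence "x = smul b e2" using xe z[of a] z[of c] k m by (simp add: smul_def)
    thus ?thesis using E l 2 by auto
  next
    case 3
    hence "x = smul c e3" using xe z[of a] z[of b] k l by (simp add: smul_def)
    thus ?thesis using E m 3 by auto
  qed
qed

text \<open>The units are the sixth roots of unity. Four times the norm equation reads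
  \<open>(2 * a - b) * (2 * a - b) + 3 * (b * b) = 4\<close>, which confines both coordinates to
  \<open>-1, 0, 1\<close>.\<close>

lemma Eis_unit_cube:
  assumes "\<alpha> \<in> Eis" "\<alpha> * cnj \<alpha> = 1" shows "\<alpha> * \<alpha> * \<alpha> = 1 \<or> \<alpha> * \<alpha> * \<alpha> = -1"
proof -
  obtain a b where ab: "\<alpha> = of_int a + of_int b * omega" using assms(1) by (rule EisE)
  have w1: "omega * cnj omega = 1" by (simp add: cnj_omega algebra_simps omega_sq)
  have "\<alpha> * cnj \<alpha> = of_int (a * a) + of_int (a * b) * (omega + cnj omega) + of_int (b * b) * (omega * cnj omega)"
    by (simp add: ab algebra_simps)
  also have "\<dots> = of_int (a * a - a * b + b * b)" by (simp only: w1) (simp add: cnj_omega)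
  finally have "(of_int (a * a - a * b + b * b) :: complex) = of_int 1" using assms(2) by simp
  hence n: "a * a - a * b + b * b = 1" by (simp only: of_int_eq_iff)
  have "(2 * a - b) * (2 * a - b) + 3 * (b * b) = 4" "(2 * b - a) * (2 * b - a) + 3 * (a * a) = 4"
    using n by (simp_all add: algebra_simps)
  moreover have "0 \<le> (2 * a - b) * (2 * a - b)" "0 \<le> (2 * b - a) * (2 * b - a)" by simp_all
  ultimately have "b * b \<le> 1" "a * a \<le> 1" by linarith+
  hence "\<bar>b\<bar> \<le> 1" "\<bar>a\<bar> \<le> 1" by (metis abs_le_square_iff abs_1 one_power2 power2_eq_square)+
  hence "a \<in> {-1, 0, 1}" "b \<in> {-1, 0, 1}" by auto
  moreover have o3: "omega * omega * omega = 1" by (simp add: omega_sq algebra_simps)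
  moreover have "(1 + omega) * (1 + omega) * (1 + omega) = -1"
  proof -
    have "(1 + omega) * (1 + omega) = omega" by (simp add: algebra_simps omega_sq)
    thus ?thesis by (simp add: algebra_simps omega_sq)
  qed
  moreover have "(- 1 - omega) * (- 1 - omega) * (- 1 - omega) = - ((1 + omega) * (1 + omega) * (1 + omega))"
    by (simp add: algebra_simps)
  ultimately show ?thesis using n unfolding ab by auto
qed

definition eigen :: "(cvec \<Rightarrow> cvec) \<Rightarrow> cvec \<Rightarrow> bool" where
  "eigen \<xi> x \<longleftrightarrow> \<xi> x = x \<or> \<xi> x = smul (-1) x"

text \<open>Take \<open>\<epsilon> = \<alpha>\<^sup>2\<close>. The image of
  \<open>\<epsilon>\<close> times \<open>e\<close> is
  \<open>cnj \<epsilon> * \<alpha> = cnj \<alpha>\<close> times \<open>e\<close>, and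
  \<open>cnj \<alpha> = \<plusminus> \<alpha>\<^sup>2\<close> because
  \<open>\<alpha>\<^sup>3 = \<plusminus>1\<close>.\<close>

lemma eigen_of_line:
  assumes \<xi>: "anti_involution \<xi>" and e: "e \<in> Lam" and a: "\<alpha> \<in> Eis" "\<alpha> * cnj \<alpha> = 1" and x: "\<xi> e = smul \<alpha> e"
  shows "\<exists>\<epsilon>\<in>Eis. \<epsilon> * cnj \<epsilon> = 1 \<and> eigen \<xi> (smul \<epsilon> e)"
proof (intro bexI conjI)
  let ?e = "\<alpha> * \<alpha>"
  show E: "?e \<in> Eis" using a by (intro Eis_closed(4))
  have "?e * cnj ?e = (\<alpha> * cnj \<alpha>) * (\<alpha> * cnj \<alpha>)" by simp
  thus "?e * cnj ?e = 1" by (simp only: a(2)) simp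
  have "cnj ?e * \<alpha> = (\<alpha> * cnj \<alpha>) * cnj \<alpha>" by simp
  hence 1: "cnj ?e * \<alpha> = cnj \<alpha>" by (simp only: a(2)) simp
  have q: "?e = (\<alpha> * \<alpha> * \<alpha>) * cnj \<alpha>" using a(2) by (simp add: mult.assoc)
  have "cnj \<alpha> = ?e \<or> cnj \<alpha> = - ?e"
    using Eis_unit_cube[OF a]
  proof
    assume t: "\<alpha> * \<alpha> * \<alpha> = 1"
    show ?thesis using q[unfolded t] by simp
  next
    assume t: "\<alpha> * \<alpha> * \<alpha> = -1"
    show ?thesis using q[unfolded t] by simp
  qed
  moreover have "\<xi> (smul ?e e) = smul (cnj ?e * \<alpha>) e"
    using anti_involutionD(3)[OF \<xi> E e] by (simp add: x smul_def mult.assoc)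
  ultimately show "eigen \<xi> (smul ?e e)" unfolding eigen_def 1 by (auto simp: smul_def)
qed

text \<open>An involution of three lines fixes all of them or exchanges just two. A fixed line is
  spanned by an eigenvector of norm one; for exchanged lines the unit is absorbed into the second
  vector, which leaves \<open>\<xi> u1 = u2\<close>.\<close>

lemma complement_eigenbasis:
  assumes \<xi>: "anti_involution \<xi>"
    and f: "f0 \<in> Lam" "f1 \<in> Lam" "hform f0 f0 = -1" "hform f1 f1 = 1" "hform f1 f0 = 0"
    and stable: "\<And>x. x \<in> Lam \<Longrightarrow> hform x f0 = 0 \<Longrightarrow> hform x f1 = 0 \<Longrightarrow> hform (\<xi> x) f0 = 0 \<and> hform (\<xi> x) f1 = 0"
  obtains u1 u2 u3 where "u1 \<in> Lam" "u2 \<in> Lam" "u3 \<in> Lam"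
    "hform u1 f0 = 0" "hform u1 f1 = 0" "hform u2 f0 = 0" "hform u2 f1 = 0" "hform u3 f0 = 0" "hform u3 f1 = 0"
    "hform u1 u1 = 1" "hform u2 u2 = 1" "hform u3 u3 = 1" "hform u1 u2 = 0" "hform u1 u3 = 0" "hform u2 u3 = 0"
    "eigen \<xi> u3" "(eigen \<xi> u1 \<and> eigen \<xi> u2) \<or> \<xi> u1 = u2"
proof -
  note goal = that
  define C where "C = {x \<in> Lam. hform x f0 = 0 \<and> hform x f1 = 0}"
  define on where "on u1 u2 u3 \<longleftrightarrow> u1 \<in> C \<and> u2 \<in> C \<and> u3 \<in> C \<and> hform u1 u1 = 1 \<and> hform u2 u2 = 1 \<and> hform u3 u3 = 1 \<and>
    hform u1 u2 = 0 \<and> hform u1 u3 = 0 \<and> hform u2 u3 = 0" for u1 u2 u3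
  obtain e1 e2 e3 where e: "on e1 e2 e3"
    using orthonormal_complement[OF f] by (auto simp: on_def C_def)
  have F: "frame [f0, f1, e1, e2, e3]"
    by (rule frame_Cons) (use e f hform_sym0 in \<open>auto simp: on_def C_def intro!: orthonormal4\<close>)
  \<comment> \<open>\<open>r p q\<close> says that \<open>\<xi>\<close> carries the line of
    \<open>p\<close> to the line of \<open>q\<close>. Below, \<open>sym\<close> holds because
    \<open>\<xi>\<close> is an involution, and \<open>inj\<close> because it preserves
    orthogonality.\<close>
  define r where "r p q \<longleftrightarrow> (\<exists>\<alpha>\<in>Eis. \<alpha> * cnj \<alpha> = 1 \<and> \<xi> p = smul \<alpha> q)" for p q
  have img: "r p e1 \<or> r p e2 \<or> r p e3" if p: "p \<in> C" "hform p p = 1" for p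
  proof -
    have "hform (\<xi> p) (\<xi> p) = 1" using anti_involutionD(5)[OF \<xi>, of p p] p by (simp add: C_def)
    moreover have "\<xi> p \<in> Lam" using anti_involutionD(1)[OF \<xi>] p by (simp add: C_def)
    ultimately show ?thesis
      using norm_one_in_complement[OF F, of "\<xi> p"] stable[of p] p unfolding r_def C_def by auto
  qed
  have sym: "r q p" if "r p q" "p \<in> C" "q \<in> C" for p q
  proof -
    from that obtain \<alpha> where a: "\<alpha> \<in> Eis" "\<alpha> * cnj \<alpha> = 1" "\<xi> p = smul \<alpha> q" by (auto simp: r_def)
    have "p = smul (cnj \<alpha>) (\<xi> q)"
      using anti_involutionD(4)[OF \<xi>, of p] anti_involutionD(3)[OF \<xi> a(1), of q] that a(3) by (simp add: C_def)
    hence "smul \<alpha> p = smul (\<alpha> * cnj \<alpha>) (\<xi> q)" by (simp add: smul_def mult.assoc)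
    hence "\<xi> q = smul \<alpha> p" using a(2) by simp
    thus ?thesis using a unfolding r_def by blast
  qed
  have inj: False if "r p s" "r q s" "p \<in> C" "q \<in> C" "hform p q = 0" "hform s s = 1" for p q s
  proof -
    from that obtain \<alpha> \<beta> where a: "\<alpha> * cnj \<alpha> = 1" "\<xi> p = smul \<alpha> s" "\<beta> * cnj \<beta> = 1" "\<xi> q = smul \<beta> s" by (auto simp: r_def)
    have "hform (\<xi> p) (\<xi> q) = 0" using anti_involutionD(5)[OF \<xi>, of p q] that by (simp add: C_def)
    hence "\<alpha> = 0 \<or> \<beta> = 0" using a that by (auto simp: hf)
    thus False using a(1,3) by auto
  qed
  have C_smul: "smul a x \<in> C" if "x \<in> C" "a \<in> Eis" for a x using that by (auto simp: C_def hf Lam_smul)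
  have adj: "\<exists>u \<epsilon>. u = smul \<epsilon> p \<and> u \<in> C \<and> eigen \<xi> u \<and> \<epsilon> * cnj \<epsilon> = 1" if "r p p" "p \<in> C" for p
  proof -
    from that obtain \<alpha> where a: "\<alpha> \<in> Eis" "\<alpha> * cnj \<alpha> = 1" "\<xi> p = smul \<alpha> p" by (auto simp: r_def)
    have "p \<in> Lam" using that by (simp add: C_def)
    from eigen_of_line[OF \<xi> this a] show ?thesis using C_smul[OF that(2)] by blast
  qed
  have nrm: "hform (smul \<epsilon> p) (smul \<epsilon> p) = hform p p" if "\<epsilon> * cnj \<epsilon> = 1" for \<epsilon> p
  proof -
    have "hform (smul \<epsilon> p) (smul \<epsilon> p) = \<epsilon> * cnj \<epsilon> * hform p p" by (simp add: hf)
    thus ?thesis using that by simp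
  qed
  have fin: thesis if o: "on p q s" and rs: "r s s" and rr: "(r p p \<and> r q q) \<or> r p q" for p q s
  proof -
    have pqs: "p \<in> C" "q \<in> C" "s \<in> C" using o by (auto simp: on_def)
    obtain u3 \<epsilon>3 where u3: "u3 = smul \<epsilon>3 s" "u3 \<in> C" "eigen \<xi> u3" "\<epsilon>3 * cnj \<epsilon>3 = 1"
      using adj[OF rs pqs(3)] by (elim exE conjE)
    from rr show thesis
    proof
      assume "r p p \<and> r q q"
      hence rp: "r p p" and rq: "r q q" by simp_all
      obtain u1 \<epsilon>1 where u: "u1 = smul \<epsilon>1 p" "u1 \<in> C" "eigen \<xi> u1" "\<epsilon>1 * cnj \<epsilon>1 = 1"
        using adj[OF rp pqs(1)] by (elim exE conjE)
      obtain u2 \<epsilon>2 where u': "u2 = smul \<epsilon>2 q" "u2 \<in> C" "eigen \<xi> u2" "\<epsilon>2 * cnj \<epsilon>2 = 1"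
        using adj[OF rq pqs(2)] by (elim exE conjE)
      have n: "hform u1 u1 = 1" "hform u2 u2 = 1" "hform u3 u3 = 1"
        unfolding u(1) u'(1) u3(1) nrm[OF u(4)] nrm[OF u'(4)] nrm[OF u3(4)] using o by (auto simp: on_def)
      have o0: "hform u1 u2 = 0" "hform u1 u3 = 0" "hform u2 u3 = 0"
        unfolding u(1) u'(1) u3(1) using o by (auto simp: on_def hf)
      show thesis by (rule goal[of u1 u2 u3]) (use u u' u3 n o0 in \<open>auto simp: C_def\<close>)
    next
      assume "r p q"
      then obtain \<alpha> where a: "\<alpha> \<in> Eis" "\<alpha> * cnj \<alpha> = 1" "\<xi> p = smul \<alpha> q" by (auto simp: r_def)
      have uC: "smul \<alpha> q \<in> C" by (rule C_smul[OF pqs(2) a(1)])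
      have n: "hform (smul \<alpha> q) (smul \<alpha> q) = 1" "hform u3 u3 = 1"
        unfolding u3(1) nrm[OF a(2)] nrm[OF u3(4)] using o by (auto simp: on_def)
      have o0: "hform p (smul \<alpha> q) = 0" "hform p u3 = 0" "hform (smul \<alpha> q) u3 = 0"
        unfolding u3(1) using o by (auto simp: on_def hf)
      show thesis by (rule goal[of p "smul \<alpha> q" u3]) (use uC pqs u3 n o0 a o in \<open>auto simp: C_def on_def\<close>)
    qed
  qed
  have eC: "e1 \<in> C" "e2 \<in> C" "e3 \<in> C" and en: "hform e1 e1 = 1" "hform e2 e2 = 1" "hform e3 e3 = 1"
    and eo: "hform e1 e2 = 0" "hform e1 e3 = 0" "hform e2 e3 = 0" using e by (auto simp: on_def)
  note eo' = eo[THEN hform_sym0]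
  have p1: "on e1 e3 e2" "on e2 e3 e1" using e eo' by (auto simp: on_def)
  note i1 = img[OF eC(1) en(1)] and i2 = img[OF eC(2) en(2)] and i3 = img[OF eC(3) en(3)]
  consider "r e1 e1" "r e2 e2" "r e3 e3" | "r e1 e1" "r e2 e3" | "r e1 e2" "r e3 e3" | "r e1 e3" "r e2 e2"
  proof -
    have "r e1 e1 \<Longrightarrow> \<not> r e2 e1 \<and> \<not> r e3 e1" using inj[of e1 e1 e2] inj[of e1 e1 e3] eC en eo by blast
    moreover have "r e2 e2 \<Longrightarrow> \<not> r e3 e2" using inj[of e2 e2 e3] eC en eo by blast
    moreover have "r e1 e2 \<Longrightarrow> r e2 e1 \<and> \<not> r e3 e2" using sym[of e1 e2] inj[of e1 e2 e3] eC en eo by blast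
    moreover have "r e2 e1 \<Longrightarrow> \<not> r e3 e1" using inj[of e2 e1 e3] eC en eo by blast
    moreover have "r e1 e3 \<Longrightarrow> r e3 e1 \<and> \<not> r e2 e3" using sym[of e1 e3] inj[of e1 e3 e2] eC en eo by blast
    moreover have "r e3 e1 \<Longrightarrow> \<not> r e2 e1" using inj[of e2 e1 e3] eC en eo by blast
    ultimately show ?thesis using that i1 i2 i3 by blast
  qed
  thus thesis
  proof cases
    case 1 thus thesis using fin[OF e] by blast
  next
    case 2 thus thesis using fin[OF p1(2)] by blast
  next
    case 3 thus thesis using fin[OF e] by blast
  next
    case 4 thus thesis using fin[OF p1(1)] by blast
  qed
qed

section \<open>Hyperbolic planes spanned by vectors fixed under an anti-involution or its
  negative\<close>

definition neg_map :: "(cvec \<Rightarrow> cvec) \<Rightarrow> cvec \<Rightarrow> cvec" where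
  "neg_map \<xi> x = smul (-1) (\<xi> x)"

lemma smul_smul: "smul a (smul c x) = smul (a * c) x" by (simp add: smul_def mult.assoc)

lemma neg_map_neg_map: "neg_map (neg_map \<xi>) = \<xi>"
  by (rule ext) (simp add: neg_map_def smul_smul)

lemma smul_vadd: "smul a (vadd x y) = vadd (smul a x) (smul a y)"
  by (simp add: smul_def vadd_def algebra_simps)

lemma minus_one_Eis: "-1 \<in> Eis" by (intro Eis_closed(2,5))

lemma anti_involutionI:
  assumes "\<And>x. x \<in> Lam \<Longrightarrow> \<xi> x \<in> Lam" "\<And>x y. x \<in> Lam \<Longrightarrow> y \<in> Lam \<Longrightarrow> \<xi> (vadd x y) = vadd (\<xi> x) (\<xi> y)"
    "\<And>a x. a \<in> Eis \<Longrightarrow> x \<in> Lam \<Longrightarrow> \<xi> (smul a x) = smul (cnj a) (\<xi> x)" "\<And>x. x \<in> Lam \<Longrightarrow> \<xi> (\<xi> x) = x"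
    "\<And>x y. x \<in> Lam \<Longrightarrow> y \<in> Lam \<Longrightarrow> hform (\<xi> x) (\<xi> y) = cnj (hform x y)"
  shows "anti_involution \<xi>"
proof -
  have "bij_betw \<xi> Lam Lam" by (rule bij_betw_byWitness[where f' = \<xi>]) (use assms in auto)
  thus ?thesis using assms unfolding anti_involution_def by blast
qed

lemma anti_involution_neg: assumes \<xi>: "anti_involution \<xi>" shows "anti_involution (neg_map \<xi>)"
proof (rule anti_involutionI)
  note d = anti_involutionD[OF \<xi>]
  fix x y a assume x: "x \<in> Lam"
  show "neg_map \<xi> x \<in> Lam" unfolding neg_map_def by (intro Lam_smul minus_one_Eis d x)
  show "neg_map \<xi> (neg_map \<xi> x) = x"
    unfolding neg_map_def d(3)[OF minus_one_Eis d(1)[OF x]] d(4)[OF x] by (simp add: smul_smul)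
  show "neg_map \<xi> (smul a x) = smul (cnj a) (neg_map \<xi> x)" if "a \<in> Eis"
    unfolding neg_map_def d(3)[OF that x] by (simp add: smul_smul mult.commute)
  show "neg_map \<xi> (vadd x y) = vadd (neg_map \<xi> x) (neg_map \<xi> y)" if "y \<in> Lam"
    unfolding neg_map_def d(2)[OF x that] by (simp add: smul_vadd)
  show "hform (neg_map \<xi> x) (neg_map \<xi> y) = cnj (hform x y)" if "y \<in> Lam"
    unfolding neg_map_def d(5)[OF x that, symmetric] by (simp add: hf)
qed

text \<open>Let \<open>m > 0\<close> generate the values \<open>hform x \<rho>\<close> for fixed
  \<open>x\<close>. By the trace identity, \<open>\<rho>\<close> pairs with \<open>theta\<close>
  times each basis vector to \<open>m\<close> times an Eisenstein integer, so \<open>y\<close>, the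
  vector \<open>theta / m\<close> times \<open>\<rho>\<close>, lies in the lattice. It is isotropic,
  negated by \<open>\<xi>\<close>, and its squared Euclidean length is \<open>3 / m\<^sup>2\<close>
  times that of \<open>\<rho>\<close>. Minimality gives \<open>m\<^sup>2 \<le> 3\<close>, that is
  \<open>m = 1\<close>.\<close>

lemma hyperbolic_pair_aux:
  assumes \<xi>: "anti_involution \<xi>" and \<rho>: "\<rho> \<in> Lfix \<xi>" "\<rho> \<noteq> (\<lambda>_. 0)" "hform \<rho> \<rho> = 0"
    and min: "\<And>x. x \<in> Lfix (neg_map \<xi>) \<Longrightarrow> x \<noteq> (\<lambda>_. 0) \<Longrightarrow> hform x x = 0 \<Longrightarrow>
      (\<Sum>i<5. (cmod (\<rho> i))\<^sup>2) \<le> (\<Sum>i<5. (cmod (x i))\<^sup>2)"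
  shows "\<exists>w\<in>Lfix \<xi>. hform w \<rho> = 1"
proof -
  note d = anti_involutionD[OF \<xi>]
  have \<rho>L: "\<rho> \<in> Lam" "\<xi> \<rho> = \<rho>" using \<rho>(1) by (auto simp: Lfix_def)
  have theta_form: "hform (smul theta (ev i)) \<rho> = theta * (sgnw i * cnj (\<rho> i))" if "i < 5" for i
    using hform_ev[OF that, of \<rho>] hf(5)[of \<rho> "ev i"] by (simp add: hf(2) sgnw_sq(2) flip: hf(5)[of \<rho> "ev i"])
  have trace_form: "hform (smul theta (ev i)) \<rho> = hform (trace2 \<xi> (ev i)) \<rho> + - cnj omega * hform (trace1 \<xi> (ev i)) \<rho>" for i
    unfolding theta_trace[of _ \<xi>] by (simp add: hf(1,2))
  define P where "P n \<longleftrightarrow> 0 < n \<and> (\<exists>x\<in>Lfix \<xi>. hform x \<rho> = of_nat n)" for n :: nat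
  have "\<exists>n. P n"
  proof (rule ccontr)
    assume no: "\<not> ?thesis"
    have z: "hform x \<rho> = 0" if x: "x \<in> Lfix \<xi>" for x
    proof (rule ccontr)
      assume nz: "hform x \<rho> \<noteq> 0"
      obtain k :: int where k: "hform x \<rho> = of_int k" using Lfix_hform_Ints[OF \<xi> x \<rho>(1)] by (auto elim: Ints_cases)
      have "hform (smul (of_int (sgn k)) x) \<rho> = of_nat (nat \<bar>k\<bar>)"
        using k by (simp add: hf(2) flip: of_int_mult) (simp add: abs_sgn mult.commute)
      moreover have "smul (of_int (sgn k)) x \<in> Lfix \<xi>" by (rule Lfix_smul[OF \<xi> x]) simp
      moreover have "0 < nat \<bar>k\<bar>" using nz k by auto
      ultimately show False using no unfolding P_def by blast
    qed
    have "\<rho> i = 0" for i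
    proof (cases "i < 5")
      case True
      have "theta * (sgnw i * cnj (\<rho> i)) = 0"
        using theta_form[OF True] trace_form[of i] z[OF trace_Lfix(1)[OF \<xi> ev_Lam[OF True]]] z[OF trace_Lfix(2)[OF \<xi> ev_Lam[OF True]]]
        by simp
      thus ?thesis using theta_nz by (auto simp: sgnw_def split: if_splits)
    next
      case False thus ?thesis using Lam_supp[OF \<rho>L(1)] by simp
    qed
    thus False using \<rho>(2) by blast
  qed
  define m where "m = (LEAST n. P n)"
  have "P m" unfolding m_def using \<open>\<exists>n. P n\<close> by (metis LeastI)
  then obtain w where m: "0 < m" "w \<in> Lfix \<xi>" "hform w \<rho> = of_nat m" by (auto simp: P_def)
  \<comment> \<open>Division with remainder: a nonzero remainder would be a smaller positive
    value.\<close>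
  have dv: "\<exists>k::int. hform x \<rho> = of_nat m * of_int k" if x: "x \<in> Lfix \<xi>" for x
  proof -
    obtain k :: int where k: "hform x \<rho> = of_int k" using Lfix_hform_Ints[OF \<xi> x \<rho>(1)] by (auto elim: Ints_cases)
    define q where "q = k div int m"
    define r where "r = k mod int m"
    have kqr: "k = int m * q + r" by (simp add: q_def r_def)
    have r: "0 \<le> r" "r < int m" using m(1) by (auto simp: r_def)
    let ?y = "vadd x (smul (of_int (- q)) w)"
    have "?y \<in> Lfix \<xi>" by (rule Lfix_add[OF \<xi> x m(2)]) simp
    moreover have "hform ?y \<rho> = of_int r" using k m(3) by (simp add: hf(1,2) kqr)
    ultimately have "P (nat r)" if "r \<noteq> 0" using r that unfolding P_def by (intro conjI bexI[of _ ?y]) auto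
    moreover have "nat r < m" using r by linarith
    ultimately have "r = 0" using not_less_Least[of "nat r" P] unfolding m_def by blast
    thus ?thesis using k kqr by (intro exI[of _ q]) simp
  qed
  define y where "y = smul (theta / of_nat m) \<rho>"
  have yL: "y \<in> Lam"
  proof (rule LamI)
    fix i :: nat assume i: "i < 5"
    obtain k1 where k1: "hform (trace1 \<xi> (ev i)) \<rho> = of_nat m * of_int k1" using dv[OF trace_Lfix(1)[OF \<xi> ev_Lam[OF i]]] by blast
    obtain k2 where k2: "hform (trace2 \<xi> (ev i)) \<rho> = of_nat m * of_int k2" using dv[OF trace_Lfix(2)[OF \<xi> ev_Lam[OF i]]] by blast
    define c :: complex where "c = of_int k2 - cnj omega * of_int k1"
    have cE: "c \<in> Eis" unfolding c_def by (intro Eis_closed(4,6,7) of_int_Eis omega_Eis)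
    \<comment> \<open>Pairing with \<open>theta\<close> times \<open>ev i\<close> exposes the
      conjugate of \<open>\<rho> i\<close>; conjugating back shows that \<open>m\<close> divides
      \<open>theta * \<rho> i\<close>.\<close>
    have "theta * (sgnw i * cnj (\<rho> i)) = of_nat m * c"
      using theta_form[OF i] trace_form[of i] by (simp add: k1 k2 c_def algebra_simps)
    hence "cnj (theta * (sgnw i * cnj (\<rho> i))) = cnj (of_nat m * c)" by (rule arg_cong)
    hence "- theta * (sgnw i * \<rho> i) = of_nat m * cnj c" by (simp add: cnj_theta sgnw_sq(2))
    hence "sgnw i * (theta * \<rho> i) = - (of_nat m * cnj c)" by (simp add: algebra_simps minus_equation_iff)
    hence "sgnw i * (sgnw i * (theta * \<rho> i)) = - sgnw i * (of_nat m * cnj c)" by simp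
    hence "theta * \<rho> i = - sgnw i * (of_nat m * cnj c)" by (simp add: mult.assoc[symmetric] sgnw_sq(1))
    hence "y i = - sgnw i * cnj c" using m(1) by (simp add: y_def smul_def field_simps)
    moreover have "- sgnw i * cnj c \<in> Eis"
      using cE by (intro Eis_closed(4,5,7)) (auto simp: sgnw_def Eis_closed)
    ultimately show "y i \<in> Eis" by simp
  next
    fix i :: nat assume "i \<ge> 5"
    thus "y i = 0" using Lam_supp[OF \<rho>L(1)] by (simp add: y_def smul_def)
  qed
  have mE: "of_nat m \<in> Eis" by (rule star_ring_of_nat[OF star_ring_Eis])
  have my: "smul (of_nat m) y = smul theta \<rho>" using m(1) by (simp add: y_def smul_smul)
  have "smul (of_nat m) (\<xi> y) = smul (- theta) \<rho>"
    using d(3)[OF mE yL] d(3)[OF theta_Eis \<rho>L(1)] my \<rho>L(2) by (simp add: cnj_theta)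
  hence "\<xi> y = smul (- 1) y"
  proof -
    assume a: "smul (of_nat m) (\<xi> y) = smul (- theta) \<rho>"
    have "\<xi> y = smul (1 / of_nat m) (smul (of_nat m) (\<xi> y))" using m(1) by (simp add: smul_smul)
    also have "\<dots> = smul (- 1) y" unfolding a by (simp add: y_def smul_smul)
    finally show ?thesis .
  qed
  hence yn: "y \<in> Lfix (neg_map \<xi>)" using yL by (simp add: Lfix_def neg_map_def smul_smul)
  have t0: "theta / of_nat m \<noteq> 0" using theta_nz m(1) by simp
  have "y \<noteq> (\<lambda>_. 0)"
  proof
    assume "y = (\<lambda>_. 0)"
    hence "\<rho> i = 0" for i using t0 by (auto simp: y_def smul_def dest: fun_cong[of _ _ i])
    thus False using \<rho>(2) by blast
  qed
  moreover have "hform y y = 0" using \<rho>(3) by (simp add: y_def hf)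
  ultimately have le: "(\<Sum>i<5. (cmod (\<rho> i))\<^sup>2) \<le> (\<Sum>i<5. (cmod (y i))\<^sup>2)" by (rule min[OF yn])
  have "(cmod (y i))\<^sup>2 = 3 / (real m)\<^sup>2 * (cmod (\<rho> i))\<^sup>2" for i
    using cmod_theta by (simp add: y_def smul_def norm_mult norm_divide power_mult_distrib power_divide)
  hence "(\<Sum>i<5. (cmod (y i))\<^sup>2) = 3 / (real m)\<^sup>2 * (\<Sum>i<5. (cmod (\<rho> i))\<^sup>2)" by (simp add: sum_distrib_left)
  with le have le2: "(\<Sum>i<5. (cmod (\<rho> i))\<^sup>2) \<le> 3 / (real m)\<^sup>2 * (\<Sum>i<5. (cmod (\<rho> i))\<^sup>2)" by simp
  have "(\<Sum>i<5. (cmod (\<rho> i))\<^sup>2) \<noteq> 0"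
  proof
    assume "(\<Sum>i<5. (cmod (\<rho> i))\<^sup>2) = 0"
    hence "\<forall>i<5. \<rho> i = 0" by (simp add: sum_nonneg_eq_0_iff)
    hence "\<rho> i = 0" for i using Lam_supp[OF \<rho>L(1), of i] by (cases "i < 5") auto
    thus False using \<rho>(2) by blast
  qed
  moreover have "(\<Sum>i<5. (cmod (\<rho> i))\<^sup>2) \<ge> 0" by (intro sum_nonneg) auto
  ultimately have pos: "0 < (\<Sum>i<5. (cmod (\<rho> i))\<^sup>2)" by linarith
  have "1 \<le> 3 / (real m)\<^sup>2" by (rule mult_right_le_imp_le[OF _ pos]) (use le2 in simp)
  hence "(real m)\<^sup>2 \<le> 3" using m(1) by (simp add: field_simps)
  have "m < 2"
  proof (rule ccontr)
    assume "\<not> m < 2"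
    hence "2 * 2 \<le> real m * real m" by (intro mult_mono) auto
    thus False using \<open>(real m)\<^sup>2 \<le> 3\<close> by (simp add: power2_eq_square)
  qed
  hence "m = 1" using m(1) by simp
  thus ?thesis using m(2,3) by auto
qed

text \<open>The minimum runs over isotropic vectors of both signs, because the vector to compare
  with has the sign opposite to that of \<open>\<rho>\<close>; the sign of the minimiser decides
  \<open>\<eta>\<close>.\<close>

lemma hyperbolic_pair:
  assumes \<xi>: "anti_involution \<xi>"
  shows "\<exists>\<eta>\<in>{\<xi>, neg_map \<xi>}. \<exists>\<rho>\<in>Lfix \<eta>. \<exists>w\<in>Lfix \<eta>. hform \<rho> \<rho> = 0 \<and> hform w \<rho> = 1"
proof -
  define P where "P x \<longleftrightarrow> x \<in> Lfix \<xi> \<union> Lfix (neg_map \<xi>) \<and> x \<noteq> (\<lambda>_. 0) \<and> hform x x = 0" for x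
  define f where "f x = nat \<lfloor>\<Sum>i<5. (cmod (x i))\<^sup>2\<rfloor>" for x :: cvec
  have f: "real (f x) = (\<Sum>i<5. (cmod (x i))\<^sup>2)" if "P x" for x
  proof -
    have "x \<in> Lam" using that by (auto simp: P_def Lfix_def)
    hence "(cmod (x i))\<^sup>2 \<in> \<int>" if "i < 5" for i
      using that Eis_norm_nat[of "x i"] unfolding Lam_def by (metis (no_types, lifting) Ints_of_nat mem_Collect_eq)
    hence "(\<Sum>i<5. (cmod (x i))\<^sup>2) \<in> \<int>" by (intro Ints_sum) auto
    then obtain k :: int where k: "(\<Sum>i<5. (cmod (x i))\<^sup>2) = of_int k" by (auto elim: Ints_cases)
    moreover have "0 \<le> (\<Sum>i<5. (cmod (x i))\<^sup>2)" by (intro sum_nonneg) auto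
    ultimately show ?thesis by (simp add: f_def)
  qed
  obtain x0 where "P x0" using Lfix_isotropic[OF \<xi>] by (auto simp: P_def)
  then obtain \<rho> where \<rho>: "P \<rho>" "\<And>y. P y \<Longrightarrow> f \<rho> \<le> f y" using ex_has_least_nat[of P x0 f] by blast
  have min: "(\<Sum>i<5. (cmod (\<rho> i))\<^sup>2) \<le> (\<Sum>i<5. (cmod (y i))\<^sup>2)" if "P y" for y
    using \<rho>(2)[OF that] f[OF that] f[OF \<rho>(1)] by linarith
  have r: "\<rho> \<noteq> (\<lambda>_. 0)" "hform \<rho> \<rho> = 0" using \<rho>(1) by (auto simp: P_def)
  show ?thesis
  proof (cases "\<rho> \<in> Lfix \<xi>")
    case True
    have "\<exists>w\<in>Lfix \<xi>. hform w \<rho> = 1"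
      by (rule hyperbolic_pair_aux[OF \<xi> True r]) (rule min, simp add: P_def)
    thus ?thesis using True r by blast
  next
    case False
    hence F: "\<rho> \<in> Lfix (neg_map \<xi>)" using \<rho>(1) by (auto simp: P_def)
    have "\<exists>w\<in>Lfix (neg_map \<xi>). hform w \<rho> = 1"
      by (rule hyperbolic_pair_aux[OF anti_involution_neg[OF \<xi>] F r]) (rule min, simp add: P_def neg_map_neg_map)
    thus ?thesis using F r by blast
  qed
qed

section \<open>Frames of eigenvectors\<close>

lemma eigen_neg: "eigen (neg_map \<xi>) x \<longleftrightarrow> eigen \<xi> x"
proof -
  have "smul (-1) a = b \<longleftrightarrow> a = smul (-1) b" for a b :: cvec
    by (auto simp: smul_smul)
  thus ?thesis unfolding eigen_def neg_map_def by (auto simp: smul_smul)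
qed

lemma stable_fixed:
  assumes \<xi>: "anti_involution \<xi>" and f: "f \<in> Lfix \<xi>" and x: "x \<in> Lam" "hform x f = 0"
  shows "hform (\<xi> x) f = 0"
  using anti_involutionD(5)[OF \<xi> x(1) Lfix_Lam(1)[OF f]] x Lfix_Lam(2)[OF f] by simp

definition eigenframe :: "(cvec \<Rightarrow> cvec) \<Rightarrow> cvec \<Rightarrow> cvec list \<Rightarrow> bool" where
  "eigenframe \<xi> f0 xs \<longleftrightarrow> f0 \<in> Lam \<and> hform f0 f0 = -1 \<and> length xs = 4 \<and> set xs \<subseteq> Lam \<and> orthonormal xs \<and>
     (\<forall>a\<in>set xs. hform a f0 = 0) \<and> eigen \<xi> f0 \<and> (\<forall>a\<in>set xs. eigen \<xi> a)"

text \<open>As \<open>w\<close> has norm 1, \<open>w\<close> and \<open>f0\<close> form a fixed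
  orthonormal basis of the hyperbolic plane, so its complement is stable. If \<open>\<xi>\<close>
  exchanges \<open>u1\<close> and \<open>u2\<close>, their sum and difference are eigenvectors of
  norm 2 only; the pair is therefore diagonalised together with \<open>f0\<close>.\<close>

lemma eigenframe_odd:
  assumes \<xi>: "anti_involution \<xi>" and \<rho>: "\<rho> \<in> Lfix \<xi>" "hform \<rho> \<rho> = 0" and w: "w \<in> Lfix \<xi>" "hform w \<rho> = 1" "hform w w = 1"
  shows "\<exists>f0 xs. eigenframe \<xi> f0 xs"
proof -
  note d = anti_involutionD[OF \<xi>]
  define f0 where "f0 = vadd w (smul (-1) \<rho>)"
  have \<rho>w: "hform \<rho> w = 1" using hf(5)[of w \<rho>] w(2) by simp
  have f0: "f0 \<in> Lfix \<xi>" unfolding f0_def by (rule Lfix_add[OF \<xi> w(1) \<rho>(1)]) simp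
  have L: "w \<in> Lam" "f0 \<in> Lam" "\<xi> w = w" "\<xi> f0 = f0" using w(1) f0 by (auto simp: Lfix_def)
  have n: "hform f0 f0 = -1" "hform w f0 = 0" "hform f0 w = 0" using w \<rho> \<rho>w by (simp_all add: f0_def hf)
  obtain u1 u2 u3 where u: "u1 \<in> Lam" "u2 \<in> Lam" "u3 \<in> Lam"
    "hform u1 f0 = 0" "hform u1 w = 0" "hform u2 f0 = 0" "hform u2 w = 0" "hform u3 f0 = 0" "hform u3 w = 0"
    "hform u1 u1 = 1" "hform u2 u2 = 1" "hform u3 u3 = 1" "hform u1 u2 = 0" "hform u1 u3 = 0" "hform u2 u3 = 0"
    "eigen \<xi> u3" "(eigen \<xi> u1 \<and> eigen \<xi> u2) \<or> \<xi> u1 = u2"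
    by (rule complement_eigenbasis[OF \<xi> L(2) L(1) n(1) w(3) n(2)])
       (use stable_fixed[OF \<xi> f0] stable_fixed[OF \<xi> w(1)] in blast)+
  note us = u(4-9,13-15)[THEN hform_sym0]
  from u(17) show ?thesis
  proof
    assume "eigen \<xi> u1 \<and> eigen \<xi> u2"
    hence "eigenframe \<xi> f0 [w, u1, u2, u3]"
      using u us L n w unfolding eigenframe_def by (auto simp: eigen_def intro!: orthonormal4)
    thus ?thesis by blast
  next
    assume sw: "\<xi> u1 = u2"
    hence sw': "\<xi> u2 = u1" using d(4)[OF u(1)] by simp
    \<comment> \<open>Both traces of \<open>u1\<close> have norm 2, and their product is
      \<open>omega + cnj omega = -1\<close>. Combining with \<open>f0\<close>, of norm
      \<open>-1\<close>, lowers the norms to 1, and the opposite signs of the traces make the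
      product vanish.\<close>
    define g1 where "g1 = vadd f0 (trace1 \<xi> u1)"
    define g2 where "g2 = vadd f0 (smul (-1) (trace2 \<xi> u1))"
    \<comment> \<open>\<open>g3\<close> is \<open>(3 f0 + trace1 u1 - trace2 u1) / theta\<close>, the complement of \<open>g1\<close> and \<open>g2\<close>\<close>
    define g3 where "g3 = vadd (smul (- theta) f0) (vadd (smul (cnj omega) u1) (smul (- omega) u2))"
    have e: "g1 = vadd f0 (vadd u1 u2)" "g2 = vadd f0 (smul (-1) (vadd (smul omega u1) (smul (cnj omega) u2)))"
      by (simp_all add: g1_def g2_def trace1_def trace2_def sw)
    have "g1 \<in> Lfix \<xi>" unfolding g1_def
      using Lfix_add[OF \<xi> f0 trace_Lfix(1)[OF \<xi> u(1)], of 1] by simp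
    moreover have "g2 \<in> Lfix \<xi>" unfolding g2_def
      by (rule Lfix_add[OF \<xi> f0 trace_Lfix(2)[OF \<xi> u(1)]]) simp
    ultimately have g12: "g1 \<in> Lam" "g2 \<in> Lam" "eigen \<xi> g1" "eigen \<xi> g2" by (auto simp: Lfix_def eigen_def)
    have E: "- theta \<in> Eis" "cnj omega \<in> Eis" "- omega \<in> Eis"
      by (auto intro: Eis_closed theta_Eis omega_Eis)
    have g3L: "g3 \<in> Lam" unfolding g3_def by (intro Lam_vadd Lam_smul E L u)
    have "\<xi> g3 = smul (-1) g3"
      unfolding g3_def using E L u
      by (simp add: d(2,3) Lam_vadd Lam_smul sw sw' L(4))
         (auto simp: vadd_def smul_def cnj_theta)
    hence g3e: "eigen \<xi> g3" by (simp add: eigen_def)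
    have ww: "omega * cnj omega = 1" by (simp add: cnj_omega algebra_simps omega_sq)
    have w2: "omega * (omega * c) = - c - omega * c" for c
      using omega_sq by (metis mult.assoc left_diff_distrib mult_minus1)
    note sm = w2 hf(1-4) n w u us e g3_def cnj_theta theta_sq
    have n1: "hform g1 g1 = 1" "hform g2 g2 = 1" "hform g3 g3 = -1" "hform g1 g2 = 0" "hform g1 g3 = 0" "hform g2 g3 = 0"
      "hform g1 w = 0" "hform g2 w = 0" "hform g3 w = 0" "hform g1 u3 = 0" "hform g2 u3 = 0" "hform g3 u3 = 0"
      by (simp_all add: sm theta_eq cnj_omega algebra_simps omega_sq)
    have "eigenframe \<xi> g3 [w, g1, g2, u3]"
      using n1 n1(4-12)[THEN hform_sym0] g12 g3L g3e L u w us unfolding eigenframe_def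
      by (auto simp: eigen_def intro!: orthonormal4)
    thus ?thesis by blast
  qed
qed

text \<open>Adding multiples of \<open>\<rho>\<close> changes the norm of \<open>w\<close> by even
  numbers, so an odd norm becomes 1. An even one becomes 0. The plane then still has an orthonormal
  basis over the Eisenstein integers, though not a fixed one, and its complement contains an
  eigenvector \<open>u\<close> of norm 1. Adding \<open>u\<close> or \<open>theta\<close> times
  \<open>u\<close>, whichever is fixed, gives the odd norm 1 or 3 without disturbing the pairing
  with \<open>\<rho>\<close>.\<close>

lemma eigenframe_exists_aux:
  assumes \<xi>: "anti_involution \<xi>" and \<rho>: "\<rho> \<in> Lfix \<xi>" "hform \<rho> \<rho> = 0" and w: "w \<in> Lfix \<xi>" "hform w \<rho> = 1"
  shows "\<exists>f0 xs. eigenframe \<xi> f0 xs"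
proof -
  have \<rho>w: "hform \<rho> x = 1" if "hform x \<rho> = 1" for x using hf(5)[of x \<rho>] that by simp
  have odd: ?thesis if x: "x \<in> Lfix \<xi>" "hform x \<rho> = 1" "hform x x = of_int (2 * k + 1)" for x k
  proof (rule eigenframe_odd[OF \<xi> \<rho>])
    let ?y = "vadd x (smul (of_int (- k)) \<rho>)"
    show "?y \<in> Lfix \<xi>" by (rule Lfix_add[OF \<xi> x(1) \<rho>(1)]) simp
    show "hform ?y \<rho> = 1" "hform ?y ?y = 1" using x \<rho> \<rho>w[OF x(2)] by (simp_all add: hf)
  qed
  obtain k :: int where k: "hform w w = of_int k" using Lfix_hform_Ints[OF \<xi> w(1) w(1)] by (auto elim: Ints_cases)
  show ?thesis
  proof (cases "odd k")
    case True
    then obtain l where "k = 2 * l + 1" by (auto elim: oddE)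
    thus ?thesis using odd[OF w, of l] k by simp
  next
    case False
    then obtain l where l: "k = 2 * l" by (auto elim: evenE)
    define v where "v = vadd w (smul (of_int (- l)) \<rho>)"
    have v: "v \<in> Lfix \<xi>" unfolding v_def by (rule Lfix_add[OF \<xi> w(1) \<rho>(1)]) simp
    have vv: "hform v v = 0" "hform v \<rho> = 1" using k l w \<rho> \<rho>w[OF w(2)] by (simp_all add: v_def hf)
    note \<rho>v = \<rho>w[OF vv(2)]
    \<comment> \<open>The coefficient \<open>- omega\<close> gives the norm
      \<open>- (omega + cnj omega) = 1\<close>, an odd value that integer multiples of
      \<open>\<rho>\<close> cannot produce.\<close>
    define f1 where "f1 = vadd v (smul (- omega) \<rho>)"
    define f0 where "f0 = vadd f1 (smul (-1) \<rho>)"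
    have L: "v \<in> Lam" "\<rho> \<in> Lam" using v \<rho> by (auto simp: Lfix_def)
    have fL: "f1 \<in> Lam" "f0 \<in> Lam" unfolding f0_def f1_def
      by (intro Lam_vadd Lam_smul L Eis_closed(5) omega_Eis minus_one_Eis)+
    have n: "hform f0 f0 = -1" "hform f1 f1 = 1" "hform f1 f0 = 0"
      by (simp_all add: f0_def f1_def hf vv \<rho>(2) \<rho>v cnj_omega)
    have \<rho>f: "\<rho> = vadd f1 (smul (-1) f0)" "v = vadd f1 (smul omega \<rho>)"
      by (auto simp: f0_def f1_def vadd_def smul_def)
    have iff: "hform x f0 = 0 \<and> hform x f1 = 0 \<longleftrightarrow> hform x \<rho> = 0 \<and> hform x v = 0" for x
    proof
      assume a: "hform x f0 = 0 \<and> hform x f1 = 0"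
      hence "hform x \<rho> = 0" by (subst \<rho>f(1)) (simp add: hf)
      moreover from this have "hform x v = 0" using a by (subst \<rho>f(2)) (simp add: hf)
      ultimately show "hform x \<rho> = 0 \<and> hform x v = 0" by simp
    next
      assume "hform x \<rho> = 0 \<and> hform x v = 0"
      thus "hform x f0 = 0 \<and> hform x f1 = 0" by (simp add: f0_def f1_def hf)
    qed
    have stable: "hform (\<xi> x) f0 = 0 \<and> hform (\<xi> x) f1 = 0" if "x \<in> Lam" "hform x f0 = 0" "hform x f1 = 0" for x
      using that iff[of x] iff[of "\<xi> x"] stable_fixed[OF \<xi> \<rho>(1) that(1)] stable_fixed[OF \<xi> v that(1)] by blast
    obtain u where u: "u \<in> Lam" "hform u f0 = 0" "hform u f1 = 0" "hform u u = 1" "eigen \<xi> u"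
      by (rule complement_eigenbasis[OF \<xi> fL(2) fL(1) n stable])
    have u0: "hform u \<rho> = 0" "hform u v = 0" using iff[of u] u by auto
    note u1 = u0[THEN hform_sym0]
    from u(5) show ?thesis unfolding eigen_def
    proof
      assume "\<xi> u = u"
      hence uL: "u \<in> Lfix \<xi>" using u by (simp add: Lfix_def)
      show ?thesis
        by (rule odd[of "vadd v (smul 1 u)" 0])
           (use Lfix_add[OF \<xi> v uL, of 1] in \<open>simp_all add: hf u u0 u1 vv\<close>)
    next
      assume "\<xi> u = smul (-1) u"
      hence tL: "smul theta u \<in> Lfix \<xi>"
        using u anti_involutionD(3)[OF \<xi> theta_Eis u(1)] by (simp add: Lfix_def Lam_smul theta_Eis smul_smul cnj_theta)
      show ?thesis
        by (rule odd[of "vadd v (smul 1 (smul theta u))" 1])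
           (use Lfix_add[OF \<xi> v tL, of 1] in \<open>simp_all add: hf u u0 u1 vv cnj_theta theta_sq\<close>)
    qed
  qed
qed

lemma eigenframe_exists:
  assumes \<xi>: "anti_involution \<xi>"
  shows "\<exists>f0 xs. eigenframe \<xi> f0 xs"
proof -
  obtain \<eta> \<rho> w where \<eta>: "\<eta> = \<xi> \<or> \<eta> = neg_map \<xi>" "\<rho> \<in> Lfix \<eta>" "w \<in> Lfix \<eta>" "hform \<rho> \<rho> = 0" "hform w \<rho> = 1"
    using hyperbolic_pair[OF \<xi>] by blast
  have a: "anti_involution \<eta>" using \<eta>(1) \<xi> anti_involution_neg by blast
  have "\<exists>f0 xs. eigenframe \<eta> f0 xs" by (rule eigenframe_exists_aux[OF a \<eta>(2,4,3,5)])
  moreover have "eigenframe (neg_map \<xi>) = eigenframe \<xi>" by (intro ext) (simp add: eigenframe_def eigen_neg)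
  ultimately show ?thesis using \<eta>(1) by (elim disjE) simp_all
qed

section \<open>Conjugating an anti-involution to diagonal form\<close>

lemma vadd_apply: "vadd x y i = x i + y i" by (simp add: vadd_def)

lemma smul_apply: "smul a x i = a * x i" by (simp add: smul_def)

text \<open>The coordinate map of the frame is an isometry of the lattice onto itself, with inverse
  \<open>\<lambda>y. comb y F\<close>. In these coordinates \<open>\<xi>\<close> is conjugation
  followed by multiplication with the eigenvalues \<open>s i\<close>.\<close>

lemma conj_of_frame:
  assumes \<xi>: "anti_involution \<xi>" and F: "frame F"
    and s: "\<And>i. i < 5 \<Longrightarrow> cnj (s i) = s i \<and> s i \<in> Eis \<and> \<xi> (F ! i) = smul (s i) (F ! i)"
    and \<eta>: "\<And>x. x \<in> Lam \<Longrightarrow> \<eta> x = (\<lambda>i. if i < 5 then s i * cnj (x i) else 0)"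
    and s2: "\<And>i. i < 5 \<Longrightarrow> s i * s i = 1"
  shows "Gamma_conj \<xi> \<eta>"
proof -
  note d = anti_involutionD[OF \<xi>]
  have n: "length F = 5" and L: "\<And>i. i < 5 \<Longrightarrow> F ! i \<in> Lam" and FL: "set F \<subseteq> Lam"
    and o: "\<And>i j. i < 5 \<Longrightarrow> j < 5 \<Longrightarrow> hform (F ! i) (F ! j) = (if i = j then sgnw i else 0)"
    using F by (auto simp: frame_def)
  define g where "g x = (\<lambda>i. if i < 5 then sgnw i * hform x (F ! i) else 0)" for x
  have sE: "sgnw i \<in> Eis" for i by (simp add: sgnw_def Eis_closed)
  have gL: "g x \<in> Lam" if "x \<in> Lam" for x
    using that L by (auto simp: g_def Lam_def intro!: Eis_closed(4) sE hform_Eis)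
  have inv: "comb (g x) F = x" if "x \<in> Lam" for x
  proof -
    have "comb (g x) F = comb (\<lambda>i. sgnw i * hform x (F ! i)) F" by (simp add: comb_def n g_def)
    thus ?thesis using frame_comb[OF F that] by simp
  qed
  have fwd: "g (comb y F) = y" if y: "y \<in> Lam" for y
  proof
    fix i
    show "g (comb y F) i = y i"
    proof (cases "i < 5")
      case True
      have "hform (comb y F) (F ! i) = (\<Sum>j<5. if j = i then y i * sgnw i else 0)"
        unfolding form_comb[OF hermitian_hform] n by (rule sum.cong) (use o True in auto)
      thus ?thesis using True by (simp add: g_def mult.left_commute[of "sgnw i"] sgnw_sq)
    next
      case False thus ?thesis using Lam_supp[OF y] by (simp add: g_def)
    qed
  qed
  have cL: "comb y F \<in> Lam" if "y \<in> Lam" for y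
    using that FL n by (intro Lam_comb) (auto simp: Lam_def)
  have "bij_betw g Lam Lam"
    by (rule bij_betw_byWitness[where f' = "\<lambda>y. comb y F"]) (use gL inv fwd cL in auto)
  moreover have "g (vadd x y) = vadd (g x) (g y)" for x y
    by (rule ext) (simp add: g_def vadd_apply hf(1) distrib_left)
  moreover have "g (smul a x) = smul a (g x)" for a x
    by (rule ext) (simp add: g_def smul_apply hf(2))
  moreover have "hform (g x) (g y) = hform x y" if x: "x \<in> Lam" for x y
  proof -
    have sg: "sgnw i * (sgnw i * a) * cnj (sgnw i * c) = sgnw i * a * cnj c" for i a c
      by (simp add: sgnw_def)
    have "hform (g x) (g y) = (\<Sum>i<5. sgnw i * hform x (F ! i) * cnj (hform y (F ! i)))"
      unfolding hform_sgnw[of "g x"] by (rule sum.cong) (simp_all only: g_def lessThan_iff if_True sg)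
    also have "\<dots> = hform x y" using frame_form[OF F x, of y] by (simp add: hf(5))
    finally show ?thesis .
  qed
  moreover have "g (\<xi> x) = \<eta> (g x)" if x: "x \<in> Lam" for x
  proof
    fix i
    show "g (\<xi> x) i = \<eta> (g x) i"
    proof (cases "i < 5")
      case True
      have Fi: "F ! i = smul (s i) (\<xi> (F ! i))" using s[OF True] s2[OF True] by (simp add: smul_smul)
      have "hform (\<xi> x) (F ! i) = s i * hform (\<xi> x) (\<xi> (F ! i))"
        by (subst Fi) (use s[OF True] in \<open>simp add: hf(4)\<close>)
      also have "\<dots> = s i * cnj (hform x (F ! i))" by (simp add: d(5)[OF x L[OF True]])
      finally show ?thesis using True unfolding \<eta>[OF gL[OF x]] by (simp add: g_def sgnw_sq)
    next
      case False
      have "\<eta> (g x) i = 0" using \<eta>[OF gL[OF x]] False by simp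
      thus ?thesis using False by (simp add: g_def)
    qed
  qed
  ultimately show ?thesis unfolding Gamma_conj_def in_Gamma_def by (intro exI[of _ g] conjI ballI) simp_all
qed

lemma std_exists:
  assumes \<xi>: "anti_involution \<xi>"
  shows "\<exists>t j. j < 5 \<and> Gamma_conj \<xi> (std t j)"
proof -
  obtain f0 xs where E: "eigenframe \<xi> f0 xs" using eigenframe_exists[OF \<xi>] by blast
  hence f: "f0 \<in> Lam" "hform f0 f0 = -1" "length xs = 4" "set xs \<subseteq> Lam" "orthonormal xs"
    "\<And>a. a \<in> set xs \<Longrightarrow> hform a f0 = 0" "eigen \<xi> f0" "\<And>a. a \<in> set xs \<Longrightarrow> eigen \<xi> a"
    unfolding eigenframe_def by auto
  define t where "t \<longleftrightarrow> \<xi> f0 = f0"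
  define \<tau> :: complex where "\<tau> = (if t then 1 else -1)"
  have tau: "\<tau> * \<tau> = 1" "cnj \<tau> = \<tau>" "\<tau> \<in> Eis" "- \<tau> \<in> Eis" by (auto simp: \<tau>_def Eis_closed minus_one_Eis)
  have f0e: "\<xi> f0 = smul \<tau> f0" using f(7) by (auto simp: \<tau>_def t_def eigen_def)
  define P where "P a \<longleftrightarrow> \<xi> a = smul \<tau> a" for a
  have nP: "\<xi> a = smul (- \<tau>) a" if "a \<in> set xs" "\<not> P a" for a
    using f(8)[OF that(1)] that(2) by (auto simp: eigen_def P_def \<tau>_def)
  \<comment> \<open>Eigenvectors sharing the eigenvalue \<open>\<tau>\<close> of \<open>f0\<close>
    come before the others, to match the shape of \<open>xi j\<close>; \<open>\<tau>\<close> itself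
    is the overall sign.\<close>
  define ys where "ys = filter P xs"
  define zs where "zs = filter (\<lambda>a. \<not> P a) xs"
  define j where "j = length zs"
  have len: "length ys + j = 4" unfolding j_def ys_def zs_def using sum_length_filter_compl[of P xs] f(3) by simp
  have set: "set (ys @ zs) = set xs" by (auto simp: ys_def zs_def)
  have "distinct (ys @ zs)" using f(5) by (auto simp: orthonormal_def ys_def zs_def)
  hence on: "orthonormal (ys @ zs)" using f(5) set by (auto simp: orthonormal_def)
  have F: "frame (f0 # ys @ zs)"
    by (rule frame_Cons) (use f set len on in \<open>auto simp: j_def\<close>)
  define s where "s i = (if 5 - j \<le> i then - \<tau> else \<tau>)" for i
  have j5: "j < 5" using len by simp
  have "Gamma_conj \<xi> (std t j)"
  proof (rule conj_of_frame[OF \<xi> F, of s])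
    fix i :: nat assume i: "i < 5"
    show "s i * s i = 1" by (simp add: s_def tau)
    show "cnj (s i) = s i \<and> s i \<in> Eis \<and> \<xi> ((f0 # ys @ zs) ! i) = smul (s i) ((f0 # ys @ zs) ! i)"
    proof (intro conjI)
      show "cnj (s i) = s i" "s i \<in> Eis" using tau by (auto simp: s_def)
      show "\<xi> ((f0 # ys @ zs) ! i) = smul (s i) ((f0 # ys @ zs) ! i)"
      proof (cases i)
        case 0 thus ?thesis using f0e j5 by (simp add: s_def)
      next
        case (Suc k)
        show ?thesis
        proof (cases "k < length ys")
          case True
          hence "P (ys ! k)" using nth_mem[of k ys] by (auto simp: ys_def)
          moreover have "\<not> 5 - j \<le> Suc k" using True len by simp
          ultimately show ?thesis using Suc True by (simp add: nth_append s_def P_def)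
        next
          case False
          hence "k - length ys < length zs" using i Suc len by (simp add: j_def)
          hence "zs ! (k - length ys) \<in> set zs" by (rule nth_mem)
          hence "\<xi> (zs ! (k - length ys)) = smul (- \<tau>) (zs ! (k - length ys))" using nP by (auto simp: zs_def)
          moreover have "5 - j \<le> i" using False len Suc by simp
          ultimately show ?thesis using Suc False by (simp add: nth_append s_def)
        qed
      qed
    qed
  next
    fix x
    show "std t j x = (\<lambda>i. if i < 5 then s i * cnj (x i) else 0)"
      by (rule ext) (auto simp: std_def xi_def s_def \<tau>_def)
  qed
  thus ?thesis using j5 by blast
qed

section \<open>Invariants modulo theta\<close>

lemma F3_cases: "(x::3) = 0 \<or> x = 1 \<or> x = -1"
proof -
  obtain z :: int where z: "x = of_int z" "0 \<le> z" "z < 3" by (cases x rule: bit1_cases) auto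
  hence "z = 0 \<or> z = 1 \<or> z = 2" by auto
  thus ?thesis using z(1) by auto
qed

lemma F3_lift: "\<exists>n::int. (x::3) = of_int n"
  using F3_cases[of x] by (metis of_int_0 of_int_1 of_int_minus)

lemma F3_three [simp]: "(3::3) * x = 0"
proof -
  have "(3::3) = 0" by simp
  thus ?thesis by (simp only: mult_zero_left)
qed

lemma F3_of_int_eq_0: "(of_int n :: 3) = 0 \<longleftrightarrow> 3 dvd n"
proof -
  have "(of_int n :: 3) = of_int (n mod 3)"
  proof -
    have "(of_int n :: 3) = of_int (3 * (n div 3) + n mod 3)" by simp
    also have "\<dots> = of_int (n mod 3)" by (simp only: of_int_add of_int_mult) simp
    finally show ?thesis .
  qed
  moreover have "n mod 3 = 0 \<or> n mod 3 = 1 \<or> n mod 3 = 2" by auto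
  ultimately show ?thesis by (auto simp: dvd_eq_mod_eq_0)
qed

text \<open>The imaginary part determines \<open>b\<close> and then \<open>a\<close>, so the
  description in \<open>red_E\<close> has a unique solution.\<close>

lemma red_E_eq: "red_E (of_int a + of_int b * omega) = of_int (a + b)"
  unfolding red_E_def
proof (rule the_equality)
  fix c :: 3 assume "\<exists>a' b'. of_int a + of_int b * omega = of_int a' + of_int b' * omega \<and> c = of_int (a' + b')"
  then obtain a' b' where e: "of_int a + of_int b * omega = of_int a' + of_int b' * omega" "c = of_int (a' + b')" by blast
  have "Im (of_int a + of_int b * omega) = Im (of_int a' + of_int b' * omega)" using e(1) by simp
  hence "b = b'" by (simp add: omega_Complex)
  moreover from this have "a = a'" using e(1) by simp
  ultimately show "c = of_int (a + b)" using e(2) by simp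
qed auto

lemma red_E_add: assumes "x \<in> Eis" "y \<in> Eis" shows "red_E (x + y) = red_E x + red_E y"
proof -
  obtain a b where x: "x = of_int a + of_int b * omega" using assms(1) by (rule EisE)
  obtain c d where y: "y = of_int c + of_int d * omega" using assms(2) by (rule EisE)
  have "x + y = of_int (a + c) + of_int (b + d) * omega" by (simp add: x y algebra_simps)
  thus ?thesis unfolding x y by (simp only: red_E_eq) simp
qed

lemma red_E_mult: assumes "x \<in> Eis" "y \<in> Eis" shows "red_E (x * y) = red_E x * red_E y"
proof -
  obtain a b where x: "x = of_int a + of_int b * omega" using assms(1) by (rule EisE)
  obtain c d where y: "y = of_int c + of_int d * omega" using assms(2) by (rule EisE)
  have "x * y = of_int (a * c) + of_int (a * d + b * c) * omega + of_int (b * d) * (omega * omega)"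
    by (simp add: x y algebra_simps)
  hence xy: "x * y = of_int (a * c - b * d) + of_int (a * d + b * c - b * d) * omega"
    by (simp add: omega_sq algebra_simps)
  have "(of_int (a * c - b * d + (a * d + b * c - b * d)) :: 3) = of_int ((a + b) * (c + d) - 3 * (b * d))"
    by (rule arg_cong[where f = of_int]) (simp add: algebra_simps)
  also have "\<dots> = of_int (a + b) * of_int (c + d)" by (simp only: of_int_diff of_int_mult) simp
  finally show ?thesis unfolding xy by (simp only: red_E_eq x y)
qed

lemma red_E_of_int: "red_E (of_int n) = of_int n"
  using red_E_eq[of n 0] by simp

text \<open>Conjugation takes \<open>a + b\<close> to \<open>a - 2 * b\<close>, a change by
  \<open>3 * b\<close>. Being trivial modulo \<open>theta\<close>, it lets anti-involutions act
  linearly on \<open>V\<close>.\<close>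

lemma red_E_cnj: assumes "x \<in> Eis" shows "red_E (cnj x) = red_E x"
proof -
  obtain a b where x: "x = of_int a + of_int b * omega" using assms by (rule EisE)
  have c: "cnj x = of_int (a - b) + of_int (- b) * omega" by (simp add: x cnj_omega algebra_simps)
  have "(of_int (a - b + - b) :: 3) = of_int (a + b - 3 * b)" by (rule arg_cong[where f = of_int]) simp
  also have "\<dots> = of_int (a + b)" by (simp only: of_int_diff of_int_mult) simp
  finally show ?thesis unfolding c by (simp only: red_E_eq x)
qed

lemma red_E_zero: assumes "x \<in> Eis" "red_E x = 0" shows "\<exists>y\<in>Eis. x = theta * y"
proof -
  obtain a b where x: "x = of_int a + of_int b * omega" using assms(1) by (rule EisE)
  have "3 dvd a + b" using assms(2) unfolding x red_E_eq F3_of_int_eq_0 .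
  then obtain k where k: "a = 3 * k - b" by (metis add_diff_cancel_right' dvdE)
  \<comment> \<open>The witness is \<open>x\<close> times \<open>- theta / 3\<close>, simplified by
    \<open>a + b = 3 * k\<close>.\<close>
  have "theta * (of_int (b - k) + of_int (b - 2 * k) * omega)
    = of_int (b - k) + of_int (2 * (b - k) + (b - 2 * k)) * omega + of_int (2 * (b - 2 * k)) * (omega * omega)"
    by (simp add: theta_eq algebra_simps)
  also have "\<dots> = x" by (simp add: x k omega_sq algebra_simps)
  finally show ?thesis using EisI by metis
qed

lemma red_vadd: "x \<in> Lam \<Longrightarrow> y \<in> Lam \<Longrightarrow> red (vadd x y) = (\<lambda>i. red x i + red y i)"
  by (rule ext) (auto simp: red_def vadd_def Lam_def red_E_add)

lemma red_smul: "a \<in> Eis \<Longrightarrow> x \<in> Lam \<Longrightarrow> red (smul a x) = (\<lambda>i. red_E a * red x i)"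
  by (rule ext) (auto simp: red_def smul_def Lam_def red_E_mult)

lemma red_zero: assumes "x \<in> Lam" "red x = (\<lambda>_. 0)" shows "\<exists>y\<in>Lam. x = smul theta y"
proof -
  have "\<exists>z\<in>Eis. x i = theta * z" for i
  proof (cases "i < 5")
    case True
    have "red_E (x i) = 0" using fun_cong[OF assms(2), of i] True by (simp add: red_def)
    thus ?thesis using red_E_zero[of "x i"] assms(1) True by (auto simp: Lam_def)
  next
    case False thus ?thesis using assms(1) Eis_closed(1) by (auto simp: Lam_def intro!: bexI[of _ 0])
  qed
  hence "\<forall>i. \<exists>z. z \<in> Eis \<and> x i = theta * z" by blast
  from choice[OF this] obtain y where y: "\<forall>i. y i \<in> Eis \<and> x i = theta * y i" ..
  have "y i = 0" if "i \<ge> 5" for i using y Lam_supp[OF assms(1) that] theta_nz by (metis mult_eq_0_iff)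
  hence "y \<in> Lam" using y by (auto simp: Lam_def)
  moreover have "x = smul theta y" using y by (auto simp: smul_def)
  ultimately show ?thesis by blast
qed

lemma red_E_theta: "red_E theta = 0"
  using red_E_eq[of 1 2] by (simp add: theta_eq add.commute)

lemma red_E_minus: "red_E (-1) = -1"
  using red_E_of_int[of "-1"] by simp

lemma red_E_sum: "(\<And>i. i \<in> S \<Longrightarrow> f i \<in> Eis) \<Longrightarrow> red_E (sum f S) = (\<Sum>i\<in>S. red_E (f i))"
proof (induction S rule: infinite_finite_induct)
  case (insert i S)
  hence "sum f S \<in> Eis" by (intro star_ring_sum[OF star_ring_Eis]) auto
  thus ?case using insert by (simp add: red_E_add)
qed (use red_E_of_int[of 0] in auto)

lemma bq_red: assumes "x \<in> Lam" "y \<in> Lam" shows "bq (red x) (red y) = red_E (hform x y)"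
proof -
  have E: "x i \<in> Eis" "y i \<in> Eis" if "i < 5" for i using assms that by (auto simp: Lam_def)
  have "red_E (hform x y) = (\<Sum>i<5. red_E ((if i = 0 then -1 else 1) * x i * cnj (y i)))"
    unfolding hform_def using E by (intro red_E_sum) (auto intro!: Eis_closed)
  also have "\<dots> = bq (red x) (red y)"
    unfolding bq_def
  proof (rule sum.cong[OF refl])
    fix i :: nat assume "i \<in> {..<5}"
    hence i: "i < 5" by simp
    show "red_E ((if i = 0 then -1 else 1) * x i * cnj (y i)) = (if i = 0 then -1 else 1) * red x i * red y i"
    proof -
      have s: "(if i = 0 then -1 else 1) \<in> Eis" by (simp add: minus_one_Eis Eis_closed(2))
      have "red_E (if i = 0 then -1 else 1) = (if i = 0 then -1 else 1)"
        using red_E_minus red_E_of_int[of 1] by simp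
      moreover have "(if i = 0 then -1 else 1) * x i \<in> Eis" by (rule Eis_closed(4)[OF s E(1)[OF i]])
      ultimately show ?thesis using E[OF i] i s by (simp only: red_E_mult Eis_closed(7) red_E_cnj red_def if_True)
    qed
  qed
  finally show ?thesis by simp
qed

text \<open>Lets the fixed space and the negated space be treated at once, as the cases
  \<open>e = 1\<close> and \<open>e = -1\<close>.\<close>

definition eigenspace :: "3 \<Rightarrow> (cvec \<Rightarrow> cvec) \<Rightarrow> (nat \<Rightarrow> 3) set" where
  "eigenspace e \<xi> = {red x | x. x \<in> Lam \<and> red (\<xi> x) = (\<lambda>i. e * red x i)}"

lemma fix_space_eq: "fix_space \<xi> = eigenspace 1 \<xi>"
  by (simp add: fix_space_def eigenspace_def)

lemma neg_space_eq: "neg_space \<xi> = eigenspace (-1) \<xi>"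
  by (simp add: neg_space_def eigenspace_def)

section \<open>Conjugacy as an equivalence relation\<close>

lemma in_GammaD:
  assumes "in_Gamma g"
  shows "x \<in> Lam \<Longrightarrow> g x \<in> Lam" "x \<in> Lam \<Longrightarrow> y \<in> Lam \<Longrightarrow> g (vadd x y) = vadd (g x) (g y)"
    "a \<in> Eis \<Longrightarrow> x \<in> Lam \<Longrightarrow> g (smul a x) = smul a (g x)"
    "x \<in> Lam \<Longrightarrow> y \<in> Lam \<Longrightarrow> hform (g x) (g y) = hform x y" "bij_betw g Lam Lam"
  using assms unfolding in_Gamma_def by (auto simp: bij_betw_def)

lemma in_Gamma_inv:
  assumes g: "in_Gamma g"
  shows "in_Gamma (inv_into Lam g)"
proof -
  note d = in_GammaD[OF g]
  let ?h = "inv_into Lam g"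
  have b: "bij_betw ?h Lam Lam" by (rule bij_betw_inv_into[OF d(5)])
  have hL: "?h x \<in> Lam" if "x \<in> Lam" for x using b that by (auto simp: bij_betw_def)
  have gh: "g (?h x) = x" if "x \<in> Lam" for x using d(5) that by (simp add: bij_betw_inv_into_right)
  have hg: "?h (g x) = x" if "x \<in> Lam" for x using d(5) that by (simp add: bij_betw_inv_into_left)
  have "?h (vadd x y) = vadd (?h x) (?h y)" if "x \<in> Lam" "y \<in> Lam" for x y
    using hg[OF Lam_vadd[OF hL hL], OF that] d(2)[OF hL hL, OF that] gh that by simp
  moreover have "?h (smul a x) = smul a (?h x)" if "a \<in> Eis" "x \<in> Lam" for a x
    using hg[OF Lam_smul[OF that(1) hL[OF that(2)]]] d(3)[OF that(1) hL[OF that(2)]] gh[OF that(2)] by simp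
  moreover have "hform (?h x) (?h y) = hform x y" if "x \<in> Lam" "y \<in> Lam" for x y
    using d(4)[OF hL hL, OF that] gh that by simp
  ultimately show ?thesis unfolding in_Gamma_def using b by simp
qed

lemma Gamma_conj_sym:
  assumes \<xi>: "anti_involution \<xi>" and c: "Gamma_conj \<xi> \<eta>"
  shows "Gamma_conj \<eta> \<xi>"
proof -
  obtain g where g: "in_Gamma g" "\<And>x. x \<in> Lam \<Longrightarrow> g (\<xi> x) = \<eta> (g x)" using c by (auto simp: Gamma_conj_def)
  note d = in_GammaD[OF g(1)]
  have "inv_into Lam g (\<eta> y) = \<xi> (inv_into Lam g y)" if y: "y \<in> Lam" for y
  proof -
    let ?x = "inv_into Lam g y"
    have x: "?x \<in> Lam" "g ?x = y"
      using in_GammaD(1)[OF in_Gamma_inv[OF g(1)] y] d(5) y by (simp_all add: bij_betw_inv_into_right)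
    have "\<eta> y = g (\<xi> ?x)" using g(2)[OF x(1)] x(2) by simp
    thus ?thesis using d(5) anti_involutionD(1)[OF \<xi> x(1)] by (simp add: bij_betw_inv_into_left)
  qed
  thus ?thesis unfolding Gamma_conj_def using in_Gamma_inv[OF g(1)] by blast
qed

lemma Gamma_conj_trans:
  assumes "Gamma_conj \<xi> \<eta>" "Gamma_conj \<eta> \<zeta>"
  shows "Gamma_conj \<xi> \<zeta>"
proof -
  obtain g where g: "in_Gamma g" "\<And>x. x \<in> Lam \<Longrightarrow> g (\<xi> x) = \<eta> (g x)" using assms(1) by (auto simp: Gamma_conj_def)
  obtain k where k: "in_Gamma k" "\<And>x. x \<in> Lam \<Longrightarrow> k (\<eta> x) = \<zeta> (k x)" using assms(2) by (auto simp: Gamma_conj_def)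
  note d = in_GammaD[OF g(1)] and e = in_GammaD[OF k(1)]
  have "in_Gamma (k \<circ> g)" unfolding in_Gamma_def
    using d e bij_betw_trans[OF d(5) e(5)] by simp
  moreover have "(k \<circ> g) (\<xi> x) = \<zeta> ((k \<circ> g) x)" if "x \<in> Lam" for x using g(2) k(2) d(1) that by simp
  ultimately show ?thesis unfolding Gamma_conj_def by blast
qed

section \<open>Bases and Gram determinants over the field with three elements\<close>

lemma lincomb_Nil [simp]: "lincomb c [] = (\<lambda>_. 0)" by (simp add: lincomb_def)

lemma lincomb_Cons: "lincomb c (v # vs) = (\<lambda>i. c 0 * v i + lincomb (\<lambda>a. c (Suc a)) vs i)"
  by (rule ext) (simp add: lincomb_def sum.lessThan_Suc_shift del: sum.lessThan_Suc)

lemma lincomb_unit: "a < length bs \<Longrightarrow> lincomb (\<lambda>b. if b = a then 1 else 0) bs = bs ! a"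
  by (rule ext) (simp add: lincomb_def if_distrib[of "\<lambda>t. t * _"] cong: if_cong)

lemma basis_members:
  assumes "is_basis W bs" shows "set bs \<subseteq> W"
proof
  fix v assume "v \<in> set bs"
  then obtain a where a: "a < length bs" "v = bs ! a" by (auto simp: in_set_conv_nth)
  have "lincomb (\<lambda>b. if b = a then 1 else 0) bs = v" unfolding a(2) by (rule lincomb_unit[OF a(1)])
  thus "v \<in> W" using assms unfolding is_basis_def by blast
qed

lemma basis_transport:
  assumes bs: "is_basis W bs" and W: "W \<subseteq> Vsp"
    and add: "\<And>v w. v \<in> Vsp \<Longrightarrow> w \<in> Vsp \<Longrightarrow> G (\<lambda>i. v i + w i) = (\<lambda>i. G v i + G w i)"
    and scale: "\<And>c v. v \<in> Vsp \<Longrightarrow> G (\<lambda>i. c * v i) = (\<lambda>i. c * G v i)"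
    and V: "\<And>v w c. v \<in> Vsp \<Longrightarrow> w \<in> Vsp \<Longrightarrow> (\<lambda>i. c * v i + w i) \<in> Vsp" "\<And>v c. v \<in> Vsp \<Longrightarrow> (\<lambda>i. c * v i) \<in> Vsp" "(\<lambda>_. 0) \<in> Vsp"
    and inj: "inj_on G Vsp" and form: "\<And>v w. v \<in> Vsp \<Longrightarrow> w \<in> Vsp \<Longrightarrow> bq (G v) (G w) = bq v w"
  shows "is_basis (G ` W) (map G bs)" "gram_det (map G bs) = gram_det bs"
proof -
  have mem: "set bs \<subseteq> Vsp" using basis_members[OF bs] W by blast
  have G0: "G (\<lambda>_. 0) = (\<lambda>_. 0)" using scale[OF V(3), of 0] by simp
  have lin: "G (lincomb c vs) = lincomb c (map G vs) \<and> lincomb c vs \<in> Vsp" if "set vs \<subseteq> Vsp" for c vs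
    using that
  proof (induction vs arbitrary: c)
    case Nil thus ?case using G0 V(3) by simp
  next
    case (Cons v vs)
    have v: "v \<in> Vsp" and i: "G (lincomb (\<lambda>a. c (Suc a)) vs) = lincomb (\<lambda>a. c (Suc a)) (map G vs)"
      "lincomb (\<lambda>a. c (Suc a)) vs \<in> Vsp" using Cons by auto
    show ?case unfolding lincomb_Cons list.map
      using add[OF V(2)[OF v, of "c 0"] i(2)] scale[OF v, of "c 0"] i V(1)[OF v i(2), of "c 0"] by simp
  qed
  show "is_basis (G ` W) (map G bs)" unfolding is_basis_def
  proof (intro conjI allI impI)
    fix c a assume z: "lincomb c (map G bs) = (\<lambda>_. 0)" and a: "a < length (map G bs)"
    have "G (lincomb c bs) = G (\<lambda>_. 0)" using lin[OF mem, of c] z G0 by simp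
    hence "lincomb c bs = (\<lambda>_. 0)" using inj lin[OF mem, of c] V(3) by (meson inj_onD)
    thus "c a = 0" using bs a unfolding is_basis_def by auto
  next
    have "W = {lincomb c bs | c. True}" using bs by (simp add: is_basis_def)
    hence "G ` W = {G (lincomb c bs) | c. True}" by auto
    thus "{lincomb c (map G bs) | c. True} = G ` W" using lin[OF mem] by simp
  qed
  have "mat (length bs) (length bs) (\<lambda>(a, b). bq (map G bs ! a) (map G bs ! b)) = mat (length bs) (length bs) (\<lambda>(a, b). bq (bs ! a) (bs ! b))"
  proof (rule eq_matI)
    fix i j assume ij: "i < dim_row (mat (length bs) (length bs) (\<lambda>(a, b). bq (bs ! a) (bs ! b)))" "j < dim_col (mat (length bs) (length bs) (\<lambda>(a, b). bq (bs ! a) (bs ! b)))"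
    hence "bs ! i \<in> Vsp" "bs ! j \<in> Vsp" using mem by auto
    thus "mat (length bs) (length bs) (\<lambda>(a, b). bq (map G bs ! a) (map G bs ! b)) $$ (i, j) = mat (length bs) (length bs) (\<lambda>(a, b). bq (bs ! a) (bs ! b)) $$ (i, j)"
      using ij form by simp
  qed auto
  thus "gram_det (map G bs) = gram_det bs" by (simp add: gram_det_def)
qed

lemma Vsp_closed:
  "v \<in> Vsp \<Longrightarrow> w \<in> Vsp \<Longrightarrow> (\<lambda>i. c * v i + w i) \<in> Vsp" "v \<in> Vsp \<Longrightarrow> (\<lambda>i. c * v i) \<in> Vsp" "(\<lambda>_. 0) \<in> Vsp"
proof -
  have s: "\<exists>y\<in>Lam. red y = (\<lambda>i. c * red x i)" if "x \<in> Lam" for x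
  proof -
    obtain n :: int where n: "c = of_int n" using F3_lift by blast
    show ?thesis using red_smul[OF of_int_Eis that, of n] Lam_smul[OF of_int_Eis that, of n] n
      by (auto simp: red_E_of_int)
  qed
  show "v \<in> Vsp \<Longrightarrow> (\<lambda>i. c * v i) \<in> Vsp"
  proof -
    assume "v \<in> Vsp"
    then obtain x where x: "x \<in> Lam" "v = red x" by (auto simp: Vsp_def)
    obtain z where z: "z \<in> Lam" "red z = (\<lambda>i. c * red x i)" using s[OF x(1)] by blast
    show ?thesis unfolding Vsp_def x(2) z(2)[symmetric] by (rule imageI[OF z(1)])
  qed
  show "v \<in> Vsp \<Longrightarrow> w \<in> Vsp \<Longrightarrow> (\<lambda>i. c * v i + w i) \<in> Vsp"
  proof -
    assume "v \<in> Vsp" "w \<in> Vsp"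
    then obtain x y where x: "x \<in> Lam" "v = red x" "y \<in> Lam" "w = red y" by (auto simp: Vsp_def)
    obtain z where z: "z \<in> Lam" "red z = (\<lambda>i. c * red x i)" using s[OF x(1)] by blast
    have r: "red (vadd z y) = (\<lambda>i. c * v i + w i)" by (simp add: red_vadd z x)
    show ?thesis unfolding Vsp_def r[symmetric] by (rule imageI[OF Lam_vadd[OF z(1) x(3)]])
  qed
  have r: "red (\<lambda>_. 0) = (\<lambda>_. 0)" using red_E_of_int[of 0] by (auto simp: red_def)
  show "(\<lambda>_. 0) \<in> Vsp" unfolding Vsp_def using imageI[OF zero_Lam, of red] r by simp
qed

text \<open>An isometry of the lattice and its inverse both preserve the multiples of
  \<open>theta\<close>, so the isometry descends to an injective linear isometry of
  \<open>V\<close>. This carries the eigenspace of \<open>\<xi>\<close> onto that of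
  \<open>\<eta>\<close> and transports bases together with their Gram matrices.\<close>

lemma conj_invariants:
  assumes \<xi>: "anti_involution \<xi>" and c: "Gamma_conj \<xi> \<eta>" and bs: "is_basis (eigenspace e \<xi>) bs"
  shows "\<exists>cs. is_basis (eigenspace e \<eta>) cs \<and> length cs = length bs \<and> gram_det cs = gram_det bs"
proof -
  obtain g where g: "in_Gamma g" "\<And>x. x \<in> Lam \<Longrightarrow> g (\<xi> x) = \<eta> (g x)" using c by (auto simp: Gamma_conj_def)
  note d = in_GammaD[OF g(1)] and a = anti_involutionD[OF \<xi>]
  have resp: "red (k x) = red (k y)" if k: "in_Gamma k" and xy: "x \<in> Lam" "y \<in> Lam" "red x = red y" for k x y
  proof -
    note dk = in_GammaD[OF k]
    let ?z = "vadd x (smul (-1) y)"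
    have zL: "?z \<in> Lam" by (intro Lam_vadd Lam_smul minus_one_Eis xy)
    have "red ?z = (\<lambda>_. 0)"
      using xy by (simp add: red_vadd red_smul Lam_smul minus_one_Eis red_E_minus)
    then obtain u where u: "u \<in> Lam" "?z = smul theta u" using red_zero[OF zL] by blast
    have "x = vadd y (smul theta u)" unfolding u(2)[symmetric] by (auto simp: vadd_def smul_def)
    hence "k x = vadd (k y) (smul theta (k u))" using dk(2,3) xy u theta_Eis Lam_smul by simp
    thus ?thesis using dk(1) xy u theta_Eis Lam_smul by (simp add: red_vadd red_smul red_E_theta)
  qed
  \<comment> \<open>Defined through an arbitrary lift; by \<open>resp\<close> the choice of the lift
    does not matter.\<close>
  define G where "G v = red (g (SOME x. x \<in> Lam \<and> red x = v))" for v
  have G: "G (red x) = red (g x)" if x: "x \<in> Lam" for x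
  proof -
    have "(SOME y. y \<in> Lam \<and> red y = red x) \<in> Lam \<and> red (SOME y. y \<in> Lam \<and> red y = red x) = red x"
      by (rule someI[of _ x]) (simp add: x)
    thus ?thesis unfolding G_def using resp[OF g(1) _ x] by blast
  qed
  have add: "G (\<lambda>i. v i + w i) = (\<lambda>i. G v i + G w i)" if "v \<in> Vsp" "w \<in> Vsp" for v w
  proof -
    from that obtain x y where x: "x \<in> Lam" "v = red x" "y \<in> Lam" "w = red y" by (auto simp: Vsp_def)
    show ?thesis using G[OF Lam_vadd[OF x(1,3)]] x d by (simp add: red_vadd G)
  qed
  have scale: "G (\<lambda>i. c * v i) = (\<lambda>i. c * G v i)" if "v \<in> Vsp" for c v
  proof -
    from that obtain x where x: "x \<in> Lam" "v = red x" by (auto simp: Vsp_def)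
    obtain n :: int where n: "c = of_int n" using F3_lift by blast
    show ?thesis using G[OF Lam_smul[OF of_int_Eis x(1), of n]] x d n
      by (simp add: red_smul of_int_Eis red_E_of_int G)
  qed
  have inj: "inj_on G Vsp"
  proof (rule inj_onI)
    fix v w assume v: "v \<in> Vsp" "w \<in> Vsp" "G v = G w"
    then obtain x y where x: "x \<in> Lam" "v = red x" "y \<in> Lam" "w = red y" by (auto simp: Vsp_def)
    have "red (g x) = red (g y)" using v(3) G x by simp
    from resp[OF in_Gamma_inv[OF g(1)] d(1)[OF x(1)] d(1)[OF x(3)] this]
    show "v = w" using x d(5) by (simp add: bij_betw_inv_into_left)
  qed
  have form: "bq (G v) (G w) = bq v w" if "v \<in> Vsp" "w \<in> Vsp" for v w
  proof -
    from that obtain x y where x: "x \<in> Lam" "v = red x" "y \<in> Lam" "w = red y" by (auto simp: Vsp_def)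
    thus ?thesis using d by (simp add: G bq_red)
  qed
  have W: "eigenspace e \<xi> \<subseteq> Vsp" by (auto simp: eigenspace_def Vsp_def)
  have key: "red (\<eta> (g x)) = (\<lambda>i. e * red (g x) i) \<longleftrightarrow> red (\<xi> x) = (\<lambda>i. e * red x i)" if x: "x \<in> Lam" for x
  proof -
    have 1: "red (\<eta> (g x)) = G (red (\<xi> x))" using g(2)[OF x] G[OF a(1)[OF x]] by simp
    have V: "red x \<in> Vsp" "red (\<xi> x) \<in> Vsp" using x a(1) by (auto simp: Vsp_def)
    have 2: "(\<lambda>i. e * red (g x) i) = G (\<lambda>i. e * red x i)" using scale[OF V(1)] G[OF x] by simp
    show ?thesis unfolding 1 2 using inj V Vsp_closed(2) by (auto dest: inj_onD)
  qed
  have im: "G ` eigenspace e \<xi> = eigenspace e \<eta>"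
  proof
    show "G ` eigenspace e \<xi> \<subseteq> eigenspace e \<eta>"
    proof
      fix v assume "v \<in> G ` eigenspace e \<xi>"
      then obtain x where x: "x \<in> Lam" "red (\<xi> x) = (\<lambda>i. e * red x i)" "v = G (red x)" by (auto simp: eigenspace_def)
      have "red (\<eta> (g x)) = (\<lambda>i. e * red (g x) i)" using key[OF x(1)] x(2) by (rule iffD2)
      thus "v \<in> eigenspace e \<eta>" unfolding eigenspace_def using d(1)[OF x(1)] G[OF x(1)] x(3) by blast
    qed
    show "eigenspace e \<eta> \<subseteq> G ` eigenspace e \<xi>"
    proof
      fix v assume "v \<in> eigenspace e \<eta>"
      then obtain y where y: "y \<in> Lam" "v = red y" "red (\<eta> y) = (\<lambda>i. e * red y i)" by (auto simp: eigenspace_def)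
      obtain x where x: "x \<in> Lam" "y = g x" using d(5) y(1) by (auto simp: bij_betw_def)
      have "red x \<in> eigenspace e \<xi>" unfolding eigenspace_def using key[OF x(1)] y(3) x by blast
      thus "v \<in> G ` eigenspace e \<xi>" using G[OF x(1)] x(2) y(2) by (metis image_eqI)
    qed
  qed
  have "is_basis (G ` eigenspace e \<xi>) (map G bs)" "gram_det (map G bs) = gram_det bs"
    by (rule basis_transport[where G = G, OF bs W]; fact add scale Vsp_closed inj form)+
  thus ?thesis unfolding im by (intro exI[of _ "map G bs"] conjI) simp_all
qed

lemma lincomb_diff: "lincomb (\<lambda>a. x a - y a) bs = (\<lambda>i. lincomb x bs i - lincomb y bs i)"
  by (rule ext) (simp add: lincomb_def left_diff_distrib sum_subtractf)

lemma basis_coeffs_unique: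
  assumes bs: "is_basis W bs" and e: "lincomb x bs = lincomb y bs" and a: "a < length bs"
  shows "x a = y a"
proof -
  have "lincomb (\<lambda>a. x a - y a) bs = (\<lambda>_. 0)" by (simp add: lincomb_diff e)
  hence "x a - y a = 0" using bs a unfolding is_basis_def by blast
  thus ?thesis by simp
qed

text \<open>Coordinates with respect to a basis are a bijection onto tuples over a field of three
  elements. Invariance of dimension is then a matter of counting.\<close>

lemma basis_card:
  assumes bs: "is_basis W bs" shows "card W = 3 ^ length bs"
proof -
  let ?S = "PiE {..<length bs} (\<lambda>_. UNIV :: 3 set)"
  have r: "lincomb (restrict c {..<length bs}) bs = lincomb c bs" for c
    unfolding lincomb_def by (intro ext sum.cong) auto
  have "bij_betw (\<lambda>c. lincomb c bs) ?S W"
  proof (rule bij_betw_imageI)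
    show "inj_on (\<lambda>c. lincomb c bs) ?S"
      by (intro inj_onI PiE_ext) (auto intro: basis_coeffs_unique[OF bs])
    have W: "W = {lincomb c bs | c. True}" using bs by (simp add: is_basis_def)
    show "(\<lambda>c. lincomb c bs) ` ?S = W"
    proof
      show "(\<lambda>c. lincomb c bs) ` ?S \<subseteq> W" unfolding W by blast
      show "W \<subseteq> (\<lambda>c. lincomb c bs) ` ?S"
      proof
        fix v assume "v \<in> W"
        then obtain c where "v = lincomb c bs" unfolding W by blast
        hence "v = lincomb (restrict c {..<length bs}) bs" using r by simp
        moreover have "restrict c {..<length bs} \<in> ?S" by simp
        ultimately show "v \<in> (\<lambda>c. lincomb c bs) ` ?S" by blast
      qed
    qed
  qed
  hence "card W = card ?S" using bij_betw_same_card by force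
  also have "\<dots> = 3 ^ length bs" by (simp add: card_PiE)
  finally show ?thesis .
qed

lemma bq_sym: "bq v w = bq w v"
  by (simp add: bq_def mult.assoc mult.commute[of "v _"])

lemma bq_lincomb: "bq (lincomb x bs) w = (\<Sum>k<length bs. x k * bq (bs ! k) w)"
proof -
  have "bq (lincomb x bs) w = (\<Sum>i<5. \<Sum>k<length bs. x k * ((if i = 0 then -1 else 1) * (bs ! k) i * w i))"
    unfolding bq_def lincomb_def by (intro sum.cong) (auto simp: sum_distrib_left sum_distrib_right algebra_simps)
  also have "\<dots> = (\<Sum>k<length bs. x k * bq (bs ! k) w)"
    by (subst sum.swap) (simp add: bq_def sum_distrib_left)
  finally show ?thesis .
qed

lemma bq_lincomb2:
  "bq (lincomb x bs) (lincomb y bs) = (\<Sum>k<length bs. \<Sum>l<length bs. x k * bq (bs ! k) (bs ! l) * y l)"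
proof -
  have "bq v (lincomb y bs) = (\<Sum>l<length bs. bq v (bs ! l) * y l)" for v
    unfolding bq_sym[of v "lincomb y bs"] bq_lincomb by (intro sum.cong) (auto simp: bq_sym mult.commute)
  thus ?thesis unfolding bq_lincomb by (simp add: sum_distrib_left mult.assoc)
qed

text \<open>The lengths agree by counting elements. If \<open>T\<close> expresses one basis in the
  other, the Gram determinant is multiplied by the square of \<open>det T\<close>, and the square of
  a nonzero element of the field with three elements is 1.\<close>

lemma basis_unique:
  assumes bs: "is_basis W bs" and cs: "is_basis W cs"
  shows "length cs = length bs" "gram_det cs = gram_det bs"
proof -
  let ?n = "length bs"
  have "(3::nat) ^ length cs = 3 ^ ?n" using basis_card[OF bs] basis_card[OF cs] by simp
  thus len: "length cs = ?n" by simp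
  have W: "W = {lincomb c bs | c. True}" "W = {lincomb c cs | c. True}"
    using bs cs by (simp_all add: is_basis_def)
  have ex: "\<exists>t. cs ! a = lincomb t bs" if "a < ?n" for a
  proof -
    have "cs ! a \<in> W" using basis_members[OF cs] nth_mem[of a cs] that len by auto
    thus ?thesis unfolding W(1) by blast
  qed
  have ex': "\<exists>s. bs ! a = lincomb s cs" if "a < ?n" for a
  proof -
    have "bs ! a \<in> W" using basis_members[OF bs] nth_mem[OF that] by auto
    thus ?thesis unfolding W(2) by blast
  qed
  define t where "t a = (SOME t. cs ! a = lincomb t bs)" for a
  define s where "s a = (SOME s. bs ! a = lincomb s cs)" for a
  have t: "cs ! a = lincomb (t a) bs" if "a < ?n" for a unfolding t_def by (rule someI_ex[OF ex[OF that]])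
  have s: "bs ! a = lincomb (s a) cs" if "a < ?n" for a unfolding s_def by (rule someI_ex[OF ex'[OF that]])
  define T where "T = mat ?n ?n (\<lambda>(a, k). t a k)"
  define S where "S = mat ?n ?n (\<lambda>(a, k). s a k)"
  define G where "G = mat ?n ?n (\<lambda>(a, b). bq (bs ! a) (bs ! b))"
  define H where "H = mat ?n ?n (\<lambda>(a, b). bq (cs ! a) (cs ! b))"
  have car: "T \<in> carrier_mat ?n ?n" "S \<in> carrier_mat ?n ?n" "G \<in> carrier_mat ?n ?n" "H \<in> carrier_mat ?n ?n"
    by (auto simp: T_def S_def G_def H_def)
  have "S * T = 1\<^sub>m ?n"
  proof (rule eq_matI)
    fix a k assume "a < dim_row (1\<^sub>m ?n :: 3 mat)" "k < dim_col (1\<^sub>m ?n :: 3 mat)"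
    hence ak: "a < ?n" "k < ?n" by auto
    have "lincomb (\<lambda>l. \<Sum>j<?n. s a j * t j l) bs = lincomb (s a) cs"
    proof
      fix i
      have "lincomb (s a) cs i = (\<Sum>j<?n. s a j * (\<Sum>l<?n. t j l * (bs ! l) i))"
        unfolding lincomb_def[of "s a"] len by (rule sum.cong) (auto simp: t lincomb_def)
      also have "\<dots> = (\<Sum>j<?n. \<Sum>l<?n. s a j * t j l * (bs ! l) i)" by (simp add: sum_distrib_left mult.assoc)
      also have "\<dots> = lincomb (\<lambda>l. \<Sum>j<?n. s a j * t j l) bs i"
        by (subst sum.swap) (simp add: lincomb_def sum_distrib_right)
      finally show "lincomb (\<lambda>l. \<Sum>j<?n. s a j * t j l) bs i = lincomb (s a) cs i" by simp
    qed
    also have "\<dots> = lincomb (\<lambda>b. if b = a then 1 else 0) bs" using s[OF ak(1)] lincomb_unit[OF ak(1)] by simp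
    finally have "(\<Sum>j<?n. s a j * t j k) = (if k = a then 1 else 0)"
      by (rule basis_coeffs_unique[OF bs _ ak(2)])
    thus "(S * T) $$ (a, k) = (1\<^sub>m ?n) $$ (a, k)"
      using ak car by (simp add: scalar_prod_def lessThan_atLeast0 S_def T_def)
  qed (use car in auto)
  hence "det S * det T = 1" using det_mult[OF car(2,1)] by simp
  hence "det T \<noteq> 0" by auto
  hence dT: "det T * det T = 1" using F3_cases[of "det T"] by auto
  have "H = T * (G * transpose_mat T)"
  proof (rule eq_matI)
    fix a b assume "a < dim_row (T * (G * transpose_mat T))" "b < dim_col (T * (G * transpose_mat T))"
    hence ab: "a < ?n" "b < ?n" using car by auto
    have GT: "(G * transpose_mat T) $$ (k, b) = (\<Sum>l<?n. bq (bs ! k) (bs ! l) * t b l)" if "k < ?n" for k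
      using that ab car by (simp add: scalar_prod_def lessThan_atLeast0 G_def T_def)
    have "(T * (G * transpose_mat T)) $$ (a, b) = (\<Sum>k<?n. t a k * (G * transpose_mat T) $$ (k, b))"
      using ab car by (simp add: scalar_prod_def lessThan_atLeast0 T_def)
    also have "\<dots> = (\<Sum>k<?n. \<Sum>l<?n. t a k * bq (bs ! k) (bs ! l) * t b l)"
      by (rule sum.cong) (auto simp: GT sum_distrib_left mult.assoc)
    also have "\<dots> = bq (cs ! a) (cs ! b)" unfolding t[OF ab(1)] t[OF ab(2)] bq_lincomb2 ..
    finally show "H $$ (a, b) = (T * (G * transpose_mat T)) $$ (a, b)" using ab by (simp add: H_def)
  qed (use car in auto)
  hence "det H = det T * (det G * det T)"
    using car det_mult[of T ?n "G * transpose_mat T"] det_mult[of G ?n "transpose_mat T"] det_transpose[OF car(1)] by simp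
  also have "\<dots> = det T * det T * det G" by (simp add: ac_simps)
  also have "\<dots> = det G" by (simp only: dT mult_1_left)
  finally show "gram_det cs = gram_det bs" by (simp add: gram_det_def H_def G_def len)
qed

text \<open>Uniqueness makes the choice in \<open>qdim\<close> definite as soon as one basis is
  known.\<close>

lemma qdim_eq: "is_basis W bs \<Longrightarrow> qdim W = length bs"
  unfolding qdim_def by (rule some_equality) (auto dest: basis_unique)

lemma qdet_eq: "is_basis W bs \<Longrightarrow> qdet W = gram_det bs"
  unfolding qdet_def by (rule some_equality) (auto dest: basis_unique)

section \<open>Invariants of the ten standard anti-involutions\<close>

definition uvec :: "nat \<Rightarrow> nat \<Rightarrow> 3" where "uvec i = (\<lambda>k. if k = i then 1 else 0)"

lemma coordinate_basis:
  assumes "distinct js"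
  shows "is_basis {v. \<forall>i. i \<notin> set js \<longrightarrow> v i = 0} (map uvec js)"
proof -
  have at: "lincomb c (map uvec js) (js ! b) = c b" if b: "b < length js" for c b
  proof -
    have "lincomb c (map uvec js) (js ! b) = (\<Sum>a<length js. if a = b then c b else 0)"
      unfolding lincomb_def by (rule sum.cong) (use assms b in \<open>auto simp: uvec_def nth_eq_iff_index_eq\<close>)
    thus ?thesis using b by simp
  qed
  have out: "lincomb c (map uvec js) k = 0" if "k \<notin> set js" for c k
    unfolding lincomb_def by (rule sum.neutral) (use that in \<open>auto simp: uvec_def\<close>)
  show ?thesis unfolding is_basis_def
  proof (intro conjI allI impI)
    fix c a assume "lincomb c (map uvec js) = (\<lambda>_. 0)" "a < length (map uvec js)"
    thus "c a = 0" using at[of a c] by simp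
  next
    show "{lincomb c (map uvec js) | c. True} = {v. \<forall>i. i \<notin> set js \<longrightarrow> v i = 0}"
    proof
      show "{lincomb c (map uvec js) | c. True} \<subseteq> {v. \<forall>i. i \<notin> set js \<longrightarrow> v i = 0}" using out by auto
      show "{v. \<forall>i. i \<notin> set js \<longrightarrow> v i = 0} \<subseteq> {lincomb c (map uvec js) | c. True}"
      proof
        fix v :: "nat \<Rightarrow> 3" assume v: "v \<in> {v. \<forall>i. i \<notin> set js \<longrightarrow> v i = 0}"
        have "v = lincomb (\<lambda>a. v (js ! a)) (map uvec js)"
        proof
          fix k
          show "v k = lincomb (\<lambda>a. v (js ! a)) (map uvec js) k"
          proof (cases "k \<in> set js")
            case True
            then obtain b where "b < length js" "k = js ! b" by (auto simp: in_set_conv_nth)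
            thus ?thesis using at by simp
          qed (use v out in simp)
        qed
        thus "v \<in> {lincomb c (map uvec js) | c. True}" by blast
      qed
    qed
  qed
qed

lemma coordinate_gram_det:
  assumes "distinct js" "set js \<subseteq> {..<5}"
  shows "gram_det (map uvec js) = (\<Prod>i\<leftarrow>js. if i = 0 then -1 else 1)"
proof -
  let ?s = "\<lambda>i::nat. (if i = 0 then -1 else 1) :: 3"
  have b: "bq (uvec i) (uvec j) = (if i = j then ?s i else 0)" if "i < 5" for i j
  proof -
    have "bq (uvec i) (uvec j) = (\<Sum>k<5. if k = i then (if i = j then ?s i else 0) else 0)"
      unfolding bq_def by (rule sum.cong) (auto simp: uvec_def)
    thus ?thesis using that by simp
  qed
  define M where "M = mat (length js) (length js) (\<lambda>(a, b). bq (uvec (js ! a)) (uvec (js ! b)))"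
  have M: "M \<in> carrier_mat (length js) (length js)" by (simp add: M_def)
  have mem: "js ! a < 5" if "a < length js" for a using assms(2) nth_mem[OF that] by auto
  have "det M = prod_list (diag_mat M)"
    by (rule det_lower_triangular[OF _ M]) (use assms(1) mem in \<open>auto simp: M_def b nth_eq_iff_index_eq\<close>)
  also have "diag_mat M = map ?s js"
    by (rule nth_equalityI) (use mem in \<open>auto simp: diag_mat_def M_def b\<close>)
  finally have "det M = (\<Prod>i\<leftarrow>js. ?s i)" .
  moreover have "gram_det (map uvec js) = det M"
    unfolding gram_det_def M_def by (rule arg_cong[where f = det], rule eq_matI) auto
  ultimately show ?thesis by simp
qed

text \<open>The eigenvalue on coordinate \<open>i\<close>, kept as an integer so that it casts into
  the complex numbers as well as into the field with three elements.\<close>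

definition std_sign :: "bool \<Rightarrow> nat \<Rightarrow> nat \<Rightarrow> int" where
  "std_sign t j i = (if t then 1 else -1) * (if 5 - j \<le> i then -1 else 1)"

lemma std_eq: "std t j x = (\<lambda>i. if i < 5 then of_int (std_sign t j i) * cnj (x i) else 0)"
  by (rule ext) (auto simp: std_def xi_def std_sign_def)

lemma std_sign_cases: "std_sign t j i = 1 \<or> std_sign t j i = -1"
  by (auto simp: std_sign_def)

lemma std_anti_involution: "anti_involution (std t j)"
proof (rule anti_involutionI)
  have sq: "of_int (std_sign t j i) * of_int (std_sign t j i) = (1::complex)" for i
    using std_sign_cases[of t j i] by auto
  fix x y :: cvec and a :: complex assume x: "x \<in> Lam"
  show "std t j x \<in> Lam" unfolding std_eq using x
    by (intro LamI) (auto simp: Lam_def intro!: Eis_closed(4,7) of_int_Eis)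
  show "std t j (vadd x y) = vadd (std t j x) (std t j y)"
    by (rule ext) (simp add: std_eq vadd_apply distrib_left)
  show "std t j (smul a x) = smul (cnj a) (std t j x)"
    by (rule ext) (simp add: std_eq smul_apply)
  show "std t j (std t j x) = x"
  proof
    fix i show "std t j (std t j x) i = x i"
      using Lam_supp[OF x, of i] sq[of i] by (cases "i < 5") (simp_all add: std_eq mult.assoc[symmetric])
  qed
  show "hform (std t j x) (std t j y) = cnj (hform x y)"
    unfolding hform_sgnw cnj_sum
  proof (rule sum.cong[OF refl])
    fix i :: nat assume "i \<in> {..<5}"
    hence "sgnw i * std t j x i * cnj (std t j y i)
        = (of_int (std_sign t j i) * of_int (std_sign t j i)) * (sgnw i * cnj (x i) * y i)"
      by (simp add: std_eq)
    thus "sgnw i * std t j x i * cnj (std t j y i) = cnj (sgnw i * x i * cnj (y i))"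
      by (simp only: sq) (simp add: sgnw_sq)
  qed
qed

lemma Vsp_eq: "Vsp = {v. \<forall>i\<ge>5. v i = 0}"
proof
  show "Vsp \<subseteq> {v. \<forall>i\<ge>5. v i = 0}" by (auto simp: Vsp_def red_def)
  show "{v. \<forall>i\<ge>5. v i = 0} \<subseteq> Vsp"
  proof
    fix v :: "nat \<Rightarrow> 3" assume v: "v \<in> {v. \<forall>i\<ge>5. v i = 0}"
    have "\<forall>i. \<exists>n::int. v i = of_int n" using F3_lift by blast
    from choice[OF this] obtain n :: "nat \<Rightarrow> int" where n: "\<forall>i. v i = of_int (n i)" ..
    define x :: cvec where "x i = (if i < 5 then of_int (n i) else 0)" for i
    have "x \<in> Lam" by (rule LamI) (auto simp: x_def of_int_Eis)
    moreover have "red x = v" by (rule ext) (use n v in \<open>auto simp: red_def x_def red_E_of_int\<close>)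
    ultimately show "v \<in> Vsp" unfolding Vsp_def by blast
  qed
qed

text \<open>As \<open>1\<close> and \<open>-1\<close> differ modulo 3, coordinates carrying the
  other sign have to vanish, and the eigenspace is a coordinate subspace.\<close>

lemma eigenspace_std:
  assumes e: "e = 1 \<or> e = (-1::int)" and js: "set js = {i. i < 5 \<and> std_sign t j i = e}"
  shows "eigenspace (of_int e) (std t j) = {v. \<forall>i. i \<notin> set js \<longrightarrow> v i = 0}"
proof -
  have r: "red (std t j x) = (\<lambda>i. of_int (std_sign t j i) * red x i)" if "x \<in> Lam" for x
    by (rule ext) (use that in \<open>auto simp: red_def std_eq red_E_mult red_E_cnj red_E_of_int of_int_Eis Eis_closed(7) Lam_def\<close>)
  have p: "of_int (std_sign t j i) * c = of_int e * c \<longleftrightarrow> std_sign t j i = e \<or> c = 0" for i and c :: 3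
    using std_sign_cases[of t j i] e F3_cases[of c] by auto
  have "v \<in> eigenspace (of_int e) (std t j) \<longleftrightarrow> v \<in> Vsp \<and> (\<forall>i. of_int (std_sign t j i) * v i = of_int e * v i)" for v
    unfolding eigenspace_def Vsp_def using r by (auto simp: fun_eq_iff)
  thus ?thesis unfolding p Vsp_eq js by (auto simp: not_less)
qed

text \<open>Coordinate 0 is the only one of negative norm, and it lies in the eigenspace exactly
  when \<open>e\<close> is the overall sign. So the determinant detects the sign, and the dimension
  then gives \<open>j\<close>.\<close>

lemma std_invariants:
  assumes j: "j < 5" and e: "e = 1 \<or> e = (-1::int)"
  shows "qdim (eigenspace (of_int e) (std t j)) = (if t = (e = 1) then 5 - j else j)"
    "qdet (eigenspace (of_int e) (std t j)) = (if t = (e = 1) then -1 else 1)"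
proof -
  define js where "js = (if t = (e = 1) then [0..<5 - j] else [5 - j..<5])"
  have s: "set js = {i. i < 5 \<and> std_sign t j i = e}"
    using e by (auto simp: js_def std_sign_def)
  have d: "distinct js" by (simp add: js_def)
  have sub: "set js \<subseteq> {..<5}" unfolding s by auto
  note b = coordinate_basis[OF d, folded eigenspace_std[OF e s]]
  show "qdim (eigenspace (of_int e) (std t j)) = (if t = (e = 1) then 5 - j else j)"
    using qdim_eq[OF b] j by (simp add: js_def)
  have pos: "(\<Prod>i\<leftarrow>js. if i = 0 then -1 else 1) = (1::3)" if "0 \<notin> set js" for "js" :: "nat list"
    using that by (induction "js") auto
  have "(\<Prod>i\<leftarrow>js. if i = 0 then -1 else 1) = (if t = (e = 1) then -1 else (1::3))"
  proof (cases "t = (e = 1)")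
    case True
    have "[0..<5 - j] = 0 # [1..<5 - j]" using j by (simp add: upt_rec)
    thus ?thesis using True pos[of "[1..<5 - j]"] by (simp add: js_def)
  next
    case False
    thus ?thesis using pos[of "[5 - j..<5]"] j by (simp add: js_def)
  qed
  thus "qdet (eigenspace (of_int e) (std t j)) = (if t = (e = 1) then -1 else 1)"
    using qdet_eq[OF b] coordinate_gram_det[OF d sub] by simp
qed

text \<open>Conjugacy in both directions makes the predicates under the choice operators of
  \<open>qdim\<close> and \<open>qdet\<close> equivalent, so the chosen values coincide without a
  basis being exhibited.\<close>

lemma conj_same_invariants:
  assumes \<xi>: "anti_involution \<xi>" and \<eta>: "anti_involution \<eta>" and c: "Gamma_conj \<xi> \<eta>"
  shows "qdim (eigenspace e \<xi>) = qdim (eigenspace e \<eta>)" "qdet (eigenspace e \<xi>) = qdet (eigenspace e \<eta>)"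
proof -
  note 1 = conj_invariants[OF \<xi> c, of e] and 2 = conj_invariants[OF \<eta> Gamma_conj_sym[OF \<xi> c], of e]
  have "(\<exists>bs. is_basis (eigenspace e \<xi>) bs \<and> length bs = d) \<longleftrightarrow> (\<exists>bs. is_basis (eigenspace e \<eta>) bs \<and> length bs = d)" for d
    using 1 2 by metis
  thus "qdim (eigenspace e \<xi>) = qdim (eigenspace e \<eta>)" by (simp add: qdim_def)
  have "(\<exists>bs. is_basis (eigenspace e \<xi>) bs \<and> gram_det bs = d) \<longleftrightarrow> (\<exists>bs. is_basis (eigenspace e \<eta>) bs \<and> gram_det bs = d)" for d
    using 1 2 by metis
  thus "qdet (eigenspace e \<xi>) = qdet (eigenspace e \<eta>)" by (simp add: qdet_def)
qed

lemma std_determined: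
  assumes "j < 5" "k < 5" "e = 1 \<or> e = (-1::int)"
    "qdim (eigenspace (of_int e) (std t j)) = qdim (eigenspace (of_int e) (std u k))"
    "qdet (eigenspace (of_int e) (std t j)) = qdet (eigenspace (of_int e) (std u k))"
  shows "t = u \<and> j = k"
proof -
  have "(-1::3) \<noteq> 1" by simp
  moreover have "(if t = (e = 1) then -1 else (1::3)) = (if u = (e = 1) then -1 else 1)"
    using assms(5) unfolding std_invariants(2)[OF assms(1,3)] std_invariants(2)[OF assms(2,3)] .
  ultimately have tu: "t = u" by (auto split: if_splits)
  have "(if t = (e = 1) then 5 - j else j) = (if u = (e = 1) then 5 - k else k)"
    using assms(4) unfolding std_invariants(1)[OF assms(1,3)] std_invariants(1)[OF assms(2,3)] .
  thus ?thesis using tu assms(1,2) by (auto split: if_splits)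
qed

text \<open>Both anti-involutions are conjugate to standard ones, and equal invariants on a single
  eigenspace already identify these. That eigenspace may be either one, which yields both criteria
  of the theorem.\<close>

lemma conj_iff_invariants:
  assumes \<xi>: "anti_involution \<xi>" and \<eta>: "anti_involution \<eta>" and e: "e = 1 \<or> e = (-1::int)"
  shows "Gamma_conj \<xi> \<eta> \<longleftrightarrow> qdim (eigenspace (of_int e) \<xi>) = qdim (eigenspace (of_int e) \<eta>) \<and>
    qdet (eigenspace (of_int e) \<xi>) = qdet (eigenspace (of_int e) \<eta>)"
proof
  assume "Gamma_conj \<xi> \<eta>"
  thus "qdim (eigenspace (of_int e) \<xi>) = qdim (eigenspace (of_int e) \<eta>) \<and>
      qdet (eigenspace (of_int e) \<xi>) = qdet (eigenspace (of_int e) \<eta>)"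
    using conj_same_invariants[OF \<xi> \<eta>] by blast
next
  assume a: "qdim (eigenspace (of_int e) \<xi>) = qdim (eigenspace (of_int e) \<eta>) \<and>
      qdet (eigenspace (of_int e) \<xi>) = qdet (eigenspace (of_int e) \<eta>)"
  obtain t j where j: "j < 5" "Gamma_conj \<xi> (std t j)" using std_exists[OF \<xi>] by blast
  obtain u k where k: "k < 5" "Gamma_conj \<eta> (std u k)" using std_exists[OF \<eta>] by blast
  have "t = u \<and> j = k"
    using std_determined[OF j(1) k(1) e, of t u] a
      conj_same_invariants[OF \<xi> std_anti_involution j(2), of "of_int e"]
      conj_same_invariants[OF \<eta> std_anti_involution k(2), of "of_int e"] by simp
  thus "Gamma_conj \<xi> \<eta>" using Gamma_conj_trans[OF j(2)] Gamma_conj_sym[OF \<eta> k(2)] by simp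
qed

theorem theorem4p1:
  shows "(\<forall>\<xi>. anti_involution \<xi> \<longrightarrow>
            (\<exists>!p :: bool \<times> nat. snd p < 5 \<and> Gamma_conj \<xi> (std (fst p) (snd p))))
       \<and> (\<forall>\<xi> \<eta>. anti_involution \<xi> \<longrightarrow> anti_involution \<eta> \<longrightarrow>
            ((Gamma_conj \<xi> \<eta> \<longleftrightarrow>
                qdim (fix_space \<xi>) = qdim (fix_space \<eta>) \<and> qdet (fix_space \<xi>) = qdet (fix_space \<eta>))
           \<and> (Gamma_conj \<xi> \<eta> \<longleftrightarrow>
                qdim (neg_space \<xi>) = qdim (neg_space \<eta>) \<and> qdet (neg_space \<xi>) = qdet (neg_space \<eta>))))"
proof (intro conjI allI impI)
  fix \<xi> assume \<xi>: "anti_involution \<xi>"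
  obtain t j where j: "j < 5" "Gamma_conj \<xi> (std t j)" using std_exists[OF \<xi>] by blast
  show "\<exists>!p :: bool \<times> nat. snd p < 5 \<and> Gamma_conj \<xi> (std (fst p) (snd p))"
  proof (rule ex1I[of _ "(t, j)"])
    fix p :: "bool \<times> nat" assume p: "snd p < 5 \<and> Gamma_conj \<xi> (std (fst p) (snd p))"
    note 1 = conj_same_invariants[OF \<xi> std_anti_involution j(2), of "of_int 1"]
      conj_same_invariants[OF \<xi> std_anti_involution conjunct2[OF p], of "of_int 1"]
    have "fst p = t \<and> snd p = j"
      by (rule std_determined[OF conjunct1[OF p] j(1), of 1]) (use 1 in simp_all)
    thus "p = (t, j)" by (simp add: prod_eq_iff)
  qed (use j in simp)
next
  fix \<xi> \<eta> assume a: "anti_involution \<xi>" "anti_involution \<eta>"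
  show "Gamma_conj \<xi> \<eta> \<longleftrightarrow>
      qdim (fix_space \<xi>) = qdim (fix_space \<eta>) \<and> qdet (fix_space \<xi>) = qdet (fix_space \<eta>)"
    using conj_iff_invariants[OF a, of 1] by (simp add: fix_space_eq)
  show "Gamma_conj \<xi> \<eta> \<longleftrightarrow>
      qdim (neg_space \<xi>) = qdim (neg_space \<eta>) \<and> qdet (neg_space \<xi>) = qdet (neg_space \<eta>)"
    using conj_iff_invariants[OF a, of "-1"] by (simp add: neg_space_eq)
qed

end
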